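(* Let $s>0$. The set $\mathcal P_s\subseteq\mathcal A^n_s$ contains an open dense set, is prevalent, $\mathcal P_s\cap\mathbb B\in\mathcal B$, and $\mu_s(\mathcal P_s\cap\mathbb B)=1$.
   Context: For integer vectors $|k|=\sum_j|k_j|$. For $s>0$, $\mathcal A^n_s$ is the Banach space of real-analytic (real-valued) functions $f(x)=\sum_{k\in\mathbb Z^n} f_k e^{\mathrm i k\cdot x}$ on $\mathbb T^n=\mathbb R^n/2\pi\mathbb Z^n$ with zero average and finite norm $|f|_s:=\sup_{k\in\mathbb Z^n}|f_k|e^{|k|s}<\infty$. $\mathbb Z^n_\sharp$ is the set of $k\in\mathbb Z^n\setminus\{0\}$ whose first non-zero component is positive, and $\mathbb Z^n_*:=\{k\in\mathbb Z^n_\sharp:\gcd(k_1,\dots,k_n)=1\}$. For $f\in\mathcal A^n_s$ and $k\in\mathbb Z^n_*$ set $F^k(t):=\sum_{j\in\mathbb Z\setminus\{0\}}f_{jk}e^{\mathrm i jt}$, where $f_{jk}$ is the Fourier coefficient of $f$ with index $jk\in\mathbb Z^n$. For $0<\delta\le1$ let $K_s(\delta):=c\,\max\{1,\ \tfrac1s,\ \tfrac1s\log\tfrac1{s\delta}\}$, where $c>1$ is a fixed, suitably large constant depending only on $n$. $\mathcal P_s(\delta)$ is the set of $f\in\mathcal A^n_s$ such that, for $k\in\mathbb Z^n_*$, the following holds: (P1) $|f_k|\ge\delta|k|^{-\frac{n+3}2}e^{-|k|s}$ if $|k|>K_s(\delta)$; (P2) $\min_{t\in\mathbb R}\big(|\partial_tF^k(t)|+|\partial_t^2F^k(t)|\big)>0$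 if $|k|\le K_s(\delta)$; (P3) $F^k(t_1)\ne F^k(t_2)$ for every $0\le t_1<t_2<2\pi$ such that $\partial_tF^k(t_1)=\partial_tF^k(t_2)=0$, if $|k|\le K_s(\delta)$. Finally $\mathcal P_s:=\bigcup_{\delta>0}\mathcal P_s(\delta)$ (union over the admissible $\delta$, i.e. $0<\delta\le1$). Let $\ell^n_\infty$ be the Banach space of complex sequences $z=\{z_k\}_{k\in\mathbb Z^n_\sharp}$ with finite sup-norm $|z|_\infty:=\sup_{k\in\mathbb Z^n_\sharp}|z_k|$. The map $j:f\in\mathcal A^n_s\mapsto\{f_ke^{|k|s}\}_{k\in\mathbb Z^n_\sharp}\in\ell^n_\infty$ is an isomorphism (indeed an isometry) of Banach spaces, which identifies functions in $\mathcal A^n_s$ with points of $\ell^n_\infty$ and the Borel sets of $\mathcal A^n_s$ with those of $\ell^n_\infty$. Consider the probability measure given by the normalized Lebesgue-product measure on the closed unit ball of $\ell^n_\infty$, namely the unique probability measure $\mu$ on the Borel sets of $\{z\in\ell^n_\infty:|z|_\infty\le1\}$ such that, given Lebesgue measurable sets $A_k\subseteq D:=\{w\in\mathbb C:|w|\le1\}$ with $A_k\ne D$ only for finitely many $k$, one has $\mu\big(\prod_{k\in\mathbb Z^n_\sharp}A_k\big)=\prod_{\{k\in\mathbb Z^n_\sharp:A_k\neq D\}}{\rm meas}(A_k)$, where ${\rm meas}$ is the normalized Lebesgue measure on $D$. $\mathbb B$ is the closed ball of radius one in $\mathcal A^n_s$, $\mathcal B$ is the family of Borel sets in $\mathbb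 B$, and $\mu_s$ is the measure on $\mathcal B$ naturally induced by $\mu$ through the isometry $j$. A set $P\subseteq\mathcal A^n_s$ is prevalent if there is a Borel probability measure $\nu$ on $\mathcal A^n_s$ with compact support such that $\nu(P+g)=1$ for every $g\in\mathcal A^n_s$. *)

theory Defs
  imports "HOL-Probability.Probability"
begin

text \<open>
  The dimension \<open>n\<close> is \<open>CARD('n)\<close>, where \<open>'n\<close> is a finite linearly ordered index type; the
  order is only used to speak of the first non-zero component of an integer vector.
  Functions on the torus are functions on \<open>real^'n\<close> that are \<open>2 * pi\<close>-periodic in each variable.
\<close>

type_synonym 'n freq = "(int, 'n) vec"
type_synonym 'n torus_fun = "(real, 'n) vec \<Rightarrow> real"

section \<open>The Banach space of periodic real-analytic functions\<close>

definition l1 :: "'n::finite freq \<Rightarrow> real" where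
  "l1 k = (\<Sum>i\<in>UNIV. real_of_int \<bar>k $ i\<bar>)"

definition phase :: "'n::finite freq \<Rightarrow> (real, 'n) vec \<Rightarrow> real" where
  "phase k x = (\<Sum>i\<in>UNIV. real_of_int (k $ i) * x $ i)"

definition fcoeff :: "'n::finite torus_fun \<Rightarrow> 'n freq \<Rightarrow> complex" where
  "fcoeff f k = integral (cbox 0 (\<chi> i. 2 * pi)) (\<lambda>x. of_real (f x) * cis (- phase k x))
                  / of_real ((2 * pi) ^ CARD('n))"

definition analytic_norm :: "real \<Rightarrow> 'n::finite torus_fun \<Rightarrow> real" where
  "analytic_norm s f = (SUP k. norm (fcoeff f k) * exp (l1 k * s))"

text \<open>
  Real-analyticity is not listed: by the last condition the Fourier coefficients decay
  exponentially, so the Fourier series converges to a holomorphic function on the strip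
  \<open>\<bar>Im x\<^sub>j\<bar> < s\<close>. Periodicity is a consequence of the first condition. The last condition
  is finiteness of \<open>analytic_norm s f\<close>.
\<close>
definition analytic_space :: "real \<Rightarrow> 'n::finite torus_fun set" where
  "analytic_space s = {f.
     (\<forall>x. ((\<lambda>k. fcoeff f k * cis (phase k x)) has_sum of_real (f x)) UNIV) \<and>
     fcoeff f 0 = 0 \<and>
     bdd_above (range (\<lambda>k. norm (fcoeff f k) * exp (l1 k * s)))}"

text \<open>
  The value outside the space is irrelevant to the topology below; it is fixed because
  \<^locale>\<open>Metric_space\<close> asks for a distance that is nonnegative on the whole type.
\<close>
definition analytic_dist :: "real \<Rightarrow> 'n::finite torus_fun \<Rightarrow> 'n torus_fun \<Rightarrow> real" where
  "analytic_dist s f g =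
     (if f \<in> analytic_space s \<and> g \<in> analytic_space s
      then analytic_norm s (\<lambda>x. f x - g x) else 0)"

definition analytic_top :: "real \<Rightarrow> 'n::finite torus_fun topology" where
  "analytic_top s = Metric_space.mtopology (analytic_space s) (analytic_dist s)"

definition analytic_borel :: "real \<Rightarrow> 'n::finite torus_fun measure" where
  "analytic_borel s = sigma (analytic_space s) {U. openin (analytic_top s) U}"

definition unit_ball :: "real \<Rightarrow> 'n::finite torus_fun set" where
  "unit_ball s = {f \<in> analytic_space s. analytic_norm s f \<le> 1}"

section \<open>The set of non-degenerate functions\<close>

definition Zsharp :: "'n::{finite,linorder} freq set" where
  "Zsharp = {k. \<exists>i. 0 < k $ i \<and> (\<forall>j<i. k $ j = 0)}"

definition Zstar :: "'n::{finite,linorder} freq set" where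
  "Zstar = {k \<in> Zsharp. Gcd (range (\<lambda>i. k $ i)) = 1}"

text \<open>For real-valued \<open>f\<close> the values of \<open>ray f k\<close> are real; they are kept as complex numbers.\<close>
definition ray :: "'n::finite torus_fun \<Rightarrow> 'n freq \<Rightarrow> real \<Rightarrow> complex" where
  "ray f k t = (\<Sum>\<^sub>\<infinity>j\<in>UNIV - {0::int}. fcoeff f (j *s k) * cis (of_int j * t))"

definition ray' :: "'n::finite torus_fun \<Rightarrow> 'n freq \<Rightarrow> real \<Rightarrow> complex" where
  "ray' f k t = vector_derivative (ray f k) (at t)"

definition ray'' :: "'n::finite torus_fun \<Rightarrow> 'n freq \<Rightarrow> real \<Rightarrow> complex" where
  "ray'' f k t = vector_derivative (ray' f k) (at t)"

definition cutoff :: "real \<Rightarrow> real \<Rightarrow> real \<Rightarrow> real" where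
  "cutoff c s \<delta> = c * Max {1, 1 / s, 1 / s * ln (1 / (s * \<delta>))}"

text \<open>
  In the second condition the infimum is a minimum, by continuity and periodicity in \<open>t\<close>.
\<close>
definition nondeg_at :: "real \<Rightarrow> real \<Rightarrow> real \<Rightarrow> 'n::{finite,linorder} torus_fun set" where
  "nondeg_at c s \<delta> = {f \<in> analytic_space s. \<forall>k\<in>Zstar.
     (l1 k > cutoff c s \<delta> \<longrightarrow>
        norm (fcoeff f k) \<ge> \<delta> * l1 k powr (- ((real CARD('n) + 3) / 2)) * exp (- (l1 k * s))) \<and>
     (l1 k \<le> cutoff c s \<delta> \<longrightarrow>
        (INF t. norm (ray' f k t) + norm (ray'' f k t)) > 0) \<and>
     (l1 k \<le> cutoff c s \<delta> \<longrightarrow>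
        (\<forall>t1 t2. 0 \<le> t1 \<and> t1 < t2 \<and> t2 < 2 * pi \<and> ray' f k t1 = 0 \<and> ray' f k t2 = 0
           \<longrightarrow> ray f k t1 \<noteq> ray f k t2))}"

definition nondeg :: "real \<Rightarrow> real \<Rightarrow> 'n::{finite,linorder} torus_fun set" where
  "nondeg c s = (\<Union>\<delta>\<in>{0<..1}. nondeg_at c s \<delta>)"

section \<open>Prevalence\<close>

text \<open>
  Since \<open>emeasure\<close> vanishes on non-measurable sets, the last condition includes measurability
  of the translates of \<open>P\<close>.
\<close>
definition prevalent :: "real \<Rightarrow> 'n::finite torus_fun set \<Rightarrow> bool" where
  "prevalent s P \<longleftrightarrow> P \<subseteq> analytic_space s \<and>
     (\<exists>\<nu>. prob_space \<nu> \<and> space \<nu> = analytic_space s \<and> sets \<nu> = sets (analytic_borel s) \<and>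
          (\<exists>C. compactin (analytic_top s) C \<and> emeasure \<nu> C = 1) \<and>
          (\<forall>g\<in>analytic_space s. emeasure \<nu> ((\<lambda>f x. f x + g x) ` P) = 1))"

section \<open>The product measure on the unit ball\<close>

text \<open>The normalized Lebesgue measure on the closed unit disc.\<close>
definition disc_measure :: "complex measure" where
  "disc_measure = restrict_space (uniform_measure lborel (cball 0 1)) (cball 0 1)"

text \<open>
  Bounded sequences indexed by \<open>Zsharp\<close> are represented as extensional functions, so that
  the closed unit ball of the sequence space is \<open>Pi\<^sub>E Zsharp (\<lambda>_. cball 0 1)\<close>.
\<close>
definition coeff_map :: "real \<Rightarrow> 'n::{finite,linorder} torus_fun \<Rightarrow> 'n freq \<Rightarrow> complex" where
  "coeff_map s f = (\<lambda>k\<in>Zsharp. fcoeff f k * of_real (exp (l1 k * s)))"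

text \<open>
  The product measure lives on the product sigma-algebra, i.e. the Borel sets of the product
  topology. These form a proper subfamily of the Borel sets of the sup-norm topology: the
  sequence space is not separable, and every sup-norm ball of radius \<open>< 1\<close> is a null set.
\<close>
definition lebesgue_product :: "('n::{finite,linorder} freq \<Rightarrow> complex) measure" where
  "lebesgue_product = Pi\<^sub>M Zsharp (\<lambda>_. disc_measure)"

text \<open>
  The characterising property of the product measure, for a probability measure on an
  arbitrary sigma-algebra that contains the cylinders (such as the product sigma-algebra,
  or the Borel sets of the sup-norm topology). The factors are Borel, as cylinders over
  Lebesgue sets that are not Borel do not belong to either of these sigma-algebras.
\<close>
definition is_lebesgue_product :: "('n::{finite,linorder} freq \<Rightarrow> complex) measure \<Rightarrow> bool" where
  "is_lebesgue_product M \<longleftrightarrow> prob_space M \<and> space M = Pi\<^sub>E Zsharp (\<lambda>_. cball 0 1) \<and>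
     (\<forall>A. (\<forall>k\<in>Zsharp. A k \<in> sets borel \<and> A k \<subseteq> cball 0 1) \<and>
          finite {k \<in> Zsharp. A k \<noteq> cball 0 1} \<longrightarrow>
        Pi\<^sub>E Zsharp A \<in> sets M \<and>
        emeasure M (Pi\<^sub>E Zsharp A)
          = (\<Prod>k\<in>{k \<in> Zsharp. A k \<noteq> cball 0 1}. emeasure disc_measure (A k)))"

text \<open>The measure on \<open>unit_ball s\<close> induced by \<open>M\<close> through the bijection \<open>coeff_map s\<close>.\<close>
definition induced_measure ::
    "real \<Rightarrow> ('n::{finite,linorder} freq \<Rightarrow> complex) measure \<Rightarrow> 'n torus_fun measure" where
  "induced_measure s M =
     distr M (vimage_algebra (unit_ball s) (coeff_map s) M)
       (the_inv_into (unit_ball s) (coeff_map s))"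

section \<open>Well-definedness\<close>

lemma prob_space_disc_measure: "prob_space disc_measure"
proof -
  have e: "emeasure lborel (cball (0::complex) 1) \<noteq> 0" "emeasure lborel (cball (0::complex) 1) \<noteq> \<infinity>"
    using emeasure_lborel_cball_finite[of "0::complex" 1] content_cball_pos[of 1 "0::complex"]
    by (auto simp: measure_def)
  interpret U: prob_space "uniform_measure lborel (cball (0::complex) 1)"
    using e by (intro prob_space_uniform_measure) auto
  show ?thesis
    unfolding disc_measure_def
    by (rule prob_spaceI) (use e in \<open>simp add: space_restrict_space emeasure_restrict_space ennreal_divide_self top.not_eq_extremum\<close>)
qed

lemma space_disc_measure: "space disc_measure = cball 0 1"
  by (simp add: disc_measure_def space_restrict_space)

lemma sets_disc_measure: "sets disc_measure = {A \<in> sets borel. A \<subseteq> cball 0 1}"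
proof -
  have "A \<in> sets disc_measure \<longleftrightarrow> A \<in> sets borel \<and> A \<subseteq> cball 0 1" for A
    unfolding disc_measure_def by (subst sets_restrict_space_iff) auto
  then show ?thesis by blast
qed

lemma is_lebesgue_product_lebesgue_product:
  "is_lebesgue_product (lebesgue_product :: ('n::{finite,linorder} freq \<Rightarrow> complex) measure)"
  unfolding is_lebesgue_product_def
proof (intro conjI allI impI)
  show "prob_space (lebesgue_product :: ('n freq \<Rightarrow> complex) measure)"
    unfolding lebesgue_product_def by (intro prob_space_PiM prob_space_disc_measure)
  show "space (lebesgue_product :: ('n freq \<Rightarrow> complex) measure) = Pi\<^sub>E Zsharp (\<lambda>_. cball 0 1)"
    by (simp add: lebesgue_product_def space_PiM space_disc_measure)
next
  fix A :: "'n freq \<Rightarrow> complex set"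
  assume *: "(\<forall>k\<in>Zsharp. A k \<in> sets borel \<and> A k \<subseteq> cball 0 1) \<and>
    finite {k \<in> Zsharp. A k \<noteq> cball 0 1}"
  define J where "J = {k \<in> Zsharp. A k \<noteq> cball 0 1}"
  have eq: "Pi\<^sub>E Zsharp A = prod_emb Zsharp (\<lambda>_. disc_measure) J (Pi\<^sub>E J A)"
  proof (intro set_eqI iffI)
    fix z assume "z \<in> Pi\<^sub>E Zsharp A"
    then show "z \<in> prod_emb Zsharp (\<lambda>_. disc_measure) J (Pi\<^sub>E J A)"
      using * unfolding prod_emb_def J_def
      by (fastforce simp: space_disc_measure PiE_iff restrict_def extensional_def)
  next
    fix z assume z: "z \<in> prod_emb Zsharp (\<lambda>_. disc_measure) J (Pi\<^sub>E J A)"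
    have "z k \<in> A k" if k: "k \<in> Zsharp" for k
    proof (cases "k \<in> J")
      case True
      then show ?thesis using z by (auto simp: prod_emb_def PiE_iff)
    next
      case False
      then have "A k = cball 0 1" using k by (simp add: J_def)
      then show ?thesis using z k by (auto simp: prod_emb_def PiE_iff space_disc_measure)
    qed
    then show "z \<in> Pi\<^sub>E Zsharp A" using z by (auto simp: prod_emb_def PiE_iff)
  qed
  have J: "J \<subseteq> Zsharp" "finite J" using * by (auto simp: J_def)
  have A: "A k \<in> sets disc_measure" if "k \<in> J" for k
    using * that J by (auto simp: sets_disc_measure)
  show "Pi\<^sub>E Zsharp A \<in> sets lebesgue_product"
    unfolding eq lebesgue_product_def using J A by (intro sets_PiM_I) auto
  show "emeasure lebesgue_product (Pi\<^sub>E Zsharp A)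
      = (\<Prod>k\<in>{k \<in> Zsharp. A k \<noteq> cball 0 1}. emeasure disc_measure (A k))"
    unfolding eq lebesgue_product_def J_def[symmetric]
    using J A by (intro emeasure_PiM_emb prob_space_disc_measure) auto
qed

lemma continuous_phase: "continuous_on UNIV (phase k)"
  unfolding phase_def by (intro continuous_intros)

lemma analytic_space_continuous:
  assumes "f \<in> analytic_space s"
  shows "continuous_on UNIV f"
proof -
  have hs: "((\<lambda>k. fcoeff f k * cis (phase k x)) has_sum of_real (f x)) UNIV" for x
    using assms by (simp add: analytic_space_def)
  have "(\<lambda>k. fcoeff f k) summable_on UNIV"
    using has_sum_imp_summable[OF hs[of 0]] by (simp add: phase_def)
  then have "(\<lambda>k. norm (fcoeff f k)) summable_on UNIV"
    by (simp add: summable_on_iff_abs_summable_on_complex)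
  then have "uniform_limit UNIV (\<lambda>X x. \<Sum>k\<in>X. fcoeff f k * cis (phase k x))
      (\<lambda>x. complex_of_real (f x)) (finite_subsets_at_top UNIV)"
    by (intro Weierstrass_m_test_general'[where M = "\<lambda>k. norm (fcoeff f k)"])
       (auto simp: norm_mult hs)
  then have "continuous_on UNIV (\<lambda>x. complex_of_real (f x))"
    by (rule uniform_limit_theorem[rotated])
       (auto intro!: always_eventually continuous_intros continuous_on_compose2[OF continuous_phase]
             simp: cis_conv_exp)
  then have "continuous_on UNIV (\<lambda>x. Re (complex_of_real (f x)))"
    by (rule continuous_on_Re)
  then show ?thesis by (simp only: Re_complex_of_real)
qed

lemma fcoeff_diff:
  assumes "f \<in> analytic_space s" "g \<in> analytic_space s"
  shows "fcoeff (\<lambda>x. f x - g x) k = fcoeff f k - fcoeff g k"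
proof -
  have int: "(\<lambda>x. complex_of_real (h x) * cis (- phase k x)) integrable_on cbox 0 (\<chi> i. 2 * pi)"
    if "h \<in> analytic_space s" for h
    unfolding cis_conv_exp
    by (intro integrable_continuous continuous_intros
          continuous_on_subset[OF continuous_phase] continuous_on_subset[OF analytic_space_continuous[OF that]]) auto
  show ?thesis
    unfolding fcoeff_def
    using integral_diff[OF int[OF assms(1)] int[OF assms(2)]]
    by (simp add: left_diff_distrib diff_divide_distrib)
qed

lemma analytic_norm_diff_bdd:
  assumes "f \<in> analytic_space s" "g \<in> analytic_space s"
  shows "bdd_above (range (\<lambda>k. norm (fcoeff (\<lambda>x. f x - g x) k) * exp (l1 k * s)))"
proof -
  obtain a b where a: "\<And>k. norm (fcoeff f k) * exp (l1 k * s) \<le> a"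
    and b: "\<And>k. norm (fcoeff g k) * exp (l1 k * s) \<le> b"
    using assms by (auto simp: analytic_space_def bdd_above_def)
  have "norm (fcoeff (\<lambda>x. f x - g x) k) * exp (l1 k * s) \<le> a + b" for k
  proof -
    have "norm (fcoeff f k - fcoeff g k) * exp (l1 k * s)
        \<le> (norm (fcoeff f k) + norm (fcoeff g k)) * exp (l1 k * s)"
      by (intro mult_right_mono norm_triangle_ineq4) auto
    also have "\<dots> \<le> a + b" using a[of k] b[of k] by (simp add: distrib_right)
    finally show ?thesis by (simp add: fcoeff_diff[OF assms])
  qed
  then show ?thesis by (intro bdd_aboveI2)
qed

lemma Metric_space_analytic:
  "Metric_space (analytic_space s) (analytic_dist s :: 'n::finite torus_fun \<Rightarrow> _)"
proof
  fix f g :: "'n torus_fun"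
  have le: "norm (fcoeff (\<lambda>x. f x - g x) k) * exp (l1 k * s) \<le> analytic_norm s (\<lambda>x. f x - g x)"
    if "f \<in> analytic_space s" "g \<in> analytic_space s" for k f g
    unfolding analytic_norm_def by (intro cSUP_upper analytic_norm_diff_bdd[OF that]) auto
  show "0 \<le> analytic_dist s f g"
    using order_trans[OF _ le[of f g 0]] by (simp add: analytic_dist_def)
  show "analytic_dist s f g = analytic_dist s g f"
    by (cases "f \<in> analytic_space s"; cases "g \<in> analytic_space s")
       (simp_all add: analytic_dist_def analytic_norm_def fcoeff_diff[of _ s] norm_minus_commute)
  show "analytic_dist s f g = 0 \<longleftrightarrow> f = g" if fg: "f \<in> analytic_space s" "g \<in> analytic_space s"
  proof
    assume "analytic_dist s f g = 0"
    then have "norm (fcoeff f k - fcoeff g k) * exp (l1 k * s) \<le> 0" for k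
      using le[OF fg, of k] fg by (simp add: analytic_dist_def fcoeff_diff)
    then have eq: "fcoeff f = fcoeff g"
      by (intro ext) (simp add: mult_le_0_iff not_le[symmetric])
    have "complex_of_real (f x) = complex_of_real (g x)" for x
    proof (rule has_sum_unique)
      show "((\<lambda>k. fcoeff g k * cis (phase k x)) has_sum of_real (f x)) UNIV"
        using fg(1) by (simp add: analytic_space_def eq)
      show "((\<lambda>k. fcoeff g k * cis (phase k x)) has_sum of_real (g x)) UNIV"
        using fg(2) by (simp add: analytic_space_def)
    qed
    then show "f = g" by (intro ext) simp
  next
    assume "f = g"
    then show "analytic_dist s f g = 0"
      by (simp add: analytic_dist_def analytic_norm_def fcoeff_def)
  qed
  show "analytic_dist s f h \<le> analytic_dist s f g + analytic_dist s g h"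
    if fgh: "f \<in> analytic_space s" "g \<in> analytic_space s" "h \<in> analytic_space s" for h
  proof -
    have "norm (fcoeff (\<lambda>x. f x - h x) k) * exp (l1 k * s)
        \<le> analytic_norm s (\<lambda>x. f x - g x) + analytic_norm s (\<lambda>x. g x - h x)" for k
    proof -
      have "norm (fcoeff f k - fcoeff h k) * exp (l1 k * s)
          \<le> (norm (fcoeff f k - fcoeff g k) + norm (fcoeff g k - fcoeff h k)) * exp (l1 k * s)"
        by (intro mult_right_mono norm_diff_triangle_le[OF order_refl order_refl]) auto
      then show ?thesis
        using le[OF fgh(1,2), of k] le[OF fgh(2,3), of k] fgh
        by (simp add: fcoeff_diff distrib_right)
    qed
    then show ?thesis
      using fgh unfolding analytic_dist_def
      by simp (subst (1) analytic_norm_def, intro cSUP_least, auto)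
  qed
qed

end

theory Submission
  imports Defs "HOL-Real_Asymp.Real_Asymp" "HOL-Library.Periodic_Fun"
begin

text \<open>
  The first coefficient \<open>w\<close> of a ray enters it as \<open>G + 2 Re (w cis)\<close>, where \<open>G\<close> depends on the
  higher coefficients only. For fixed \<open>G\<close>, the \<open>w\<close> that create a degenerate critical point form
  a smooth curve in the plane, and those that create two equal critical values form, up to
  another curve, the image of a plane set under a map of rank at most one; so almost every \<open>w\<close>
  is good (Sard). Distinct primitive frequencies have disjoint rays and there are countably many
  of them, hence by Fubini almost all coefficient sequences have only non-degenerate rays.
  By Borel-Cantelli the lower bound on \<open>\<bar>f\<^sub>k\<bar>\<close> fails for finitely many \<open>k\<close> only, and these drop below
  the cutoff as \<open>\<delta> \<rightarrow> 0\<close>. The argument is unaffected by adding a fixed function and by shrinking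
  the discs like \<open>l1 k powr (- 1 / 2)\<close>, which makes the support compact and gives prevalence.
  For the dense interior, first move the coefficients away from \<open>0\<close> uniformly, then perturb the
  finitely many rays below the cutoff: non-degeneracy of a single ray is an open condition.
\<close>

section \<open>Summation over integer vectors\<close>

text \<open>The obstacle is measurability. The sup-norm space is not separable, and its Borel
  algebra is too large for the product algebra on which independent coefficients live: synthesis
  with the weights \<open>exp (- (l1 k * s))\<close> of the unit ball is not measurable between the
  two. Non-degeneracy of a ray, however, does not mention \<open>s\<close>. Read in the space of
  width \<open>s / 2\<close>, the same weights tend to 0 after normalisation, synthesis is
  continuous for the product topology, and an open condition pulls back to a measurable set. The
  lower bounds concern one coordinate each and need no such detour.

  The Sard step is parametrised by pairs of critical points and not by the coefficient: the critical
  equations are linear in \<open>w\<close>, so a pair with non-zero determinant determines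
  \<open>w\<close>, whereas critical points are functions of \<open>w\<close> only locally.\<close>

lemma finite_sum_vec_prod:
  fixes a :: "'b \<Rightarrow> real"
  assumes "finite J"
  shows "(\<Sum>k\<in>{k::('b,'n::finite) vec. \<forall>i. k $ i \<in> J}. \<Prod>i\<in>UNIV. a (k $ i)) = (\<Sum>j\<in>J. a j) ^ CARD('n)"
proof -
  have "(\<Sum>j\<in>J. a j) ^ CARD('n) = (\<Prod>i\<in>(UNIV::'n set). \<Sum>j\<in>J. a j)"
    by simp
  also have "\<dots> = (\<Sum>g\<in>PiE UNIV (\<lambda>_. J). \<Prod>i\<in>(UNIV::'n set). a (g i))"
    using assms by (intro prod_sum_PiE) auto
  also have "\<dots> = (\<Sum>k\<in>{k::('b,'n) vec. \<forall>i. k $ i \<in> J}. \<Prod>i\<in>UNIV. a (k $ i))"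
    by (rule sum.reindex_bij_witness[where i = "($)" and j = vec_lambda])
       (auto simp: PiE_def)
  finally show ?thesis by simp
qed

text \<open>A finite set of vectors lies in the box spanned by all its components, and over a box
  the sum factorises into a power of a one-dimensional sum.\<close>

lemma summable_vec_prod:
  fixes a :: "'b \<Rightarrow> real"
  assumes "a summable_on UNIV" "\<And>j. 0 \<le> a j"
  shows "(\<lambda>k::('b,'n::finite) vec. \<Prod>i\<in>UNIV. a (k $ i)) summable_on UNIV"
proof (rule nonneg_bdd_above_summable_on)
  show "bdd_above (sum (\<lambda>k::('b,'n) vec. \<Prod>i\<in>UNIV. a (k $ i)) ` {F. F \<subseteq> UNIV \<and> finite F})"
  proof (rule bdd_aboveI2)
    fix F :: "('b,'n) vec set"
    assume "F \<in> {F. F \<subseteq> UNIV \<and> finite F}"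
    then have F: "finite F" by simp
    define J where "J = (\<Union>k\<in>F. range (($) k))"
    have J: "finite J" using F by (simp add: J_def)
    let ?B = "{k::('b,'n) vec. \<forall>i. k $ i \<in> J}"
    have "?B \<subseteq> vec_lambda ` (PiE UNIV (\<lambda>_. J))"
    proof
      fix k :: "('b,'n) vec" assume "k \<in> ?B"
      then have "($) k \<in> PiE UNIV (\<lambda>_. J)" by auto
      then show "k \<in> vec_lambda ` (PiE UNIV (\<lambda>_. J))"
        using image_eqI[of k vec_lambda "($) k"] by (simp add: vec_nth_inverse)
    qed
    then have "finite ?B"
      by (rule finite_subset) (auto intro!: finite_PiE simp: J)
    then have "(\<Sum>k\<in>F. \<Prod>i\<in>UNIV. a (k $ i)) \<le> (\<Sum>k\<in>?B. \<Prod>i\<in>UNIV. a (k $ i))"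
      using assms(2) by (intro sum_mono2) (auto simp: J_def intro!: prod_nonneg)
    also have "\<dots> = (\<Sum>j\<in>J. a j) ^ CARD('n)"
      by (rule finite_sum_vec_prod[OF J])
    also have "\<dots> \<le> (infsum a UNIV) ^ CARD('n)"
      using assms J by (intro power_mono finite_sum_le_infsum sum_nonneg) auto
    finally show "(\<Sum>k\<in>F. \<Prod>i\<in>UNIV. a (k $ i)) \<le> (infsum a UNIV) ^ CARD('n)" .
  qed
qed (auto intro!: prod_nonneg assms)

lemma summable_int_abs:
  fixes h :: "nat \<Rightarrow> real"
  assumes "summable h" "\<And>n. 0 \<le> h n"
  shows "(\<lambda>j::int. h (nat \<bar>j\<bar>)) summable_on UNIV"
proof -
  have h: "h summable_on UNIV"
    using assms by (simp add: summable_on_UNIV_nonneg_real_iff)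
  have 1: "(\<lambda>j::int. h (nat \<bar>j\<bar>)) summable_on range int"
    by (subst summable_on_reindex) (use h in \<open>auto simp: o_def inj_on_def\<close>)
  have 2: "(\<lambda>j::int. h (nat \<bar>j\<bar>)) summable_on range (\<lambda>n. - int n)"
    by (subst summable_on_reindex) (use h in \<open>auto simp: o_def inj_on_def\<close>)
  have U: "(UNIV::int set) = range int \<union> range (\<lambda>n. - int n)"
    by (auto simp: image_iff) (metis int_cases2)
  show ?thesis
    unfolding U by (rule summable_on_union[OF 1 2])
qed

lemma l1_nonneg [simp]: "0 \<le> l1 k"
  by (simp add: l1_def sum_nonneg)

lemma component_le_l1: "real_of_int \<bar>k $ i\<bar> \<le> l1 k"
  unfolding l1_def by (rule member_le_sum) auto

lemma l1_of_int: "l1 k = real_of_int (\<Sum>i\<in>UNIV. \<bar>k $ i\<bar>)"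
  by (simp add: l1_def)

lemma l1_ge_1:
  assumes "k \<noteq> 0" shows "1 \<le> l1 k"
proof -
  obtain i where "k $ i \<noteq> 0" using assms by (auto simp: vec_eq_iff)
  then have "1 \<le> real_of_int \<bar>k $ i\<bar>" by linarith
  then show ?thesis using component_le_l1[of k i] by linarith
qed

lemma l1_minus [simp]: "l1 (- k) = l1 k"
  by (simp add: l1_def)

lemma l1_scale: "l1 (j *s k) = real_of_int \<bar>j\<bar> * l1 k"
  by (simp add: l1_def abs_mult sum_distrib_left)

text \<open>The factor \<open>\<bar>j\<bar> ^ m\<close> is the price of \<open>m\<close> termwise
  derivatives of a ray.\<close>

lemma summable_power_exp_int:
  assumes "0 < s"
  shows "(\<lambda>j::int. real_of_int \<bar>j\<bar> ^ m * exp (- (real_of_int \<bar>j\<bar> * s))) summable_on UNIV"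
proof -
  have "summable (\<lambda>n. real n ^ m * exp (- (real n * s)))"
  proof (rule summable_comparison_test_bigo)
    show "summable (\<lambda>n. norm (1 / real n ^ 2))"
      using inverse_power_summable[of 2, where 'a = real] by (simp add: inverse_eq_divide)
    show "(\<lambda>n. real n ^ m * exp (- (real n * s))) \<in> O(\<lambda>n. 1 / real n ^ 2)"
      using assms by real_asymp
  qed
  from summable_int_abs[OF this] show ?thesis
    by (simp add: abs_of_nonneg)
qed

lemma summable_exp_l1:
  assumes "0 < s"
  shows "(\<lambda>k::'n::finite freq. exp (- (l1 k * s))) summable_on UNIV"
proof -
  have "(\<lambda>k::'n freq. \<Prod>i\<in>UNIV. exp (- (real_of_int \<bar>k $ i\<bar> * s))) summable_on UNIV"
    using summable_power_exp_int[OF assms, of 0] by (intro summable_vec_prod) auto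
  then show ?thesis
    by (simp add: exp_sum[symmetric] l1_def sum_distrib_right sum_negf)
qed

text \<open>The exponent is shared equally by the components: each of the factors has exponent
  \<open>q > 1\<close>, and \<open>1 + l1 k\<close> dominates \<open>1 + \<bar>k $ i\<bar>\<close>
  for every \<open>i\<close>. This reduces the claim to a convergent one-dimensional series.\<close>

lemma summable_l1_powr:
  assumes "real CARD('n) < p"
  shows "(\<lambda>k::'n::finite freq. (1 + l1 k) powr (- p)) summable_on UNIV"
proof (rule summable_on_comparison_test)
  define q where "q = p / real CARD('n)"
  have q: "q > 1" using assms by (simp add: q_def)
  have "summable (\<lambda>n. (1 + real n) powr (- q))"
  proof (rule summable_comparison_test_bigo)
    show "summable (\<lambda>n. norm (real n powr (- q)))"
      using q by (simp add: summable_real_powr_iff)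
    show "(\<lambda>n. (1 + real n) powr (- q)) \<in> O(\<lambda>n. real n powr (- q))"
      by real_asymp
  qed
  from summable_int_abs[OF this]
  have "(\<lambda>j::int. (1 + real_of_int \<bar>j\<bar>) powr (- q)) summable_on UNIV"
    by (simp add: abs_of_nonneg)
  then show "(\<lambda>k::'n freq. \<Prod>i\<in>UNIV. (1 + real_of_int \<bar>k $ i\<bar>) powr (- q)) summable_on UNIV"
    by (intro summable_vec_prod) auto
  fix k :: "'n freq"
  have "1 + l1 k > 0"
    by (simp add: add_pos_nonneg)
  then have "(1 + l1 k) powr (- p) = (\<Prod>i\<in>(UNIV::'n set). (1 + l1 k) powr (- q))"
    by (simp add: q_def powr_powr powr_realpow[symmetric])
  also have "\<dots> \<le> (\<Prod>i\<in>UNIV. (1 + real_of_int \<bar>k $ i\<bar>) powr (- q))"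
    using q by (intro prod_mono conjI powr_mono2' add_mono component_le_l1) auto
  finally show "(1 + l1 k) powr (- p) \<le> (\<Prod>i\<in>UNIV. (1 + real_of_int \<bar>k $ i\<bar>) powr (- q))" .
qed auto

section \<open>Orthogonality of the exponentials on the torus\<close>

lemma integral_cis_int:
  "(LBINT x:{0..2*pi}. cis (real_of_int m * x)) = (if m = 0 then of_real (2 * pi) else 0)"
proof -
  have "continuous_on {0..2*pi} (\<lambda>x. cis (real_of_int m * x))"
    unfolding cis_conv_exp by (intro continuous_intros)
  then have "set_integrable lborel {0..2*pi} (\<lambda>x. cis (real_of_int m * x))"
    by (intro borel_integrable_compact[unfolded set_integrable_def[symmetric]]) auto
  then have "(LBINT x:{0..2*pi}. cis (real_of_int m * x)) = integral {0..2*pi} (\<lambda>x. cis (real_of_int m * x))"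
    by (rule set_borel_integral_eq_integral)
  also have "\<dots> = (if m = 0 then of_real (2 * pi) else 0)"
  proof (cases "m = 0")
    case False
    have "((\<lambda>x. cis (real_of_int m * x)) has_integral
        (cis (real_of_int m * (2*pi)) / (\<i> * of_int m) - cis (real_of_int m * 0) / (\<i> * of_int m))) {0..2*pi}"
    proof (rule fundamental_theorem_of_calculus)
      fix x
      have "((\<lambda>x. exp (\<i> * of_int m * complex_of_real x) / (\<i> * of_int m)) has_vector_derivative
          exp (\<i> * of_int m * complex_of_real x)) (at x within {0..2*pi})"
        using False
        by (intro has_vector_derivative_real_field[where f = "\<lambda>z. exp (\<i> * of_int m * z) / (\<i> * of_int m)"])
           (auto intro!: derivative_eq_intros)
      then show "((\<lambda>x. cis (real_of_int m * x) / (\<i> * of_int m)) has_vector_derivative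
          cis (real_of_int m * x)) (at x within {0..2*pi})"
        by (simp add: cis_conv_exp mult.assoc)
    qed auto
    moreover have "cis (real_of_int m * (2*pi)) = 1"
      by (metis cis_multiple_2pi Ints_of_int mult.commute mult.left_commute)
    ultimately show ?thesis using False by (simp add: integral_unique)
  qed (simp add: scaleR_conv_of_real)
  finally show ?thesis .
qed

lemma integral_cis_phase:
  "integral (cbox 0 (\<chi> i. 2 * pi)) (\<lambda>x::(real,'n::finite) vec. cis (phase k x)) =
     (if k = 0 then of_real ((2 * pi) ^ CARD('n)) else 0)"
proof -
  interpret product_sigma_finite "\<lambda>_::(real,'n) vec. lborel :: real measure" ..
  \<comment> \<open>\<open>lborel\<close> is the image of a product measure indexed by basis
    vectors, so the one-dimensional factors are indexed by \<open>b\<close> too; \<open>THE\<close>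
    recovers the coordinate.\<close>
  define g where "g b x = indicator {0..2*pi} x *\<^sub>R cis (real_of_int (k $ (THE i. b = axis i 1)) * x)"
    for b :: "(real,'n) vec" and x :: real
  have the: "(THE j. axis i (1::real) = axis j 1) = i" for i :: 'n
    by (simp add: axis_eq_axis)
  have B: "(Basis :: (real,'n) vec set) = (\<lambda>i. axis i 1) ` UNIV"
    by (auto simp: Basis_vec_def)
  have inj: "inj (\<lambda>i::'n. axis i (1::real))"
    by (auto simp: inj_on_def axis_eq_axis)
  have cont: "continuous_on UNIV (\<lambda>x::(real,'n) vec. cis (phase k x))"
    unfolding cis_conv_exp by (intro continuous_intros continuous_phase)
  have gint: "integrable lborel (g b)" for b
  proof -
    have "continuous_on {0..2*pi} (\<lambda>x. cis (real_of_int m * x))" for m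
      unfolding cis_conv_exp by (intro continuous_intros)
    then show ?thesis unfolding g_def by (intro borel_integrable_compact) auto
  qed
  have gm: "g b \<in> borel_measurable borel" for b
    using borel_measurable_integrable[OF gint, of b] by simp
  have eq: "indicator (cbox 0 (\<chi> i. 2 * pi)) x *\<^sub>R cis (phase k x) = (\<Prod>b\<in>Basis. g b (x \<bullet> b))"
    for x :: "(real,'n) vec"
  proof -
    have "(\<Prod>b\<in>Basis. g b (x \<bullet> b)) = (\<Prod>i\<in>UNIV. indicator {0..2*pi} (x $ i) *\<^sub>R cis (real_of_int (k $ i) * x $ i))"
      unfolding B by (simp add: prod.reindex inj the g_def inner_axis)
    also have "\<dots> = (\<Prod>i\<in>UNIV. complex_of_real (indicator {0..2*pi} (x $ i))) * (\<Prod>i\<in>UNIV. cis (real_of_int (k $ i) * x $ i))"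
      by (simp add: scaleR_conv_of_real prod.distrib)
    also have "(\<Prod>i\<in>UNIV. cis (real_of_int (k $ i) * x $ i)) = cis (phase k x)"
      unfolding phase_def cis_conv_exp by (simp add: exp_sum[symmetric] sum_distrib_left)
    also have "(\<Prod>i\<in>UNIV. complex_of_real (indicator {0..2*pi} (x $ i))) = of_real (indicator (cbox 0 (\<chi> i. 2 * pi)) x)"
      by (auto simp: indicator_def mem_box_cart) 
    finally show ?thesis by (simp add: scaleR_conv_of_real)
  qed
  have "set_integrable lborel (cbox 0 (\<chi> i. 2 * pi)) (\<lambda>x::(real,'n) vec. cis (phase k x))"
    unfolding set_integrable_def
    by (intro borel_integrable_compact continuous_on_subset[OF cont]) auto
  then have "integral (cbox 0 (\<chi> i. 2 * pi)) (\<lambda>x::(real,'n) vec. cis (phase k x)) =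
     (LBINT x:cbox 0 (\<chi> i. 2 * pi). cis (phase k x))"
    by (rule set_borel_integral_eq_integral(2)[symmetric])
  also have "\<dots> = (LBINT x::(real,'n) vec. (\<Prod>b\<in>Basis. g b (x \<bullet> b)))"
    by (simp add: set_lebesgue_integral_def eq)
  also have "\<dots> = (\<integral>f. (\<Prod>b\<in>Basis. g b ((\<Sum>b\<in>Basis. f b *\<^sub>R b) \<bullet> b)) \<partial>Pi\<^sub>M Basis (\<lambda>_::(real,'n) vec. lborel :: real measure))"
    unfolding lborel_eq[where 'a = "(real,'n) vec"]
    by (intro integral_distr) (auto intro!: borel_measurable_prod measurable_compose[OF _ gm])
  also have "\<dots> = (\<integral>f. (\<Prod>b\<in>Basis. g b (f b)) \<partial>Pi\<^sub>M Basis (\<lambda>_::(real,'n) vec. lborel :: real measure))"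
    by (intro Bochner_Integration.integral_cong refl prod.cong) simp
  also have "\<dots> = (\<Prod>b\<in>Basis. integral\<^sup>L lborel (g b))"
    using gint by (intro product_integral_prod) auto
  also have "\<dots> = (\<Prod>i\<in>UNIV. (LBINT x:{0..2*pi}. cis (real_of_int (k $ i) * x)))"
    unfolding B by (simp add: prod.reindex inj the g_def[abs_def] set_lebesgue_integral_def)
  also have "\<dots> = (\<Prod>i\<in>UNIV. if k $ i = 0 then of_real (2 * pi) else 0)"
    by (simp add: integral_cis_int)
  also have "\<dots> = (if k = 0 then of_real ((2 * pi) ^ CARD('n)) else 0)"
    by (auto simp: vec_eq_iff)
  finally show ?thesis .
qed

section \<open>Functions and their Fourier coefficients\<close>

lemma Zsharp_cases:
  fixes k :: "'n::{finite,linorder} freq"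
  assumes "k \<noteq> 0"
  shows "k \<in> Zsharp \<or> - k \<in> Zsharp"
proof -
  define i where "i = Min {i. k $ i \<noteq> 0}"
  have "{i. k $ i \<noteq> 0} \<noteq> {}" using assms by (auto simp: vec_eq_iff)
  then have "i \<in> {i. k $ i \<noteq> 0}" unfolding i_def by (intro Min_in) auto
  moreover have "k $ j = 0" if "j < i" for j
    using that Min_le[of "{i. k $ i \<noteq> 0}" j] unfolding i_def by (force simp: not_le[symmetric])
  ultimately have "k $ i > 0 \<and> (\<forall>j<i. k $ j = 0) \<or> (- k) $ i > 0 \<and> (\<forall>j<i. (- k) $ j = 0)"
    by auto
  then show ?thesis unfolding Zsharp_def by blast
qed

lemma Zsharp_minus:
  assumes "k \<in> Zsharp" shows "- k \<notin> Zsharp"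
proof
  assume "- k \<in> Zsharp"
  then obtain i j where "0 < k $ i" "\<forall>l<i. k $ l = 0" "0 < - k $ j" "\<forall>l<j. - k $ l = 0"
    using assms by (auto simp: Zsharp_def)
  then show False by (cases i j rule: linorder_cases) auto
qed

lemma zero_notin_Zsharp [simp]: "0 \<notin> Zsharp"
  by (simp add: Zsharp_def)

lemma Zsharp_scale:
  assumes "k \<in> Zsharp" "0 < j" shows "j *s k \<in> Zsharp"
proof -
  obtain i where "0 < k $ i" "\<forall>l<i. k $ l = 0"
    using assms(1) by (auto simp: Zsharp_def)
  then show ?thesis
    using assms(2) unfolding Zsharp_def by (intro CollectI exI[of _ i]) simp
qed

lemma Zstar_subset: "k \<in> Zstar \<Longrightarrow> k \<in> Zsharp"
  by (simp add: Zstar_def)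

lemma Zstar_nonzero: "k \<in> Zstar \<Longrightarrow> k \<noteq> 0"
  using Zstar_subset by fastforce

lemma phase_zero [simp]: "phase 0 x = 0" "phase k 0 = 0"
  by (simp_all add: phase_def)

lemma phase_minus [simp]: "phase (- k) x = - phase k x"
  by (simp add: phase_def sum_negf)

lemma phase_diff: "phase (k - m) x = phase k x - phase m x"
  by (simp add: phase_def sum_subtractf left_diff_distrib)

lemma finite_l1_le: "finite {k::'n::finite freq. l1 k \<le> R}"
proof -
  have "{k::'n freq. l1 k \<le> R} \<subseteq> vec_lambda ` PiE UNIV (\<lambda>_. {- \<lceil>R\<rceil>..\<lceil>R\<rceil>})"
  proof
    fix k :: "'n freq" assume "k \<in> {k. l1 k \<le> R}"
    then have "real_of_int \<bar>k $ i\<bar> \<le> R" for i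
      using component_le_l1[of k i] by simp
    then have "\<bar>k $ i\<bar> \<le> \<lceil>R\<rceil>" for i
      using le_of_int_ceiling[of R] by (meson of_int_le_iff order_trans)
    then have "($) k \<in> PiE UNIV (\<lambda>_. {- \<lceil>R\<rceil>..\<lceil>R\<rceil>})"
      by (simp add: PiE_iff abs_le_iff) (metis minus_le_iff)
    then show "k \<in> vec_lambda ` PiE UNIV (\<lambda>_. {- \<lceil>R\<rceil>..\<lceil>R\<rceil>})"
      using image_eqI[of k vec_lambda "($) k"] by (simp add: vec_nth_inverse)
  qed
  then show ?thesis
    by (rule finite_subset) (auto intro!: finite_PiE)
qed

text \<open>Uniqueness of Fourier coefficients: absolute summability gives uniform convergence on
  the period cell, hence termwise integration. Through this lemma any expansion of \<open>f\<close>
  determines the integrals in \<open>fcoeff\<close>.\<close>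

lemma fcoeff_of_has_sum:
  fixes c :: "'n::finite freq \<Rightarrow> complex"
  assumes c: "(\<lambda>k. norm (c k)) summable_on UNIV"
    and f: "\<And>x. ((\<lambda>k. c k * cis (phase k x)) has_sum of_real (f x)) UNIV"
  shows "fcoeff f = c"
proof
  fix m :: "'n freq"
  let ?B = "cbox 0 (\<chi> i. 2 * pi) :: (real,'n) vec set"
  have "uniform_limit ?B (\<lambda>X x. \<Sum>k\<in>X. c k * cis (phase k x) * cis (- phase m x))
      (\<lambda>x. complex_of_real (f x) * cis (- phase m x)) (finite_subsets_at_top UNIV)"
    using c has_sum_cmult_left[OF f]
    by (intro Weierstrass_m_test_general'[where M = "\<lambda>k. norm (c k)"]) (auto simp: norm_mult)
  then have "uniform_limit ?B (\<lambda>X x. \<Sum>k\<in>X. c k * cis (phase (k - m) x))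
      (\<lambda>x. complex_of_real (f x) * cis (- phase m x)) (finite_subsets_at_top UNIV)"
    by (simp add: mult.assoc cis_mult phase_diff)
  moreover have "continuous_on ?B (\<lambda>x. \<Sum>k\<in>X. c k * cis (phase (k - m) x))" for X
    unfolding cis_conv_exp by (intro continuous_intros continuous_on_subset[OF continuous_phase]) auto
  ultimately obtain I J where I: "\<And>X. ((\<lambda>x. \<Sum>k\<in>X. c k * cis (phase (k - m) x)) has_integral I X) ?B"
    and J: "((\<lambda>x. complex_of_real (f x) * cis (- phase m x)) has_integral J) ?B"
    and IJ: "(I \<longlongrightarrow> J) (finite_subsets_at_top UNIV)"
    by (rule uniform_limit_integral_cbox) auto
  \<comment> \<open>By orthogonality one term survives once \<open>m\<close> belongs to
    \<open>X\<close>, so the net of partial integrals is eventually constant.\<close>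
  have "I X = c m * of_real ((2 * pi) ^ CARD('n))" if X: "finite X" "m \<in> X" for X
  proof -
    have int: "(\<lambda>x. c k * cis (phase (k - m) x)) integrable_on ?B" for k
      unfolding cis_conv_exp
      by (intro integrable_continuous continuous_intros continuous_on_subset[OF continuous_phase]) auto
    have "I X = integral ?B (\<lambda>x. \<Sum>k\<in>X. c k * cis (phase (k - m) x))"
      by (rule integral_unique[OF I, symmetric])
    also have "\<dots> = (\<Sum>k\<in>X. c k * integral ?B (\<lambda>x. cis (phase (k - m) x)))"
      using X int by (simp add: integral_sum)
    also have "\<dots> = (\<Sum>k\<in>X. if k = m then c m * of_real ((2 * pi) ^ CARD('n)) else 0)"
      by (intro sum.cong) (auto simp: integral_cis_phase)
    finally show ?thesis using X by simp
  qed
  then have "eventually (\<lambda>X. I X = c m * of_real ((2 * pi) ^ CARD('n))) (finite_subsets_at_top UNIV)"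
    by (auto simp: eventually_finite_subsets_at_top intro!: exI[of _ "{m}"])
  then have "J = c m * of_real ((2 * pi) ^ CARD('n))"
    by (intro tendsto_unique[OF _ IJ tendsto_eventually]) auto
  then show "fcoeff f m = c m"
    using J by (simp add: fcoeff_def integral_unique)
qed

lemma analytic_spaceD:
  assumes "f \<in> analytic_space s"
  shows "((\<lambda>k. fcoeff f k * cis (phase k x)) has_sum of_real (f x)) UNIV"
    "fcoeff f 0 = 0"
    "norm (fcoeff f k) * exp (l1 k * s) \<le> analytic_norm s f"
    "0 \<le> analytic_norm s f"
proof -
  show le: "norm (fcoeff f k) * exp (l1 k * s) \<le> analytic_norm s f" for k
    using assms unfolding analytic_norm_def by (intro cSUP_upper) (auto simp: analytic_space_def)
  show "0 \<le> analytic_norm s f"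
    by (rule order_trans[OF _ le[of 0]]) simp
qed (use assms in \<open>auto simp: analytic_space_def\<close>)

text \<open>At the origin all phases are 1, and unconditional summability of complex numbers is
  absolute summability.\<close>

lemma fcoeff_summable:
  assumes "f \<in> analytic_space s"
  shows "(\<lambda>k. norm (fcoeff f k)) summable_on UNIV"
  using has_sum_imp_summable[OF analytic_spaceD(1)[OF assms, of 0]]
  by (simp add: summable_on_iff_abs_summable_on_complex)

text \<open>Since \<open>f\<close> is real, conjugating its expansion and reversing the frequencies
  gives an expansion of \<open>f\<close> again; uniqueness compares the two.\<close>

lemma fcoeff_minus:
  assumes "f \<in> analytic_space s"
  shows "fcoeff f (- k) = cnj (fcoeff f k)"
proof -
  have "((\<lambda>k. cnj (fcoeff f (- k)) * cis (phase k x)) has_sum of_real (f x)) UNIV" for x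
  proof -
    have "((\<lambda>k. cnj (fcoeff f k * cis (phase k x))) has_sum cnj (of_real (f x))) UNIV"
      using analytic_spaceD(1)[OF assms] by (subst has_sum_cnj_iff)
    then have "((\<lambda>k. cnj (fcoeff f (- k) * cis (phase (- k) x))) has_sum cnj (of_real (f x))) UNIV"
      by (subst has_sum_reindex_bij_betw[of uminus UNIV UNIV]) (auto simp: bij_uminus)
    then show ?thesis by (simp add: cis_cnj)
  qed
  moreover have "(\<lambda>k. norm (cnj (fcoeff f (- k)))) summable_on UNIV"
    using fcoeff_summable[OF assms]
    by (simp, subst summable_on_reindex_bij_betw[of uminus UNIV UNIV]) (auto simp: bij_uminus)
  ultimately have "fcoeff f = (\<lambda>k. cnj (fcoeff f (- k)))"
    by (intro fcoeff_of_has_sum) auto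
  then have "fcoeff f (- k) = cnj (fcoeff f (- (- k)))" by metis
  then show ?thesis by simp
qed

text \<open>The conjugate-symmetric extension of a family given on half of the lattice. Values of
  \<open>a\<close> outside \<open>Zsharp\<close> are ignored, and the value 0 at the origin encodes
  zero average.\<close>

definition herm :: "('n::{finite,linorder} freq \<Rightarrow> complex) \<Rightarrow> 'n freq \<Rightarrow> complex" where
  "herm a k = (if k \<in> Zsharp then a k else if - k \<in> Zsharp then cnj (a (- k)) else 0)"

text \<open>\<open>Re\<close> only adjusts the type: for an absolutely summable family the sum is
  already real by symmetry.\<close>

definition synth :: "('n::{finite,linorder} freq \<Rightarrow> complex) \<Rightarrow> 'n torus_fun" where
  "synth a x = Re (\<Sum>\<^sub>\<infinity>k. herm a k * cis (phase k x))"

lemma herm_minus: "herm a (- k) = cnj (herm a k)"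
  using Zsharp_minus[of k] by (auto simp: herm_def)

lemma herm_zero [simp]: "herm a 0 = 0"
  by (simp add: herm_def)

lemma herm_Zsharp: "k \<in> Zsharp \<Longrightarrow> herm a k = a k"
  by (simp add: herm_def)

lemma herm_cong: "(\<And>k. k \<in> Zsharp \<Longrightarrow> a k = b k) \<Longrightarrow> herm a = herm b"
  by (auto simp: herm_def fun_eq_iff)

lemma synth_cong: "(\<And>k. k \<in> Zsharp \<Longrightarrow> a k = b k) \<Longrightarrow> synth a = synth b"
  using herm_cong[of a b] by (simp add: synth_def fun_eq_iff)

lemma herm_bound:
  assumes "\<And>k. k \<in> Zsharp \<Longrightarrow> norm (a k) \<le> h (l1 k)" "\<And>t. 0 \<le> h t"
  shows "norm (herm a k) \<le> h (l1 k)"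
  using assms(1)[of k] assms(1)[of "- k"] assms(2) by (auto simp: herm_def)

lemma synth_has_sum:
  assumes "(\<lambda>k. norm (herm a k)) summable_on UNIV"
  shows "((\<lambda>k. herm a k * cis (phase k x)) has_sum of_real (synth a x)) UNIV"
proof -
  let ?S = "\<Sum>\<^sub>\<infinity>k. herm a k * cis (phase k x)"
  have "(\<lambda>k. herm a k * cis (phase k x)) summable_on UNIV"
    using assms by (auto intro: abs_summable_summable simp: norm_mult)
  then have S: "((\<lambda>k. herm a k * cis (phase k x)) has_sum ?S) UNIV"
    by (rule has_sum_infsum)
  then have "((\<lambda>k. cnj (herm a k * cis (phase k x))) has_sum cnj ?S) UNIV"
    by (subst has_sum_cnj_iff)
  then have "((\<lambda>k. cnj (herm a (- k) * cis (phase (- k) x))) has_sum cnj ?S) UNIV"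
    by (subst has_sum_reindex_bij_betw[of uminus UNIV UNIV]) (auto simp: bij_uminus)
  then have "((\<lambda>k. herm a k * cis (phase k x)) has_sum cnj ?S) UNIV"
    by (simp add: herm_minus cis_cnj)
  with S have "cnj ?S = ?S" by (rule has_sum_unique[rotated])
  then have "complex_of_real (Re ?S) = ?S"
    by (simp add: complex_eq_iff)
  with S show ?thesis by (simp add: synth_def)
qed

lemma synth_in_space:
  fixes a :: "'n::{finite,linorder} freq \<Rightarrow> complex"
  assumes s: "0 < s" and a: "\<And>k. k \<in> Zsharp \<Longrightarrow> norm (a k) * exp (l1 k * s) \<le> C"
  shows "synth a \<in> analytic_space s" "fcoeff (synth a) = herm a"
proof -
  \<comment> \<open>\<open>max C 0\<close> supplies the nonnegativity that \<open>herm_bound\<close>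
    asks for without exhibiting an element of \<open>Zsharp\<close>.\<close>
  have le: "norm (herm a k) \<le> max C 0 * exp (- (l1 k * s))" for k
  proof (rule herm_bound)
    fix k :: "'n freq" assume "k \<in> Zsharp"
    from a[OF this] have "norm (a k) * exp (l1 k * s) \<le> max C 0" by simp
    then show "norm (a k) \<le> max C 0 * exp (- (l1 k * s))"
      by (simp add: exp_minus field_simps)
  qed auto
  have "(\<lambda>k. norm (herm a k)) summable_on UNIV"
    using le by (rule summable_on_comparison_test[OF summable_on_cmult_right[OF summable_exp_l1[OF s]]]) auto
  from synth_has_sum[OF this] this
  show *: "fcoeff (synth a) = herm a"
    by (intro fcoeff_of_has_sum)
  have "norm (herm a k) * exp (l1 k * s) \<le> max C 0" for k
    using le[of k] by (simp add: exp_minus field_simps)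
  then show "synth a \<in> analytic_space s"
    using synth_has_sum[OF \<open>(\<lambda>k. norm (herm a k)) summable_on UNIV\<close>]
    by (auto simp: analytic_space_def * intro!: bdd_aboveI2)
qed

lemma herm_fcoeff:
  assumes "f \<in> analytic_space s"
  shows "herm (fcoeff f) = fcoeff f"
proof
  fix k
  show "herm (fcoeff f) k = fcoeff f k"
    using Zsharp_cases[of k] analytic_spaceD(2)[OF assms] fcoeff_minus[OF assms]
    by (cases "k = 0") (auto simp: herm_def)
qed

lemma synth_fcoeff:
  assumes "f \<in> analytic_space s"
  shows "synth (fcoeff f) = f"
  using infsumI[OF analytic_spaceD(1)[OF assms]]
  by (simp add: synth_def fun_eq_iff herm_fcoeff[OF assms])

lemma analytic_space_eqI:
  assumes "f \<in> analytic_space s" "g \<in> analytic_space s"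
    and "\<And>k. k \<in> Zsharp \<Longrightarrow> fcoeff f k = fcoeff g k"
  shows "f = g"
  using synth_cong[of "fcoeff f" "fcoeff g"] assms(3) synth_fcoeff[OF assms(1)] synth_fcoeff[OF assms(2)] by simp

lemma analytic_space_diff:
  assumes "f \<in> analytic_space s" "g \<in> analytic_space s"
  shows "(\<lambda>x. f x - g x) \<in> analytic_space s"
proof -
  have "((\<lambda>k. - (fcoeff g k * cis (phase k x))) has_sum - of_real (g x)) UNIV" for x
    using analytic_spaceD(1)[OF assms(2)] by (simp add: has_sum_uminus)
  from has_sum_add[OF analytic_spaceD(1)[OF assms(1)] this]
  show ?thesis
    using analytic_spaceD(2)[OF assms(1)] analytic_spaceD(2)[OF assms(2)]
      analytic_norm_diff_bdd[OF assms]
    by (simp add: analytic_space_def fcoeff_diff[OF assms] left_diff_distrib)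
qed

lemma analytic_space_zero:
  assumes "0 < s"
  shows "(\<lambda>x. 0) \<in> (analytic_space s :: 'n::{finite,linorder} torus_fun set)"
proof -
  have "synth (\<lambda>k::'n freq. 0) \<in> analytic_space s"
    using assms by (intro synth_in_space[where C = 0]) auto
  moreover have "herm (\<lambda>k::'n freq. 0) = (\<lambda>k. 0)"
    by (auto simp: herm_def)
  then have "synth (\<lambda>k::'n freq. 0) = (\<lambda>x. 0)"
    by (simp add: synth_def fun_eq_iff)
  ultimately show ?thesis by simp
qed

lemma analytic_space_add:
  fixes f g :: "'n::{finite,linorder} torus_fun"
  assumes "0 < s" "f \<in> analytic_space s" "g \<in> analytic_space s"
  shows "(\<lambda>x. f x + g x) \<in> analytic_space s"
    "fcoeff (\<lambda>x. f x + g x) k = fcoeff f k + fcoeff g k"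
proof -
  have g: "(\<lambda>x. 0 - g x) \<in> analytic_space s"
    by (intro analytic_space_diff analytic_space_zero assms)
  have 0: "fcoeff (\<lambda>x::(real,'n) vec. 0) k = 0"
    by (simp add: fcoeff_def)
  show "(\<lambda>x. f x + g x) \<in> analytic_space s"
    using analytic_space_diff[OF assms(2) g] by simp
  show "fcoeff (\<lambda>x. f x + g x) k = fcoeff f k + fcoeff g k"
    using fcoeff_diff[OF assms(2) g, of k] fcoeff_diff[OF analytic_space_zero[OF assms(1)] assms(3), of k] 0
    by simp
qed

lemma analytic_dist_ge:
  assumes "f \<in> analytic_space s" "g \<in> analytic_space s"
  shows "norm (fcoeff f k - fcoeff g k) * exp (l1 k * s) \<le> analytic_dist s f g"
  using analytic_spaceD(3)[OF analytic_space_diff[OF assms], of k] assms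
  by (simp add: analytic_dist_def fcoeff_diff[OF assms])

text \<open>Opposite frequencies have conjugate coefficients and equal \<open>l1\<close>, and the
  origin contributes 0, so half of the lattice controls the norm.\<close>

lemma analytic_norm_le:
  assumes "f \<in> analytic_space s" "0 \<le> e"
    and "\<And>k. k \<in> Zsharp \<Longrightarrow> norm (fcoeff f k) * exp (l1 k * s) \<le> e"
  shows "analytic_norm s f \<le> e"
  unfolding analytic_norm_def
proof (rule cSUP_least)
  fix k
  show "norm (fcoeff f k) * exp (l1 k * s) \<le> e"
    using Zsharp_cases[of k] assms(3)[of k] assms(3)[of "- k"] assms(2)
      analytic_spaceD(2)[OF assms(1)] fcoeff_minus[OF assms(1)]
    by (cases "k = 0") auto
qed auto

lemma analytic_dist_le:
  assumes "f \<in> analytic_space s" "g \<in> analytic_space s" "0 \<le> e"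
    and "\<And>k. k \<in> Zsharp \<Longrightarrow> norm (fcoeff f k - fcoeff g k) * exp (l1 k * s) \<le> e"
  shows "analytic_dist s f g \<le> e"
  using analytic_norm_le[OF analytic_space_diff[OF assms(1,2)] assms(3)] assms
  by (simp add: analytic_dist_def fcoeff_diff[OF assms(1,2)])

section \<open>The metric topology and its Borel sets\<close>

lemma openin_analytic_top:
  "openin (analytic_top s) U \<longleftrightarrow> U \<subseteq> analytic_space s \<and>
     (\<forall>f\<in>U. \<exists>e>0. \<forall>g\<in>analytic_space s. analytic_dist s f g < e \<longrightarrow> g \<in> U)"
proof -
  interpret Metric_space "analytic_space s" "analytic_dist s"
    by (rule Metric_space_analytic)
  have "(\<exists>r>0. mball f r \<subseteq> U) \<longleftrightarrow>
      (\<exists>e>0. \<forall>g\<in>analytic_space s. analytic_dist s f g < e \<longrightarrow> g \<in> U)"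
    if "f \<in> analytic_space s" for f
    using that by (auto simp: mball_def subset_iff)
  then show ?thesis
    unfolding analytic_top_def openin_mtopology by (meson subsetD)
qed

lemma topspace_analytic_top [simp]: "topspace (analytic_top s) = analytic_space s"
proof -
  interpret Metric_space "analytic_space s" "analytic_dist s"
    by (rule Metric_space_analytic)
  show ?thesis by (simp add: analytic_top_def)
qed

lemma space_analytic_borel [simp]: "space (analytic_borel s) = analytic_space s"
  unfolding analytic_borel_def
  by (intro space_measure_of) (use openin_subset[of "analytic_top s"] in auto)

lemma sets_analytic_borel: "sets (analytic_borel s) = sigma_sets (analytic_space s) {U. openin (analytic_top s) U}"
  unfolding analytic_borel_def
  by (intro sets_measure_of) (use openin_subset[of "analytic_top s"] in auto)

lemma open_in_analytic_borel: "openin (analytic_top s) U \<Longrightarrow> U \<in> sets (analytic_borel s)"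
  by (simp add: sets_analytic_borel sigma_sets.Basic)

section \<open>Rays\<close>

text \<open>A quadratic remainder estimate can be summed term by term; this differentiates a series
  without a separate study of uniform convergence of the derivatives.\<close>

lemma has_vector_derivative_quadratic:
  assumes "\<And>y. norm (f y - f t - (y - t) *\<^sub>R D) \<le> M * (y - t)\<^sup>2"
  shows "(f has_vector_derivative D) (at t)"
  unfolding has_vector_derivative_def has_derivative_within_alt
proof (intro conjI allI impI)
  show "bounded_linear (\<lambda>x. x *\<^sub>R D)"
    by (rule bounded_linear_scaleR_left)
  fix e :: real assume e: "0 < e"
  show "\<exists>d>0. \<forall>y\<in>UNIV. norm (y - t) < d \<longrightarrow> norm (f y - f t - (y - t) *\<^sub>R D) \<le> e * norm (y - t)"
  \<comment> \<open>The denominator is positive whatever the sign of \<open>M\<close>, zero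
    included.\<close>
  proof (intro exI[of _ "e / (\<bar>M\<bar> + 1)"] conjI ballI impI)
    show "0 < e / (\<bar>M\<bar> + 1)" using e by simp
    fix y assume "norm (y - t) < e / (\<bar>M\<bar> + 1)"
    then have "(\<bar>M\<bar> + 1) * \<bar>y - t\<bar> \<le> e" by (simp add: field_simps)
    then have "(\<bar>M\<bar> + 1) * \<bar>y - t\<bar> * \<bar>y - t\<bar> \<le> e * \<bar>y - t\<bar>"
      by (rule mult_right_mono) simp
    moreover have "M * (y - t)\<^sup>2 \<le> (\<bar>M\<bar> + 1) * (\<bar>y - t\<bar> * \<bar>y - t\<bar>)"
      by (intro mult_mono) (auto simp: power2_eq_square)
    ultimately show "norm (f y - f t - (y - t) *\<^sub>R D) \<le> e * norm (y - t)"
      using assms[of y] by (simp add: mult.assoc)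
  qed
qed

text \<open>The formal \<open>m\<close>-th derivative of the series with coefficients
  \<open>b\<close>, so that one family covers a ray and all its derivatives.\<close>

definition trig_sum :: "nat \<Rightarrow> (int \<Rightarrow> complex) \<Rightarrow> real \<Rightarrow> complex" where
  "trig_sum m b t = (\<Sum>\<^sub>\<infinity>j\<in>UNIV - {0}. (\<i> * of_int j) ^ m * b j * cis (of_int j * t))"

context
  fixes b :: "int \<Rightarrow> complex" and C s :: real
  assumes s: "0 < s" and b: "\<And>j. norm (b j) \<le> C * exp (- (real_of_int \<bar>j\<bar> * s))"
begin

lemma trig_coeff_summable: "(\<lambda>j. real_of_int \<bar>j\<bar> ^ m * norm (b j)) summable_on A"
proof (rule summable_on_comparison_test)
  have "(\<lambda>j::int. C * (real_of_int \<bar>j\<bar> ^ m * exp (- (real_of_int \<bar>j\<bar> * s)))) summable_on UNIV"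
    by (rule summable_on_cmult_right, rule summable_power_exp_int[OF s])
  then show "(\<lambda>j::int. C * (real_of_int \<bar>j\<bar> ^ m * exp (- (real_of_int \<bar>j\<bar> * s)))) summable_on A"
    by (rule summable_on_subset_banach) auto
  show "real_of_int \<bar>j\<bar> ^ m * norm (b j) \<le> C * (real_of_int \<bar>j\<bar> ^ m * exp (- (real_of_int \<bar>j\<bar> * s)))" for j
    using mult_left_mono[OF b[of j], of "real_of_int \<bar>j\<bar> ^ m"] by (simp add: algebra_simps)
qed auto

lemma trig_norm: "norm ((\<i> * of_int j) ^ m * b j * cis x) = real_of_int \<bar>j\<bar> ^ m * norm (b j)"
  by (simp add: norm_mult norm_power)

lemma trig_sum_has_sum:
  "((\<lambda>j. (\<i> * of_int j) ^ m * b j * cis (of_int j * t)) has_sum trig_sum m b t) (UNIV - {0})"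
  unfolding trig_sum_def
  by (rule has_sum_infsum, rule abs_summable_summable) (simp only: trig_norm trig_coeff_summable)

text \<open>With \<open>u = j * (y - t)\<close>, the term \<open>j\<close> has a remainder of size
  \<open>u\<^sup>2\<close>, at the cost of two further powers of \<open>\<bar>j\<bar>\<close>;
  exponential decay of the coefficients keeps the sum of these remainders finite.\<close>

lemma trig_sum_has_vector_derivative:
  "(trig_sum m b has_vector_derivative trig_sum (Suc m) b t) (at t)"
proof (rule has_vector_derivative_quadratic)
  fix y
  have "((\<lambda>j. (\<i> * of_int j) ^ m * b j * cis (of_int j * y)
      + - ((\<i> * of_int j) ^ m * b j * cis (of_int j * t))
      + - ((y - t) *\<^sub>R ((\<i> * of_int j) ^ Suc m * b j * cis (of_int j * t))))
    has_sum (trig_sum m b y + - trig_sum m b t + - ((y - t) *\<^sub>R trig_sum (Suc m) b t))) (UNIV - {0})"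
    by (intro has_sum_add iffD2[OF has_sum_uminus])
       (simp_all only: minus_minus has_sum_scaleR trig_sum_has_sum)
  moreover have "((\<lambda>j. (real_of_int \<bar>j\<bar> ^ (m + 2) * norm (b j)) * (y - t)\<^sup>2) has_sum
      (\<Sum>\<^sub>\<infinity>j\<in>UNIV - {0}. real_of_int \<bar>j\<bar> ^ (m + 2) * norm (b j)) * (y - t)\<^sup>2) (UNIV - {0})"
    by (rule has_sum_cmult_left, rule has_sum_infsum, rule trig_coeff_summable)
  moreover have "norm ((\<i> * of_int j) ^ m * b j * cis (of_int j * y)
      + - ((\<i> * of_int j) ^ m * b j * cis (of_int j * t))
      + - ((y - t) *\<^sub>R ((\<i> * of_int j) ^ Suc m * b j * cis (of_int j * t))))
      \<le> (real_of_int \<bar>j\<bar> ^ (m + 2) * norm (b j)) * (y - t)\<^sup>2" for j :: int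
  proof -
    define u where "u = real_of_int j * (y - t)"
    have cy: "cis (of_int j * y) = cis (of_int j * t) * cis u"
      by (simp add: u_def cis_mult algebra_simps)
    have eq: "(\<i> * of_int j) ^ m * b j * cis (of_int j * y)
        + - ((\<i> * of_int j) ^ m * b j * cis (of_int j * t))
        + - ((y - t) *\<^sub>R ((\<i> * of_int j) ^ Suc m * b j * cis (of_int j * t)))
      = ((\<i> * of_int j) ^ m * b j * cis (of_int j * t)) * (cis u - 1 - \<i> * of_real u)"
      unfolding cy by (simp add: u_def scaleR_conv_of_real algebra_simps)
    have le: "norm (cis u - 1 - \<i> * of_real u) \<le> \<bar>u\<bar>\<^sup>2"
    proof -
      have "norm (cis u - 1 - \<i> * of_real u) \<le> \<bar>u\<bar>\<^sup>2 / 2"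
        using iexp_approx1[of u 1] by (simp add: cis_conv_exp diff_diff_eq numeral_2_eq_2)
      then show ?thesis by (rule order_trans) simp
    qed
    have "norm ((\<i> * of_int j) ^ m * b j * cis (of_int j * y)
        + - ((\<i> * of_int j) ^ m * b j * cis (of_int j * t))
        + - ((y - t) *\<^sub>R ((\<i> * of_int j) ^ Suc m * b j * cis (of_int j * t))))
      = (real_of_int \<bar>j\<bar> ^ m * norm (b j)) * norm (cis u - 1 - \<i> * of_real u)"
      by (simp only: eq norm_mult[of _ "cis u - 1 - \<i> * of_real u"] trig_norm)
    also have "\<dots> \<le> (real_of_int \<bar>j\<bar> ^ m * norm (b j)) * \<bar>u\<bar>\<^sup>2"
      by (intro mult_left_mono le) auto
    also have "\<bar>u\<bar>\<^sup>2 = real_of_int \<bar>j\<bar> ^ 2 * (y - t)\<^sup>2"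
      by (simp add: u_def power_mult_distrib)
    also have "real_of_int \<bar>j\<bar> ^ m * norm (b j) * (real_of_int \<bar>j\<bar> ^ 2 * (y - t)\<^sup>2)
        = (real_of_int \<bar>j\<bar> ^ (m + 2) * norm (b j)) * (y - t)\<^sup>2"
      by (simp only: power_add mult_ac)
    finally show ?thesis .
  qed
  ultimately have "norm (trig_sum m b y + - trig_sum m b t + - ((y - t) *\<^sub>R trig_sum (Suc m) b t))
      \<le> (\<Sum>\<^sub>\<infinity>j\<in>UNIV - {0}. real_of_int \<bar>j\<bar> ^ (m + 2) * norm (b j)) * (y - t)\<^sup>2"
    by (rule norm_infsum_le)
  then show "norm (trig_sum m b y - trig_sum m b t - (y - t) *\<^sub>R trig_sum (Suc m) b t)
      \<le> (\<Sum>\<^sub>\<infinity>j\<in>UNIV - {0}. real_of_int \<bar>j\<bar> ^ (m + 2) * norm (b j)) * (y - t)\<^sup>2"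
    by simp
qed

lemma trig_sum_real:
  assumes "\<And>j. b (- j) = cnj (b j)"
  shows "of_real (Re (trig_sum m b t)) = trig_sum m b t"
proof -
  have "((\<lambda>j. cnj ((\<i> * of_int j) ^ m * b j * cis (of_int j * t))) has_sum cnj (trig_sum m b t)) (UNIV - {0})"
    using trig_sum_has_sum by (subst has_sum_cnj_iff)
  then have "((\<lambda>j. cnj ((\<i> * of_int (- j)) ^ m * b (- j) * cis (of_int (- j) * t))) has_sum cnj (trig_sum m b t)) (UNIV - {0})"
    by (subst has_sum_reindex_bij_witness[of _ uminus uminus "UNIV - {0}"]) auto
  then have "((\<lambda>j. (\<i> * of_int j) ^ m * b j * cis (of_int j * t)) has_sum cnj (trig_sum m b t)) (UNIV - {0})"
    by (simp add: assms cis_cnj)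
  with trig_sum_has_sum have "cnj (trig_sum m b t) = trig_sum m b t"
    by (rule has_sum_unique[rotated])
  then show ?thesis by (simp add: complex_eq_iff)
qed

lemma trig_sum_bound:
  "norm (trig_sum m b t) \<le> C * (\<Sum>\<^sub>\<infinity>j\<in>UNIV - {0::int}. real_of_int \<bar>j\<bar> ^ m * exp (- (real_of_int \<bar>j\<bar> * s)))"
proof (rule norm_infsum_le[OF trig_sum_has_sum])
  show "((\<lambda>j::int. C * (real_of_int \<bar>j\<bar> ^ m * exp (- (real_of_int \<bar>j\<bar> * s)))) has_sum
      C * (\<Sum>\<^sub>\<infinity>j\<in>UNIV - {0::int}. real_of_int \<bar>j\<bar> ^ m * exp (- (real_of_int \<bar>j\<bar> * s)))) (UNIV - {0})"
    by (rule has_sum_cmult_right, rule has_sum_infsum, rule summable_on_subset_banach[OF summable_power_exp_int[OF s]]) auto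
  show "norm ((\<i> * of_int j) ^ m * b j * cis (of_int j * t)) \<le> C * (real_of_int \<bar>j\<bar> ^ m * exp (- (real_of_int \<bar>j\<bar> * s)))" for j
    unfolding trig_norm using mult_left_mono[OF b[of j], of "real_of_int \<bar>j\<bar> ^ m"] by (simp add: algebra_simps)
qed

end

lemma trig_sum_periodic: "trig_sum m b (t + 2 * pi) = trig_sum m b t"
proof -
  have "cis (of_int j * (t + 2 * pi)) = cis (of_int j * t)" for j :: int
  proof -
    have "cis (of_int j * (t + 2 * pi)) = cis (of_int j * t) * cis (2 * pi * of_int j)"
      by (simp add: cis_mult algebra_simps)
    then show ?thesis by (simp add: cis_multiple_2pi)
  qed
  then show ?thesis by (simp add: trig_sum_def)
qed

text \<open>The real form of the \<open>m\<close>-th derivative of a ray, to which real analysis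
  applies; \<open>ray_eq\<close>, \<open>ray'_eq\<close> and \<open>ray''_eq\<close> connect it with
  the complex-valued definitions.\<close>

definition ray_real :: "nat \<Rightarrow> 'n::finite torus_fun \<Rightarrow> 'n freq \<Rightarrow> real \<Rightarrow> real" where
  "ray_real m f k t = Re (trig_sum m (\<lambda>j. fcoeff f (j *s k)) t)"

text \<open>A non-zero integer vector has \<open>l1 k\<close> at least 1, so coefficients decay
  along every ray at rate \<open>s\<close> at least, uniformly in \<open>k\<close>.\<close>

lemma ray_coeff_bound:
  assumes "\<And>k. norm (c k) * exp (l1 k * s) \<le> C" "0 < s" "k \<noteq> 0" "0 \<le> C"
  shows "norm (c (j *s k)) \<le> C * exp (- (real_of_int \<bar>j\<bar> * s))"
proof -
  have "norm (c (j *s k)) \<le> C * exp (- (l1 (j *s k) * s))"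
    using assms(1)[of "j *s k"] by (simp add: exp_minus field_simps)
  also have "real_of_int \<bar>j\<bar> * 1 * s \<le> real_of_int \<bar>j\<bar> * l1 k * s"
    using l1_ge_1[OF assms(3)] assms(2) by (intro mult_left_mono mult_right_mono) auto
  then have "C * exp (- (l1 (j *s k) * s)) \<le> C * exp (- (real_of_int \<bar>j\<bar> * s))"
    using assms by (intro mult_left_mono) (auto simp: l1_scale)
  finally show ?thesis .
qed

context
  fixes f :: "'n::{finite,linorder} torus_fun" and s :: real and k :: "'n freq"
  assumes f: "f \<in> analytic_space s" and s: "0 < s" and k: "k \<noteq> 0"
begin

lemma ray_bound: "norm (fcoeff f (j *s k)) \<le> analytic_norm s f * exp (- (real_of_int \<bar>j\<bar> * s))"
  using ray_coeff_bound[of "fcoeff f" s "analytic_norm s f" k j] analytic_spaceD(3,4)[OF f] s k by blast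

lemma trig_sum_ray: "trig_sum m (\<lambda>j. fcoeff f (j *s k)) t = of_real (ray_real m f k t)"
proof -
  have "fcoeff f (- j *s k) = cnj (fcoeff f (j *s k))" for j
  proof -
    have "- j *s k = - (j *s k)" by (simp add: vec_eq_iff)
    then show ?thesis using fcoeff_minus[OF f] by simp
  qed
  then show ?thesis
    unfolding ray_real_def by (rule trig_sum_real[OF s ray_bound, symmetric])
qed

lemma ray_real_deriv: "(ray_real m f k has_real_derivative ray_real (Suc m) f k t) (at t)"
  using trig_sum_has_vector_derivative[OF s ray_bound, of m t] unfolding ray_real_def
  by (simp add: has_real_derivative_iff_has_vector_derivative
      bounded_linear.has_vector_derivative[OF bounded_linear_Re])

lemma ray_eq: "ray f k t = of_real (ray_real 0 f k t)"
  using trig_sum_ray[of 0 t] by (simp add: ray_def trig_sum_def)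

lemma ray'_eq: "ray' f k t = of_real (ray_real 1 f k t)"
proof -
  have "ray f k = trig_sum 0 (\<lambda>j. fcoeff f (j *s k))"
    by (simp add: ray_def trig_sum_def fun_eq_iff)
  then show ?thesis
    using trig_sum_has_vector_derivative[OF s ray_bound, of 0 t] trig_sum_ray[of 1 t]
    by (simp add: ray'_def vector_derivative_at)
qed

lemma ray''_eq: "ray'' f k t = of_real (ray_real 2 f k t)"
proof -
  have "ray' f k = trig_sum 1 (\<lambda>j. fcoeff f (j *s k))"
    by (simp add: ray'_eq trig_sum_ray fun_eq_iff)
  then show ?thesis
    using trig_sum_has_vector_derivative[OF s ray_bound, of 1 t] trig_sum_ray[of 2 t]
    by (simp add: ray''_def vector_derivative_at numeral_2_eq_2)
qed

text \<open>The factor after the distance depends on \<open>m\<close> and \<open>s\<close> only, so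
  nearby functions have rays and derivatives of rays that are close uniformly in
  \<open>t\<close>.\<close>

lemma ray_real_dist:
  assumes g: "g \<in> analytic_space s"
  shows "\<bar>ray_real m f k t - ray_real m g k t\<bar>
    \<le> analytic_dist s f g * (\<Sum>\<^sub>\<infinity>j\<in>UNIV - {0::int}. real_of_int \<bar>j\<bar> ^ m * exp (- (real_of_int \<bar>j\<bar> * s)))"
proof -
  let ?h = "\<lambda>x. f x - g x"
  have h: "?h \<in> analytic_space s" by (rule analytic_space_diff[OF f g])
  have b: "norm (fcoeff g (j *s k)) \<le> analytic_norm s g * exp (- (real_of_int \<bar>j\<bar> * s))" for j
    using ray_coeff_bound[of "fcoeff g" s "analytic_norm s g" k j] analytic_spaceD(3,4)[OF g] s k by blast
  have bh: "norm (fcoeff ?h (j *s k)) \<le> analytic_norm s ?h * exp (- (real_of_int \<bar>j\<bar> * s))" for j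
    using ray_coeff_bound[of "fcoeff ?h" s "analytic_norm s ?h" k j] analytic_spaceD(3,4)[OF h] s k by blast
  have "((\<lambda>j. (\<i> * of_int j) ^ m * fcoeff f (j *s k) * cis (of_int j * t)
      + - ((\<i> * of_int j) ^ m * fcoeff g (j *s k) * cis (of_int j * t)))
    has_sum (trig_sum m (\<lambda>j. fcoeff f (j *s k)) t + - trig_sum m (\<lambda>j. fcoeff g (j *s k)) t)) (UNIV - {0})"
    by (intro has_sum_add iffD2[OF has_sum_uminus])
       (simp_all only: minus_minus trig_sum_has_sum[OF s ray_bound] trig_sum_has_sum[OF s b])
  then have "((\<lambda>j. (\<i> * of_int j) ^ m * fcoeff ?h (j *s k) * cis (of_int j * t))
    has_sum (trig_sum m (\<lambda>j. fcoeff f (j *s k)) t + - trig_sum m (\<lambda>j. fcoeff g (j *s k)) t)) (UNIV - {0})"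
    by (simp add: fcoeff_diff[OF f g] algebra_simps)
  then have "trig_sum m (\<lambda>j. fcoeff ?h (j *s k)) t
      = trig_sum m (\<lambda>j. fcoeff f (j *s k)) t + - trig_sum m (\<lambda>j. fcoeff g (j *s k)) t"
    unfolding trig_sum_def[of m "\<lambda>j. fcoeff ?h (j *s k)"] by (rule infsumI)
  then have "\<bar>ray_real m f k t - ray_real m g k t\<bar> \<le> norm (trig_sum m (\<lambda>j. fcoeff ?h (j *s k)) t)"
    using abs_Re_le_cmod[of "trig_sum m (\<lambda>j. fcoeff ?h (j *s k)) t"] by (simp add: ray_real_def)
  also have "\<dots> \<le> analytic_norm s ?h * (\<Sum>\<^sub>\<infinity>j\<in>UNIV - {0::int}. real_of_int \<bar>j\<bar> ^ m * exp (- (real_of_int \<bar>j\<bar> * s)))"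
    by (rule trig_sum_bound[OF s bh])
  finally show ?thesis using f g by (simp add: analytic_dist_def)
qed

end

lemma ray_real_periodic: "ray_real m f k (t + 2 * pi) = ray_real m f k t"
  by (simp add: ray_real_def trig_sum_periodic)

section \<open>Stability of non-degeneracy\<close>

definition periodic_C2 :: "(real \<Rightarrow> real) \<Rightarrow> (real \<Rightarrow> real) \<Rightarrow> (real \<Rightarrow> real) \<Rightarrow> bool" where
  "periodic_C2 F0 F1 F2 \<longleftrightarrow>
     (\<forall>t. (F0 has_real_derivative F1 t) (at t)) \<and> (\<forall>t. (F1 has_real_derivative F2 t) (at t)) \<and>
     continuous_on UNIV F2 \<and>
     (\<forall>t. F0 (t + 2 * pi) = F0 t \<and> F1 (t + 2 * pi) = F1 t \<and> F2 (t + 2 * pi) = F2 t)"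

text \<open>Morse functions on the circle with pairwise distinct critical values. The derivatives
  are separate arguments so that perturbations of \<open>F0\<close>, \<open>F1\<close> and
  \<open>F2\<close> can be bounded one by one.\<close>

definition morse :: "(real \<Rightarrow> real) \<Rightarrow> (real \<Rightarrow> real) \<Rightarrow> (real \<Rightarrow> real) \<Rightarrow> bool" where
  "morse F0 F1 F2 \<longleftrightarrow> (\<forall>t. \<not> (F1 t = 0 \<and> F2 t = 0)) \<and>
     (\<forall>t1 t2. 0 \<le> t1 \<and> t1 < t2 \<and> t2 < 2 * pi \<and> F1 t1 = 0 \<and> F1 t2 = 0 \<longrightarrow> F0 t1 \<noteq> F0 t2)"

lemma periodic_attains_inf:
  fixes h :: "real \<Rightarrow> real"
  assumes "continuous_on UNIV h" "\<And>t. h (t + 2 * pi) = h t"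
  shows "\<exists>t0. \<forall>t. h t0 \<le> h t"
proof -
  interpret periodic_fun_simple h "2 * pi"
    by standard (rule assms(2))
  obtain t0 where t0: "\<forall>t\<in>{0..2*pi}. h t0 \<le> h t"
    using continuous_attains_inf[of "{0..2*pi}" h] continuous_on_subset[OF assms(1)] by auto
  have "h t0 \<le> h t" for t
  proof -
    define n where "n = \<lfloor>t / (2 * pi)\<rfloor>"
    have "real_of_int n \<le> t / (2 * pi)" "t / (2 * pi) \<le> real_of_int n + 1"
      unfolding n_def by linarith+
    then have "t - of_int n * (2 * pi) \<in> {0..2*pi}"
      by (simp add: field_simps)
    then have "h t0 \<le> h (t - of_int n * (2 * pi))" using t0 by blast
    then show ?thesis by (simp add: minus_of_int)
  qed
  then show ?thesis by blast
qed

lemma periodic_C2_continuous: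
  assumes "periodic_C2 F0 F1 F2"
  shows "continuous_on UNIV F0" "continuous_on UNIV F1" "continuous_on UNIV F2"
  using assms unfolding periodic_C2_def
  by (auto intro!: continuous_at_imp_continuous_on DERIV_isCont)

text \<open>By periodicity the infimum over the line is attained, so its positivity is a pointwise
  statement; hence \<open>morse\<close> can do without \<open>INF\<close>.\<close>

lemma periodic_C2_INF_pos_iff:
  assumes "periodic_C2 F0 F1 F2"
  shows "(INF t. \<bar>F1 t\<bar> + \<bar>F2 t\<bar>) > 0 \<longleftrightarrow> (\<forall>t. \<not> (F1 t = 0 \<and> F2 t = 0))"
proof -
  have "continuous_on UNIV (\<lambda>t. \<bar>F1 t\<bar> + \<bar>F2 t\<bar>)"
    by (intro continuous_intros periodic_C2_continuous[OF assms])
  moreover have "\<bar>F1 (t + 2 * pi)\<bar> + \<bar>F2 (t + 2 * pi)\<bar> = \<bar>F1 t\<bar> + \<bar>F2 t\<bar>" for t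
    using assms by (simp add: periodic_C2_def)
  ultimately obtain t0 where t0: "\<And>t. \<bar>F1 t0\<bar> + \<bar>F2 t0\<bar> \<le> \<bar>F1 t\<bar> + \<bar>F2 t\<bar>"
    using periodic_attains_inf[of "\<lambda>t. \<bar>F1 t\<bar> + \<bar>F2 t\<bar>"] by auto
  have "(INF t. \<bar>F1 t\<bar> + \<bar>F2 t\<bar>) = \<bar>F1 t0\<bar> + \<bar>F2 t0\<bar>"
    by (rule cInf_eq_minimum) (use t0 in auto)
  moreover have "0 < \<bar>F1 t0\<bar> + \<bar>F2 t0\<bar> \<longleftrightarrow> (\<forall>t. \<not> (F1 t = 0 \<and> F2 t = 0))"
  proof
    assume "0 < \<bar>F1 t0\<bar> + \<bar>F2 t0\<bar>"
    then have "0 < \<bar>F1 t\<bar> + \<bar>F2 t\<bar>" for t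
      using t0 by (rule less_le_trans)
    then show "\<forall>t. \<not> (F1 t = 0 \<and> F2 t = 0)"
      by (metis abs_zero add_0 less_irrefl)
  next
    assume "\<forall>t. \<not> (F1 t = 0 \<and> F2 t = 0)"
    then show "0 < \<bar>F1 t0\<bar> + \<bar>F2 t0\<bar>"
      by (cases "F1 t0 = 0") (auto intro: add_nonneg_pos add_pos_nonneg)
  qed
  ultimately show ?thesis by simp
qed

text \<open>
  If failing functions \<open>G\<^sub>n\<close> converge to \<open>F\<close>, a subsequence of their pairs of critical points
  converges. Two distinct limits contradict the second condition for \<open>F\<close>; if the pairs collide,
  Rolle's theorem produces a degenerate critical point of \<open>F\<close>.
\<close>
lemma morse_open:
  assumes F: "periodic_C2 F0 F1 F2" and M: "morse F0 F1 F2"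
  obtains e where "0 < e"
    "\<And>G0 G1 G2. \<lbrakk>periodic_C2 G0 G1 G2; \<And>t. \<bar>G0 t - F0 t\<bar> < e; \<And>t. \<bar>G1 t - F1 t\<bar> < e;
       \<And>t. \<bar>G2 t - F2 t\<bar> < e\<rbrakk> \<Longrightarrow> morse G0 G1 G2"
proof -
  have "\<exists>e>0. \<forall>G0 G1 G2. periodic_C2 G0 G1 G2 \<longrightarrow>
      (\<forall>t. \<bar>G0 t - F0 t\<bar> < e \<and> \<bar>G1 t - F1 t\<bar> < e \<and> \<bar>G2 t - F2 t\<bar> < e) \<longrightarrow> morse G0 G1 G2"
  proof (rule ccontr)
    assume neg: "\<not> ?thesis"
    define c where "c = (INF t. \<bar>F1 t\<bar> + \<bar>F2 t\<bar>)"
    have c: "c > 0"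
      using periodic_C2_INF_pos_iff[OF F] M by (simp add: c_def morse_def)
    have cle: "c \<le> \<bar>F1 t\<bar> + \<bar>F2 t\<bar>" for t
      unfolding c_def by (rule cINF_lower) (auto intro!: bdd_belowI2[of _ 0])
    \<comment> \<open>The bound \<open>c / 2\<close> protects the first condition of
      \<open>morse\<close>: a common zero of \<open>G1 n\<close> and \<open>G2 n\<close> would force
      \<open>\<bar>F1 t\<bar> + \<bar>F2 t\<bar> < c\<close>. Hence the failure is one of the second
      condition. The other bound gives convergence.\<close>
    define e where "e n = min (c / 2) (1 / (real n + 1))" for n
    have e: "e n > 0" for n using c by (simp add: e_def)
    have "\<exists>G0 G1 G2. periodic_C2 G0 G1 G2 \<and>
        (\<forall>t. \<bar>G0 t - F0 t\<bar> < e n \<and> \<bar>G1 t - F1 t\<bar> < e n \<and> \<bar>G2 t - F2 t\<bar> < e n) \<and> \<not> morse G0 G1 G2" for n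
      using neg e[of n] by blast
    then obtain G0 G1 G2 where G: "\<And>n. periodic_C2 (G0 n) (G1 n) (G2 n)"
      and close: "\<And>n t. \<bar>G0 n t - F0 t\<bar> < e n" "\<And>n t. \<bar>G1 n t - F1 t\<bar> < e n" "\<And>n t. \<bar>G2 n t - F2 t\<bar> < e n"
      and bad: "\<And>n. \<not> morse (G0 n) (G1 n) (G2 n)"
      by metis
    have "\<not> (G1 n t = 0 \<and> G2 n t = 0)" for n t
      using cle[of t] close(2,3)[of n t] by (auto simp: e_def)
    then have "\<exists>t1 t2. 0 \<le> t1 \<and> t1 < t2 \<and> t2 < 2 * pi \<and> G1 n t1 = 0 \<and> G1 n t2 = 0 \<and> G0 n t1 = G0 n t2" for n
      using bad[of n] by (auto simp: morse_def)
    then obtain t1 t2 where t: "\<And>n. 0 \<le> t1 n \<and> t1 n < t2 n \<and> t2 n < 2 * pi"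
      and crit: "\<And>n. G1 n (t1 n) = 0" "\<And>n. G1 n (t2 n) = 0" and val: "\<And>n. G0 n (t1 n) = G0 n (t2 n)"
      by metis
    have "(t1 n, t2 n) \<in> {0..2*pi} \<times> {0..2*pi}" for n
      using t[of n] by auto
    moreover have "compact ({0..2*pi} \<times> {0..2*pi::real})"
      by (intro compact_Times) auto
    ultimately obtain l r where l: "l \<in> {0..2*pi} \<times> {0..2*pi}" and r: "strict_mono r"
      and lim: "((\<lambda>n. (t1 n, t2 n)) \<circ> r) \<longlonglongrightarrow> l"
      unfolding compact_def by (metis (no_types, lifting))
    obtain u v where uv: "l = (u, v)" by (cases l)
    have lim1: "(\<lambda>n. t1 (r n)) \<longlonglongrightarrow> u" and lim2: "(\<lambda>n. t2 (r n)) \<longlonglongrightarrow> v"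
      using tendsto_fst[OF lim] tendsto_snd[OF lim] by (simp_all add: o_def uv)
    have lim_inv: "(\<lambda>n. 1 / (real n + 1)) \<longlonglongrightarrow> 0" by real_asymp
    have e0: "e \<longlonglongrightarrow> 0"
      by (rule tendsto_sandwich[OF _ _ tendsto_const lim_inv])
         (auto intro!: always_eventually less_imp_le[OF e], simp add: e_def)
    then have er: "(\<lambda>n. e (r n)) \<longlonglongrightarrow> 0"
      using LIMSEQ_subseq_LIMSEQ[OF e0 r] by (simp add: o_def)
    have conv: "(\<lambda>n. G (r n) (w n)) \<longlonglongrightarrow> H x"
      if "\<And>n t. \<bar>G n t - H t\<bar> < e n" "continuous_on UNIV H" "w \<longlonglongrightarrow> x" for G H w x
    proof -
      have "(\<lambda>n. G (r n) (w n) - H (w n)) \<longlonglongrightarrow> 0"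
        by (rule Lim_null_comparison[OF _ er]) (auto intro!: always_eventually less_imp_le that(1))
      moreover have "(\<lambda>n. H (w n)) \<longlonglongrightarrow> H x"
        using that(2,3) by (auto intro: continuous_on_tendsto_compose)
      ultimately show ?thesis
        using tendsto_add by fastforce
    qed
    note cont = periodic_C2_continuous[OF F]
    have F1u: "F1 u = 0"
      using conv[OF close(2) cont(2) lim1] crit(1) by (simp add: LIMSEQ_const_iff)
    have F1v: "F1 v = 0"
      using conv[OF close(2) cont(2) lim2] crit(2) by (simp add: LIMSEQ_const_iff)
    have "(\<lambda>n. G0 (r n) (t1 (r n))) \<longlonglongrightarrow> F0 v"
      using conv[OF close(1) cont(1) lim2] by (simp add: val)
    with conv[OF close(1) cont(1) lim1] have F0uv: "F0 u = F0 v"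
      by (rule LIMSEQ_unique)
    \<comment> \<open>Stated for arbitrary sequences because it serves both for the pair itself and
      for a pair shifted across the period.\<close>
    have collide: False
      if "\<And>n. a n < b n" "\<And>n. G1 (r n) (a n) = 0" "\<And>n. G1 (r n) (b n) = 0"
        "a \<longlonglongrightarrow> x" "b \<longlonglongrightarrow> x" "F1 x = 0" for a b x
    proof -
      have "\<exists>z>a n. z < b n \<and> G2 (r n) z = 0" for n
        using MVT2[of "a n" "b n" "G1 (r n)" "G2 (r n)"] that(1-3)[of n] G[of "r n"]
        by (auto simp: periodic_C2_def)
      then obtain z where z: "\<And>n. a n < z n" "\<And>n. z n < b n" "\<And>n. G2 (r n) (z n) = 0"
        by metis
      have "z \<longlonglongrightarrow> x"
        by (rule tendsto_sandwich[OF _ _ that(4,5)]) (use z in \<open>auto intro!: always_eventually less_imp_le\<close>)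
      from conv[OF close(3) cont(3) this] have "F2 x = 0"
        using z(3) by (simp add: LIMSEQ_const_iff)
      then show False using that(6) M by (auto simp: morse_def)
    qed
    have "u \<le> v"
      by (rule LIMSEQ_le[OF lim1 lim2]) (use t in \<open>auto intro: less_imp_le\<close>)
    have uv_bounds: "0 \<le> u" "v \<le> 2 * pi"
      using l by (auto simp: uv)
    have per: "F0 (2 * pi) = F0 0" "F1 (2 * pi) = F1 0"
      using F by (auto simp: periodic_C2_def dest: spec[of _ 0])
    consider "u = v" | "u < v" "v < 2 * pi" | "0 < u" "u < v" "v = 2 * pi" | "u = 0" "v = 2 * pi"
      using \<open>u \<le> v\<close> uv_bounds by linarith
    then show False
    proof cases
      case 1
      show False
        by (rule collide[of "\<lambda>n. t1 (r n)" "\<lambda>n. t2 (r n)" u]) (use 1 t crit lim1 lim2 F1u in auto)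
    next
      case 2
      then show False using M F1u F1v F0uv uv_bounds by (auto simp: morse_def)
    next
      \<comment> \<open>The limit \<open>2 * pi\<close> is outside the half-open interval of
        \<open>morse\<close>, so it is replaced by 0, which now is the smaller point.\<close>
      case 3
      then have "0 \<le> (0::real) \<and> 0 < u \<and> u < 2 * pi \<and> F1 0 = 0 \<and> F1 u = 0" "F0 0 = F0 u"
        using F1u F1v F0uv per by auto
      then show False using M by (auto simp: morse_def)
    next
      \<comment> \<open>The two points collide on the circle although not on the line; adding a
        period to \<open>t1\<close> brings them together.\<close>
      case 4
      show False
      proof (rule collide[of "\<lambda>n. t2 (r n)" "\<lambda>n. t1 (r n) + 2 * pi" "2 * pi"])
        show "t2 (r n) < t1 (r n) + 2 * pi" for n
          using t[of "r n"] by linarith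
        show "G1 (r n) (t1 (r n) + 2 * pi) = 0" for n
          using G[of "r n"] crit(1)[of "r n"] by (simp add: periodic_C2_def)
        show "(\<lambda>n. t1 (r n) + 2 * pi) \<longlonglongrightarrow> 2 * pi"
          using tendsto_add[OF lim1 tendsto_const[of "2 * pi"]] 4 by simp
      qed (use 4 crit lim2 F1v in auto)
    qed
  qed
  then show ?thesis using that by blast
qed

section \<open>Genericity of non-degeneracy in one coefficient\<close>

text \<open>The condition on \<open>e\<close> says that the image of \<open>D\<close> is orthogonal
  to \<open>cnj e\<close>, so \<open>D\<close> is not onto; identifying the plane with
  \<open>real^2\<close> then leads to \<open>baby_Sard\<close>. The derivative is taken within
  \<open>S\<close>, where it need not be unique, and the caller may pick a \<open>D\<close> of low
  rank.\<close>

lemma baby_Sard_complex: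
  fixes W :: "complex \<Rightarrow> complex"
  assumes "\<And>x. x \<in> S \<Longrightarrow> \<exists>D e. (W has_derivative D) (at x within S) \<and> e \<noteq> 0 \<and> (\<forall>h. Re (D h * e) = 0)"
  shows "negligible (W ` S)"
proof -
  obtain W' where der: "\<And>x. x \<in> S \<Longrightarrow> (W has_derivative W' x) (at x within S)"
    and rank: "\<And>x. x \<in> S \<Longrightarrow> \<exists>e. e \<noteq> 0 \<and> (\<forall>h. Re (W' x h * e) = 0)"
    using assms by metis
  define \<phi> :: "complex \<Rightarrow> real^2" where "\<phi> z = (\<chi> i. if i = 1 then Re z else Im z)" for z
  define \<psi> :: "real^2 \<Rightarrow> complex" where "\<psi> v = Complex (v $ 1) (v $ 2)" for v
  have \<psi>\<phi> [simp]: "\<psi> (\<phi> z) = z" for z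
    by (simp add: \<phi>_def \<psi>_def complex_eq_iff)
  have \<phi>: "bounded_linear \<phi>"
    by (intro linear_conv_bounded_linear[THEN iffD1] linearI) (auto simp: \<phi>_def vec_eq_iff)
  have \<psi>: "bounded_linear \<psi>"
    by (intro linear_conv_bounded_linear[THEN iffD1] linearI) (auto simp: \<psi>_def complex_eq_iff)
  have "negligible ((\<lambda>v. \<phi> (W (\<psi> v))) ` (\<phi> ` S))"
  proof (rule baby_Sard)
    fix v assume "v \<in> \<phi> ` S"
    then have v: "\<psi> v \<in> S" by auto
    have im: "\<psi> ` \<phi> ` S = S" by (simp add: image_image)
    have "(\<psi> has_derivative \<psi>) (at v within \<phi> ` S)"
      by (rule bounded_linear_imp_has_derivative[OF \<psi>])
    moreover have "(W has_derivative W' (\<psi> v)) (at (\<psi> v) within \<psi> ` \<phi> ` S)"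
      unfolding im by (rule der[OF v])
    ultimately have "(W \<circ> \<psi> has_derivative W' (\<psi> v) \<circ> \<psi>) (at v within \<phi> ` S)"
      by (rule diff_chain_within)
    then show d: "((\<lambda>v. \<phi> (W (\<psi> v))) has_derivative (\<lambda>h. \<phi> (W' (\<psi> v) (\<psi> h)))) (at v within \<phi> ` S)"
      using bounded_linear.has_derivative[OF \<phi>] by (fastforce simp: o_def)
    obtain e where e: "e \<noteq> 0" "\<And>h. Re (W' (\<psi> v) h * e) = 0"
      using rank[OF v] by blast
    have lin: "linear (\<lambda>h. \<phi> (W' (\<psi> v) (\<psi> h)))"
      using has_derivative_linear[OF d] .
    \<comment> \<open>\<open>cnj e\<close> is missed by the derivative because
      \<open>cnj e * e\<close> has the positive real part \<open>(norm e)\<^sup>2\<close>.\<close>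
    have "\<phi> (cnj e) \<noteq> \<phi> (W' (\<psi> v) (\<psi> h))" for h
    proof
      assume "\<phi> (cnj e) = \<phi> (W' (\<psi> v) (\<psi> h))"
      then have "cnj e = W' (\<psi> v) (\<psi> h)" by (metis \<psi>\<phi>)
      then have "Re (cnj e * e) = 0" using e(2) by metis
      then show False using e(1) by (simp add: complex_eq_iff)
    qed
    then have "\<not> surj ((*v) (matrix (\<lambda>h. \<phi> (W' (\<psi> v) (\<psi> h)))))"
      using matrix_vector_mul(2)[OF lin] by (metis surjD)
    then have "rank (matrix (\<lambda>h. \<phi> (W' (\<psi> v) (\<psi> h)))) \<noteq> CARD(2)"
      by (simp only: full_rank_surjective) simp
    moreover have "rank (matrix (\<lambda>h. \<phi> (W' (\<psi> v) (\<psi> h)))) \<le> CARD(2)"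
      using rank_bound[of "matrix (\<lambda>h. \<phi> (W' (\<psi> v) (\<psi> h)))"] by simp
    ultimately show "rank (matrix (\<lambda>h. \<phi> (W' (\<psi> v) (\<psi> h)))) < CARD(2)"
      by linarith
  qed simp
  then have "negligible (\<psi> ` (\<lambda>v. \<phi> (W (\<psi> v))) ` (\<phi> ` S))"
    by (rule negligible_differentiable_image_negligible[rotated])
       (auto intro!: differentiable_at_imp_differentiable_on bounded_linear_imp_differentiable[OF \<psi>])
  then show ?thesis by (simp add: image_image)
qed

text \<open>The curve consists of the solutions \<open>w\<close> of
  \<open>w * cis t = Complex (u t) (v t)\<close>, the form in which conditions at a critical point
  prescribe a coefficient.\<close>

lemma negligible_curve:
  fixes u v :: "real \<Rightarrow> real"
  assumes "\<And>t. u differentiable (at t)" "\<And>t. v differentiable (at t)"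
  shows "negligible (range (\<lambda>t. cis (- t) * Complex (u t) (v t)))"
proof (rule negligible_differentiable_image_lowdim)
  have of_real: "(\<lambda>t. complex_of_real (f t)) differentiable (at t)" if "f differentiable (at t)" for f and t :: real
    using that by (auto simp: differentiable_def intro: has_derivative_of_real)
  have "cos differentiable (at t)" "sin differentiable (at t)" for t :: real
    by (auto simp: real_differentiable_def intro: DERIV_cos DERIV_sin)
  then have "(\<lambda>t. (of_real (cos t) - \<i> * of_real (sin t)) * (of_real (u t) + \<i> * of_real (v t))) differentiable_on UNIV"
    using assms
    by (intro differentiable_at_imp_differentiable_on differentiable_mult differentiable_add
        differentiable_diff of_real differentiable_const)
  moreover have "(\<lambda>t. cis (- t) * Complex (u t) (v t))
      = (\<lambda>t. (of_real (cos t) - \<i> * of_real (sin t)) * (of_real (u t) + \<i> * of_real (v t)))"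
    by (simp add: fun_eq_iff complex_eq_iff)
  ultimately show "(\<lambda>t. cis (- t) * Complex (u t) (v t)) differentiable_on UNIV"
    by simp
qed auto

text \<open>
  For \<open>sin (t\<^sub>1 - t\<^sub>2) \<noteq> 0\<close>, \<open>W (Complex t\<^sub>1 t\<^sub>2)\<close> is the only \<open>w\<close> for which \<open>G + 2 Re (w cis)\<close> has the
  critical points \<open>t\<^sub>1\<close> and \<open>t\<^sub>2\<close>, and \<open>H\<close> is the difference of the critical values. By the two
  critical equations \<open>dH = 2 Re (e dW)\<close> with \<open>e = cis t\<^sub>1 - cis t\<^sub>2 \<noteq> 0\<close>; so along \<open>{H = 0}\<close> the
  derivative of \<open>W\<close> can be replaced by its component orthogonal to \<open>cnj e\<close>, which has rank one.
\<close>
lemma negligible_equal_critical_values: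
  fixes G0 G1 G2 :: "real \<Rightarrow> real"
  assumes G1: "\<And>t. (G0 has_real_derivative G1 t) (at t)"
    and G2: "\<And>t. (G1 has_real_derivative G2 t) (at t)"
  shows "negligible {w. \<exists>t1 t2. sin (t1 - t2) \<noteq> 0 \<and>
    G1 t1 - 2 * Im (w * cis t1) = 0 \<and> G1 t2 - 2 * Im (w * cis t2) = 0 \<and>
    G0 t1 + 2 * Re (w * cis t1) = G0 t2 + 2 * Re (w * cis t2)}" (is "negligible ?B")
proof -
  \<comment> \<open>Cramer's rule for the critical equations
    \<open>G1 t = 2 * (Re w * sin t + Im w * cos t)\<close> at \<open>t = Re x\<close> and
    \<open>t = Im x\<close>; their determinant is a multiple of \<open>sin (Re x - Im x)\<close>.
    The pair of parameters is packed into one complex number \<open>x\<close>.\<close>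
  define p where "p x = (G1 (Re x) * cos (Im x) - G1 (Im x) * cos (Re x)) / (2 * sin (Re x - Im x))" for x
  define q where "q x = (G1 (Im x) * sin (Re x) - G1 (Re x) * sin (Im x)) / (2 * sin (Re x - Im x))" for x
  define W where "W x = Complex (p x) (q x)" for x
  define H where "H x = (G0 (Re x) + 2 * (p x * cos (Re x) - q x * sin (Re x)))
      - (G0 (Im x) + 2 * (p x * cos (Im x) - q x * sin (Im x)))" for x
  define S where "S = {x. sin (Re x - Im x) \<noteq> 0 \<and> H x = 0}"
  have comp: "(\<lambda>x. f (g x)) differentiable (at x)"
    if "\<And>t. (f has_real_derivative f' t) (at t)" "g differentiable (at x)"
    for f f' :: "real \<Rightarrow> real" and g :: "complex \<Rightarrow> real" and x
    using that by (auto simp: differentiable_def intro: DERIV_compose_FDERIV)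
  have ReIm: "Re differentiable (at x)" "Im differentiable (at x)" for x
    by (auto intro: bounded_linear_imp_differentiable bounded_linear_Re bounded_linear_Im)
  have diff: "p differentiable (at x)" "q differentiable (at x)" if "sin (Re x - Im x) \<noteq> 0" for x
    unfolding p_def[abs_def] q_def[abs_def] using that
    by (auto intro!: differentiable_divide differentiable_diff differentiable_mult
        comp[OF G2] comp[OF DERIV_cos] comp[OF DERIV_sin] ReIm)
  have crit: "2 * (p x * sin (Re x) + q x * cos (Re x)) = G1 (Re x)"
    "2 * (p x * sin (Im x) + q x * cos (Im x)) = G1 (Im x)" if "sin (Re x - Im x) \<noteq> 0" for x
  proof -
    let ?D = "sin (Re x - Im x)"
    have P: "2 * p x * ?D = G1 (Re x) * cos (Im x) - G1 (Im x) * cos (Re x)"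
      and Q: "2 * q x * ?D = G1 (Im x) * sin (Re x) - G1 (Re x) * sin (Im x)"
      using that by (simp_all add: p_def q_def)
    have "2 * (p x * sin t + q x * cos t) * ?D = (2 * p x * ?D) * sin t + (2 * q x * ?D) * cos t" for t
      by (simp add: algebra_simps)
    then have "2 * (p x * sin t + q x * cos t) * ?D =
        (G1 (Re x) * cos (Im x) - G1 (Im x) * cos (Re x)) * sin t
        + (G1 (Im x) * sin (Re x) - G1 (Re x) * sin (Im x)) * cos t" for t
      by (simp only: P Q)
    from this[of "Re x"] this[of "Im x"]
    have "2 * (p x * sin (Re x) + q x * cos (Re x)) * ?D = G1 (Re x) * ?D"
      "2 * (p x * sin (Im x) + q x * cos (Im x)) * ?D = G1 (Im x) * ?D"
      by (simp_all add: sin_diff algebra_simps)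
    then show "2 * (p x * sin (Re x) + q x * cos (Re x)) = G1 (Re x)"
      "2 * (p x * sin (Im x) + q x * cos (Im x)) = G1 (Im x)"
      using that by (metis mult_right_cancel)+
  qed
  have "negligible (W ` S)"
  proof (rule baby_Sard_complex)
    fix x assume "x \<in> S"
    then have x: "sin (Re x - Im x) \<noteq> 0" by (simp add: S_def)
    define e where "e = cis (Re x) - cis (Im x)"
    have e: "e \<noteq> 0"
    proof
      assume "e = 0"
      then have "cos (Re x) = cos (Im x)" "sin (Re x) = sin (Im x)"
        by (auto simp: e_def complex_eq_iff)
      then show False using x by (simp add: sin_diff)
    qed
    obtain p' q' where p': "(p has_derivative p') (at x)" and q': "(q has_derivative q') (at x)"
      using diff[OF x] by (auto simp: differentiable_def)
    define W' where "W' h = Complex (p' h) (q' h)" for h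
    have W': "(W has_derivative W') (at x)"
      unfolding W_def[abs_def] W'_def[abs_def] Complex_eq
      by (intro has_derivative_add has_derivative_mult_right has_derivative_of_real p' q')
    have Re': "(Re has_derivative Re) (at x)" and Im': "(Im has_derivative Im) (at x)"
      by (auto intro: bounded_linear_imp_has_derivative bounded_linear_Re bounded_linear_Im)
    have "(H has_derivative (\<lambda>h. (Re h * G1 (Re x)
        + 2 * ((p x * (Re h * - sin (Re x)) + p' h * cos (Re x)) - (q x * (Re h * cos (Re x)) + q' h * sin (Re x))))
      - (Im h * G1 (Im x)
        + 2 * ((p x * (Im h * - sin (Im x)) + p' h * cos (Im x)) - (q x * (Im h * cos (Im x)) + q' h * sin (Im x)))))) (at x)"
      unfolding H_def[abs_def]
      by (intro has_derivative_add has_derivative_diff has_derivative_mult has_derivative_mult_right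
          DERIV_compose_FDERIV[OF G1] DERIV_compose_FDERIV[OF DERIV_cos] DERIV_compose_FDERIV[OF DERIV_sin]
          p' q' Re' Im')
    \<comment> \<open>The equations \<open>crit\<close> cancel all terms in which the critical
      points themselves move; only the variation of \<open>p\<close> and \<open>q\<close>
      survives.\<close>
    also have "(\<lambda>h. (Re h * G1 (Re x)
        + 2 * ((p x * (Re h * - sin (Re x)) + p' h * cos (Re x)) - (q x * (Re h * cos (Re x)) + q' h * sin (Re x))))
      - (Im h * G1 (Im x)
        + 2 * ((p x * (Im h * - sin (Im x)) + p' h * cos (Im x)) - (q x * (Im h * cos (Im x)) + q' h * sin (Im x)))))
      = (\<lambda>h. 2 * Re (W' h * e))"
      unfolding crit[OF x, symmetric] by (auto simp: W'_def e_def algebra_simps)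
    finally have H': "(H has_derivative (\<lambda>h. 2 * Re (W' h * e))) (at x within S)"
      by (rule has_derivative_at_withinI)
    \<comment> \<open>\<open>H\<close> vanishes on \<open>S\<close>, so the constant 0 has the
      derivative of \<open>H\<close> within \<open>S\<close>. Subtracting a multiple of this zero
      function changes the derivative of \<open>W\<close> but not \<open>W\<close>.\<close>
    have "((\<lambda>y. 0) has_derivative (\<lambda>h. 2 * Re (W' h * e))) (at x within S)"
      by (rule has_derivative_transform[OF \<open>x \<in> S\<close> _ H']) (simp add: S_def)
    \<comment> \<open>The multiple is chosen to remove from \<open>W' h\<close> its component along
      \<open>cnj e\<close>, using \<open>Re (cnj e * e) = (norm e)\<^sup>2\<close>.\<close>
    from bounded_linear.has_derivative[OF bounded_linear_scaleR_left[of "(1 / (2 * (norm e)\<^sup>2)) *\<^sub>R cnj e"] this]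
    have "((\<lambda>y. 0) has_derivative
        (\<lambda>h. (2 * Re (W' h * e)) *\<^sub>R ((1 / (2 * (norm e)\<^sup>2)) *\<^sub>R cnj e))) (at x within S)"
      by (simp only: scaleR_zero_left)
    from has_derivative_diff[OF has_derivative_at_withinI[OF W'] this]
    have "(W has_derivative (\<lambda>h. W' h - (2 * Re (W' h * e)) *\<^sub>R ((1 / (2 * (norm e)\<^sup>2)) *\<^sub>R cnj e)))
        (at x within S)"
      by (simp only: diff_0_right)
    moreover have "Re ((W' h - (2 * Re (W' h * e)) *\<^sub>R ((1 / (2 * (norm e)\<^sup>2)) *\<^sub>R cnj e)) * e) = 0" for h
    proof -
      have "Re (cnj e * e) = (norm e)\<^sup>2"
        unfolding cmod_power2 by (simp add: power2_eq_square)
      then show ?thesis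
        using e by (simp only: left_diff_distrib mult_scaleR_left minus_complex.sel scaleR_complex.sel) simp
    qed
    ultimately show "\<exists>D e. (W has_derivative D) (at x within S) \<and> e \<noteq> 0 \<and> (\<forall>h. Re (D h * e) = 0)"
      using e by blast
  qed
  moreover have "?B \<subseteq> W ` S"
  proof clarify
    fix w t1 t2
    assume s: "sin (t1 - t2) \<noteq> 0" and c1: "G1 t1 - 2 * Im (w * cis t1) = 0"
      and c2: "G1 t2 - 2 * Im (w * cis t2) = 0"
      and v: "G0 t1 + 2 * Re (w * cis t1) = G0 t2 + 2 * Re (w * cis t2)"
    have g: "G1 t1 = 2 * (Re w * sin t1 + Im w * cos t1)" "G1 t2 = 2 * (Re w * sin t2 + Im w * cos t2)"
      using c1 c2 by auto
    have "G1 t1 * cos t2 - G1 t2 * cos t1 = Re w * (2 * sin (t1 - t2))"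
      "G1 t2 * sin t1 - G1 t1 * sin t2 = Im w * (2 * sin (t1 - t2))"
      unfolding g sin_diff by algebra+
    then have "p (Complex t1 t2) = Re w" "q (Complex t1 t2) = Im w"
      using s by (simp_all add: p_def q_def)
    then have "w = W (Complex t1 t2)" "Complex t1 t2 \<in> S"
      using s v by (auto simp: W_def S_def H_def)
    then show "w \<in> W ` S" by blast
  qed
  ultimately show ?thesis by (rule negligible_subset)
qed

text \<open>A degenerate critical point \<open>t\<close> prescribes both parts of
  \<open>w * cis t\<close>, which gives the curve \<open>C1\<close>; the third derivative makes this
  curve differentiable. Two critical points half a turn apart make the linear system for
  \<open>w\<close> singular and are collected in \<open>C2\<close>. All other pairs belong to
  \<open>C3\<close>.\<close>

lemma negligible_not_morse:
  fixes G0 G1 G2 G3 :: "real \<Rightarrow> real"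
  assumes G1: "\<And>t. (G0 has_real_derivative G1 t) (at t)"
    and G2: "\<And>t. (G1 has_real_derivative G2 t) (at t)"
    and G3: "\<And>t. (G2 has_real_derivative G3 t) (at t)"
  shows "negligible {w. \<not> morse (\<lambda>t. G0 t + 2 * Re (w * cis t)) (\<lambda>t. G1 t - 2 * Im (w * cis t))
    (\<lambda>t. G2 t - 2 * Re (w * cis t))}"
proof -
  have d1: "(\<lambda>t. G1 t / 2) differentiable (at t)" and d2: "(\<lambda>t. G2 t / 2) differentiable (at t)" for t
    using DERIV_cdivide[OF G2, of 2 t] DERIV_cdivide[OF G3, of 2 t] by (auto simp: real_differentiable_def)
  define C1 where "C1 = range (\<lambda>t. cis (- t) * Complex (G2 t / 2) (G1 t / 2))"
  \<comment> \<open>As \<open>cis (t + pi) = - cis t\<close>, equal critical values mean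
    \<open>4 * Re (w * cis t) = G0 (t + pi) - G0 t\<close>; the critical equation at
    \<open>t\<close> supplies the imaginary part.\<close>
  define C2 where "C2 = range (\<lambda>t. cis (- t) * Complex ((G0 (t + pi) - G0 t) / 4) (G1 t / 2))"
  define C3 where "C3 = {w. \<exists>t1 t2. sin (t1 - t2) \<noteq> 0 \<and>
    G1 t1 - 2 * Im (w * cis t1) = 0 \<and> G1 t2 - 2 * Im (w * cis t2) = 0 \<and>
    G0 t1 + 2 * Re (w * cis t1) = G0 t2 + 2 * Re (w * cis t2)}"
  have "negligible C1"
    unfolding C1_def by (intro negligible_curve d1 d2)
  moreover have "negligible C2"
    unfolding C2_def
  proof (rule negligible_curve)
    fix t
    have "((\<lambda>t. (G0 (t + pi) - G0 t) / 4) has_real_derivative (G1 (t + pi) - G1 t) / 4) (at t)"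
      by (auto intro!: derivative_eq_intros G1 DERIV_chain'[OF _ G1])
    then show "(\<lambda>t. (G0 (t + pi) - G0 t) / 4) differentiable (at t)"
      by (auto simp: real_differentiable_def)
  qed (rule d1)
  moreover have "negligible C3"
    unfolding C3_def by (rule negligible_equal_critical_values[OF G1 G2])
  ultimately have N: "negligible (C1 \<union> C2 \<union> C3)"
    by (intro negligible_Un)
  have sub: "w \<in> C1 \<union> C2 \<union> C3"
    if "\<not> morse (\<lambda>t. G0 t + 2 * Re (w * cis t)) (\<lambda>t. G1 t - 2 * Im (w * cis t))
      (\<lambda>t. G2 t - 2 * Re (w * cis t))" for w
  proof -
    have w: "w = cis (- t) * (w * cis t)" for t
      by (simp add: mult.left_commute[of _ w] cis_mult)
    consider t where "G1 t - 2 * Im (w * cis t) = 0" "G2 t - 2 * Re (w * cis t) = 0"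
      | t1 t2 where "0 \<le> t1" "t1 < t2" "t2 < 2 * pi" "G1 t1 - 2 * Im (w * cis t1) = 0"
        "G1 t2 - 2 * Im (w * cis t2) = 0" "G0 t1 + 2 * Re (w * cis t1) = G0 t2 + 2 * Re (w * cis t2)"
      using \<open>\<not> morse _ _ _\<close> unfolding morse_def by blast
    then show ?thesis
    proof cases
      case (1 t)
      then have "w * cis t = Complex (G2 t / 2) (G1 t / 2)"
        by (simp add: complex_eq_iff)
      then have "w = cis (- t) * Complex (G2 t / 2) (G1 t / 2)"
        using w[of t] by simp
      then show ?thesis by (auto simp: C1_def)
    next
      case (2 t1 t2)
      show ?thesis
      proof (cases "sin (t1 - t2) = 0")
        case True
        have "t2 = t1 + pi"
        proof -
          have "sin (t2 - t1) = 0" using True sin_minus[of "t1 - t2"] by simp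
          moreover have "t2 - t1 > 0" "t2 - t1 < 2 * pi" using 2 by auto
          ultimately have "t2 - t1 = pi"
            using sin_gt_zero[of "t2 - t1"] sin_lt_zero[of "t2 - t1"] by linarith
          then show ?thesis by simp
        qed
        then have "cis t2 = - cis t1"
          by (simp add: complex_eq_iff)
        then have "w * cis t1 = Complex ((G0 (t1 + pi) - G0 t1) / 4) (G1 t1 / 2)"
          using 2(4,6) \<open>t2 = t1 + pi\<close> by (simp add: complex_eq_iff)
        then have "w = cis (- t1) * Complex ((G0 (t1 + pi) - G0 t1) / 4) (G1 t1 / 2)"
          using w[of t1] by simp
        then show ?thesis by (auto simp: C2_def)
      next
        case False
        then show ?thesis using 2 unfolding C3_def by blast
      qed
    qed
  qed
  show ?thesis
    by (rule negligible_subset[OF N]) (use sub in blast)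
qed

text \<open>The conditions imposed below the cutoff, at a single frequency. Neither \<open>s\<close>
  nor \<delta> occurs, which allows \<open>sets_nondeg_ray\<close> to test them in a space of
  smaller width.\<close>

definition nondeg_ray :: "'n::finite freq \<Rightarrow> 'n torus_fun \<Rightarrow> bool" where
  "nondeg_ray k f \<longleftrightarrow> (INF t. norm (ray' f k t) + norm (ray'' f k t)) > 0 \<and>
     (\<forall>t1 t2. 0 \<le> t1 \<and> t1 < t2 \<and> t2 < 2 * pi \<and> ray' f k t1 = 0 \<and> ray' f k t2 = 0
        \<longrightarrow> ray f k t1 \<noteq> ray f k t2)"

lemma nondeg_at_iff:
  "(f :: 'n::{finite,linorder} torus_fun) \<in> nondeg_at c s \<delta> \<longleftrightarrow> f \<in> analytic_space s \<and> (\<forall>k\<in>Zstar.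
     (l1 k > cutoff c s \<delta> \<longrightarrow>
        norm (fcoeff f k) \<ge> \<delta> * l1 k powr (- ((real CARD('n) + 3) / 2)) * exp (- (l1 k * s))) \<and>
     (l1 k \<le> cutoff c s \<delta> \<longrightarrow> nondeg_ray k f))"
  by (auto simp: nondeg_at_def nondeg_ray_def)

lemma periodic_C2_ray:
  fixes f :: "'n::{finite,linorder} torus_fun"
  assumes "f \<in> analytic_space s" "0 < s" "k \<noteq> 0"
  shows "periodic_C2 (ray_real 0 f k) (ray_real 1 f k) (ray_real 2 f k)"
  unfolding periodic_C2_def
  using ray_real_deriv[OF assms, of 0] ray_real_deriv[OF assms, of 1] ray_real_deriv[OF assms, of 2]
  by (auto simp: ray_real_periodic numeral_2_eq_2 intro!: continuous_at_imp_continuous_on DERIV_isCont)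

lemma nondeg_ray_iff:
  fixes f :: "'n::{finite,linorder} torus_fun"
  assumes "f \<in> analytic_space s" "0 < s" "k \<noteq> 0"
  shows "nondeg_ray k f \<longleftrightarrow> morse (ray_real 0 f k) (ray_real 1 f k) (ray_real 2 f k)"
  using periodic_C2_INF_pos_iff[OF periodic_C2_ray[OF assms]]
  by (simp add: nondeg_ray_def morse_def ray_eq[OF assms] ray'_eq[OF assms] ray''_eq[OF assms])

text \<open>By \<open>ray_real_dist\<close> a ray and its first two derivatives are Lipschitz in the
  function, uniformly in \<open>t\<close>; \<open>M\<close> is a common Lipschitz constant, and
  \<open>morse_open\<close> does the rest.\<close>

lemma openin_nondeg_ray:
  fixes k :: "'n::{finite,linorder} freq"
  assumes s: "0 < s" and k: "k \<noteq> 0"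
  shows "openin (analytic_top s) {f \<in> analytic_space s. nondeg_ray k f}"
  unfolding openin_analytic_top
proof (intro conjI ballI)
  fix f assume "f \<in> {f \<in> analytic_space s. nondeg_ray k f}"
  then have f: "f \<in> analytic_space s" and "nondeg_ray k f" by auto
  then have "morse (ray_real 0 f k) (ray_real 1 f k) (ray_real 2 f k)"
    using nondeg_ray_iff[OF f s k] by simp
  from morse_open[OF periodic_C2_ray[OF f s k] this]
  obtain e where e: "0 < e"
    "\<And>G0 G1 G2. \<lbrakk>periodic_C2 G0 G1 G2; \<And>t. \<bar>G0 t - ray_real 0 f k t\<bar> < e;
       \<And>t. \<bar>G1 t - ray_real 1 f k t\<bar> < e; \<And>t. \<bar>G2 t - ray_real 2 f k t\<bar> < e\<rbrakk> \<Longrightarrow> morse G0 G1 G2"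
    by metis
  define S where "S m = (\<Sum>\<^sub>\<infinity>j\<in>UNIV - {0::int}. real_of_int \<bar>j\<bar> ^ m * exp (- (real_of_int \<bar>j\<bar> * s)))" for m
  have S0: "0 \<le> S m" for m
    unfolding S_def by (rule infsum_nonneg) auto
  define M where "M = S 0 + S 1 + S 2 + 1"
  have M: "M > 0" "S 0 \<le> M" "S 1 \<le> M" "S 2 \<le> M"
    using S0[of 0] S0[of 1] S0[of 2] by (auto simp: M_def)
  show "\<exists>e>0. \<forall>g\<in>analytic_space s. analytic_dist s f g < e \<longrightarrow> g \<in> {f \<in> analytic_space s. nondeg_ray k f}"
  proof (intro exI[of _ "e / M"] conjI ballI impI)
    show "0 < e / M" using e M by simp
    fix g assume g: "g \<in> analytic_space s" and d: "analytic_dist s f g < e / M"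
    interpret Metric_space "analytic_space s" "analytic_dist s"
      by (rule Metric_space_analytic)
    have "\<bar>ray_real m g k t - ray_real m f k t\<bar> < e" if "m = 0 \<or> m = 1 \<or> m = 2" for m t
    proof -
      have "\<bar>ray_real m g k t - ray_real m f k t\<bar> \<le> analytic_dist s f g * S m"
        using ray_real_dist[OF f s k g, of m t] by (simp add: S_def abs_minus_commute)
      also have "\<dots> \<le> analytic_dist s f g * M"
        using that M by (intro mult_left_mono) auto
      also have "\<dots> < e" using d M by (simp add: field_simps)
      finally show ?thesis .
    qed
    then have "morse (ray_real 0 g k) (ray_real 1 g k) (ray_real 2 g k)"
      by (intro e(2) periodic_C2_ray[OF g s k]) auto
    then show "g \<in> {f \<in> analytic_space s. nondeg_ray k f}"
      using nondeg_ray_iff[OF g s k] g by simp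
  qed
qed auto

section \<open>A ray as a function of its first coefficient\<close>

lemma scale_eq_self_iff:
  fixes k :: "'n::finite freq"
  assumes "k \<noteq> 0" shows "j *s k = k \<longleftrightarrow> j = 1"
  using assms by (auto simp: vec_eq_iff)

lemma herm_fun_upd_ray:
  assumes k: "k \<in> Zsharp"
  shows "herm (a(k := w)) (j *s k)
    = herm (a(k := 0)) (j *s k) + (if j = 1 then w else if j = - 1 then cnj w else 0)"
proof -
  have k0: "k \<noteq> 0" using k by auto
  consider "j > 0" | "j = 0" | "j < 0" by linarith
  then show ?thesis
  proof cases
    case 1
    then show ?thesis
      using Zsharp_scale[OF k 1] scale_eq_self_iff[OF k0, of j] by (auto simp: herm_Zsharp)
  next
    case 2
    have "(0::int) *s k = 0" by (simp add: vec_eq_iff)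
    then show ?thesis using 2 by simp
  next
    case 3
    have eq: "j *s k = - ((- j) *s k)" by (simp add: vec_eq_iff)
    have "(- j) *s k \<in> Zsharp" using Zsharp_scale[OF k, of "- j"] 3 by simp
    moreover have "(- j) *s k = k \<longleftrightarrow> j = - 1"
      using scale_eq_self_iff[OF k0, of "- j"] by linarith
    ultimately show ?thesis
      using 3 unfolding eq herm_minus by (auto simp: herm_Zsharp)
  qed
qed

lemma synth_upd_in_space:
  assumes "0 < s" "\<And>k. k \<in> Zsharp \<Longrightarrow> norm (a k) * exp (l1 k * s) \<le> C"
  shows "synth (a(k := w)) \<in> analytic_space s" "fcoeff (synth (a(k := w))) = herm (a(k := w))"
proof -
  have "norm ((a(k := w)) m) * exp (l1 m * s) \<le> max C (norm w * exp (l1 k * s))" if "m \<in> Zsharp" for m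
    using assms(2)[OF that] by auto
  note * = synth_in_space[where a = "a(k := w)", OF assms(1) this]
  show "synth (a(k := w)) \<in> analytic_space s" by (rule *(1))
  show "fcoeff (synth (a(k := w))) = herm (a(k := w))" by (rule *(2))
qed

text \<open>The coefficients at \<open>j = 1\<close> and \<open>j = - 1\<close> are conjugate, so
  together they give twice a real part, and \<open>a(k := 0)\<close> leaves a remainder free of
  \<open>w\<close>. For \<open>m\<close> up to 2 the factor \<open>\<i> ^ m\<close> produces the
  three perturbations in \<open>negligible_not_morse\<close>.\<close>

lemma ray_real_synth_upd:
  assumes s: "0 < s" and a: "\<And>k. k \<in> Zsharp \<Longrightarrow> norm (a k) * exp (l1 k * s) \<le> C" and k: "k \<in> Zsharp"
  shows "ray_real m (synth (a(k := w))) k t = ray_real m (synth (a(k := 0))) k t + 2 * Re (\<i> ^ m * w * cis t)"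
proof -
  have k0: "k \<noteq> 0" using k by auto
  have f: "synth (a(k := w)) \<in> analytic_space s" "fcoeff (synth (a(k := w))) = herm (a(k := w))" for w
    by (rule synth_upd_in_space[OF s a], assumption)+
  note g = f[of 0]
  let ?d = "\<lambda>j::int. if j = 1 then w else if j = - 1 then cnj w else 0"
  have "((\<lambda>j. (\<i> * of_int j) ^ m * herm (a(k := 0)) (j *s k) * cis (of_int j * t)) has_sum
      of_real (ray_real m (synth (a(k := 0))) k t)) (UNIV - {0})"
    using trig_sum_has_sum[OF s ray_bound[OF g(1) s k0], of m t]
    unfolding g(2) trig_sum_ray[OF g(1) s k0, unfolded g(2)] .
  moreover have "((\<lambda>j. (\<i> * of_int j) ^ m * ?d j * cis (of_int j * t)) has_sum
      of_real (2 * Re (\<i> ^ m * w * cis t))) (UNIV - {0})"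
  proof (rule has_sum_finite_neutralI[of "{1, -1}"])
    have "(\<Sum>j\<in>{1, -1}. (\<i> * of_int j) ^ m * ?d j * cis (of_int j * t))
        = \<i> ^ m * w * cis t + cnj (\<i> ^ m * w * cis t)"
      by (simp add: cis_cnj)
    also have "\<dots> = of_real (2 * Re (\<i> ^ m * w * cis t))"
      by (rule complex_add_cnj)
    finally show "of_real (2 * Re (\<i> ^ m * w * cis t)) = (\<Sum>j\<in>{1, -1}. (\<i> * of_int j) ^ m * ?d j * cis (of_int j * t))" ..
  qed auto
  ultimately have "((\<lambda>j. (\<i> * of_int j) ^ m * herm (a(k := 0)) (j *s k) * cis (of_int j * t)
      + (\<i> * of_int j) ^ m * ?d j * cis (of_int j * t)) has_sum
      (of_real (ray_real m (synth (a(k := 0))) k t) + of_real (2 * Re (\<i> ^ m * w * cis t)))) (UNIV - {0})"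
    by (rule has_sum_add)
  then have "((\<lambda>j. (\<i> * of_int j) ^ m * herm (a(k := w)) (j *s k) * cis (of_int j * t)) has_sum
      (of_real (ray_real m (synth (a(k := 0))) k t) + of_real (2 * Re (\<i> ^ m * w * cis t)))) (UNIV - {0})"
    unfolding herm_fun_upd_ray[OF k, of a w] by (simp only: distrib_left distrib_right)
  then have "trig_sum m (\<lambda>j. fcoeff (synth (a(k := w))) (j *s k)) t
      = of_real (ray_real m (synth (a(k := 0))) k t + 2 * Re (\<i> ^ m * w * cis t))"
    unfolding trig_sum_def f(2) by (simp add: infsumI)
  then have "complex_of_real (ray_real m (synth (a(k := w))) k t)
      = of_real (ray_real m (synth (a(k := 0))) k t + 2 * Re (\<i> ^ m * w * cis t))"
    by (simp only: trig_sum_ray[OF f(1) s k0])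
  then show ?thesis by (simp only: of_real_eq_iff)
qed

text \<open>All other coefficients, those further out on the same ray included, are frozen in
  \<open>a\<close>. This is the common source of density and of the almost sure statement.\<close>

lemma negligible_degenerate_coeff:
  assumes s: "0 < s" and a: "\<And>k. k \<in> Zsharp \<Longrightarrow> norm (a k) * exp (l1 k * s) \<le> C" and k: "k \<in> Zsharp"
  shows "negligible {w. \<not> nondeg_ray k (synth (a(k := w)))}"
proof -
  have k0: "k \<noteq> 0" using k by auto
  have f: "synth (a(k := w)) \<in> analytic_space s" for w
    by (rule synth_upd_in_space(1)[OF s a])
  let ?G = "\<lambda>m. ray_real m (synth (a(k := 0))) k"
  have "nondeg_ray k (synth (a(k := w))) \<longleftrightarrow>
    morse (\<lambda>t. ?G 0 t + 2 * Re (w * cis t)) (\<lambda>t. ?G 1 t - 2 * Im (w * cis t)) (\<lambda>t. ?G 2 t - 2 * Re (w * cis t))" for w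
  proof -
    have "ray_real 0 (synth (a(k := w))) k = (\<lambda>t. ?G 0 t + 2 * Re (w * cis t))"
      "ray_real 1 (synth (a(k := w))) k = (\<lambda>t. ?G 1 t - 2 * Im (w * cis t))"
      "ray_real 2 (synth (a(k := w))) k = (\<lambda>t. ?G 2 t - 2 * Re (w * cis t))"
      using ray_real_synth_upd[OF s a k, where w = w]
      by (simp_all add: fun_eq_iff mult.assoc)
    then show ?thesis
      by (simp add: nondeg_ray_iff[OF f s k0])
  qed
  moreover have "negligible {w. \<not> morse (\<lambda>t. ?G 0 t + 2 * Re (w * cis t)) (\<lambda>t. ?G 1 t - 2 * Im (w * cis t))
      (\<lambda>t. ?G 2 t - 2 * Re (w * cis t))}"
  proof (rule negligible_not_morse)
    show "(?G 0 has_real_derivative ?G 1 t) (at t)" "(?G 1 has_real_derivative ?G 2 t) (at t)"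
    "(?G 2 has_real_derivative ?G 3 t) (at t)" for t
    using ray_real_deriv[OF f s k0, of 0 0 t] ray_real_deriv[OF f s k0, of 1 0 t] ray_real_deriv[OF f s k0, of 2 0 t]
    by (simp_all add: numeral_2_eq_2 numeral_3_eq_3)
  qed
  ultimately show ?thesis by simp
qed

section \<open>The non-degenerate set is Borel and has dense interior\<close>

lemma cutoff_eq: "cutoff c s \<delta> = c * max 1 (max (1 / s) (1 / s * ln (1 / (s * \<delta>))))"
  by (simp add: cutoff_def)

lemma cutoff_antimono:
  assumes "0 < s" "0 \<le> c" "0 < \<delta>'" "\<delta>' \<le> \<delta>"
  shows "cutoff c s \<delta> \<le> cutoff c s \<delta>'"
proof -
  have "ln (1 / (s * \<delta>)) \<le> ln (1 / (s * \<delta>'))"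
    using assms by (intro ln_mono divide_left_mono mult_left_mono) auto
  then have le: "1 / s * ln (1 / (s * \<delta>)) \<le> 1 / s * ln (1 / (s * \<delta>'))"
    using assms by (intro mult_left_mono) auto
  show ?thesis
    unfolding cutoff_eq
    by (rule mult_left_mono[OF max.mono[OF order_refl max.mono[OF order_refl le]] assms(2)])
qed

text \<open>
  The set of frequencies below the cutoff is locally constant to the left of \<open>\<delta>\<close>, because \<open>l1\<close>
  takes integer values. This reduces the uncountable union in \<open>nondeg\<close> to a countable one.
\<close>
lemma rational_cutoff:
  assumes "0 < s" "0 \<le> c" "0 < \<delta>"
  obtains q where "q \<in> \<rat>" "0 < q" "q \<le> \<delta>" "\<And>k::'n::finite freq. l1 k \<le> cutoff c s q \<Longrightarrow> l1 k \<le> cutoff c s \<delta>"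
proof -
  \<comment> \<open>The least integer strictly above the cutoff. Continuity keeps the cutoff below
    \<open>N\<close> for nearby \<open>q\<close>, and integrality of \<open>l1 k\<close> turns
    \<open>l1 k < N\<close> back into a bound by the old cutoff.\<close>
  define N where "N = real_of_int (\<lfloor>cutoff c s \<delta>\<rfloor> + 1)"
  have N: "cutoff c s \<delta> < N" unfolding N_def by linarith
  have "isCont (cutoff c s) \<delta>"
    unfolding cutoff_eq using assms by (intro continuous_intros) auto
  then have "eventually (\<lambda>q. cutoff c s q < N) (at_left \<delta>)"
    using N by (intro order_tendstoD(2)[of _ "cutoff c s \<delta>"])
      (auto simp: isCont_def intro: tendsto_mono[OF at_le])
  then obtain b where b: "b < \<delta>" "\<And>q. b < q \<Longrightarrow> q < \<delta> \<Longrightarrow> cutoff c s q < N"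
    by (auto simp: eventually_at_left[of "\<delta> - 1" \<delta>])
  obtain q where q: "q \<in> \<rat>" "max b 0 < q" "q < \<delta>"
    using Rats_dense_in_real[of "max b 0" \<delta>] b assms by auto
  show ?thesis
  proof (rule that[of q])
    fix k :: "'n freq" assume "l1 k \<le> cutoff c s q"
    then have "l1 k < N" using b(2)[of q] q by auto
    then have "(\<Sum>i\<in>UNIV. \<bar>k $ i\<bar>) \<le> \<lfloor>cutoff c s \<delta>\<rfloor>"
      unfolding N_def l1_of_int by linarith
    then show "l1 k \<le> cutoff c s \<delta>"
      unfolding l1_of_int by linarith
  qed (use q in auto)
qed

text \<open>Lowering \<delta> relaxes the lower bound but raises the cutoff, which could subject
  more rays to the other conditions; \<open>eq\<close> says that no further frequency is
  caught.\<close>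

lemma nondeg_at_mono:
  fixes f :: "'n::{finite,linorder} torus_fun"
  assumes f: "f \<in> nondeg_at c s \<delta>" and "0 < s" "0 \<le> c" "0 < q" "q \<le> \<delta>"
    and eq: "\<And>k::'n freq. l1 k \<le> cutoff c s q \<Longrightarrow> l1 k \<le> cutoff c s \<delta>"
  shows "f \<in> nondeg_at c s q"
  unfolding nondeg_at_iff
proof (intro conjI ballI impI)
  show "f \<in> analytic_space s" using f by (simp add: nondeg_at_iff)
  fix k :: "'n freq" assume k: "k \<in> Zstar"
  {
    assume "cutoff c s q < l1 k"
    then have "cutoff c s \<delta> < l1 k"
      using cutoff_antimono[of s c q \<delta>] assms by linarith
    then have "\<delta> * l1 k powr (- ((real CARD('n) + 3) / 2)) * exp (- (l1 k * s)) \<le> norm (fcoeff f k)"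
      using f k by (auto simp: nondeg_at_iff)
    moreover have "q * l1 k powr (- ((real CARD('n) + 3) / 2)) * exp (- (l1 k * s))
        \<le> \<delta> * l1 k powr (- ((real CARD('n) + 3) / 2)) * exp (- (l1 k * s))"
      using assms by (intro mult_right_mono) auto
    ultimately show "q * l1 k powr (- ((real CARD('n) + 3) / 2)) * exp (- (l1 k * s)) \<le> norm (fcoeff f k)"
      by linarith
  }
  assume "l1 k \<le> cutoff c s q"
  from eq[OF this] show "nondeg_ray k f" using f k by (auto simp: nondeg_at_iff)
qed

lemma nondeg_rational:
  assumes "0 < s" "0 \<le> c"
  shows "(nondeg c s :: 'n::{finite,linorder} torus_fun set) = (\<Union>q\<in>\<rat> \<inter> {0<..1}. nondeg_at c s q)"
proof
  show "(nondeg c s :: 'n torus_fun set) \<subseteq> (\<Union>q\<in>\<rat> \<inter> {0<..1}. nondeg_at c s q)"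
  proof
    fix f :: "'n torus_fun" assume "f \<in> nondeg c s"
    then obtain \<delta> where \<delta>: "0 < \<delta>" "\<delta> \<le> 1" "f \<in> nondeg_at c s \<delta>"
      by (auto simp: nondeg_def)
    obtain q where "q \<in> \<rat>" "0 < q" "q \<le> \<delta>" "\<And>k::'n freq. l1 k \<le> cutoff c s q \<Longrightarrow> l1 k \<le> cutoff c s \<delta>"
      using rational_cutoff[OF assms \<delta>(1)] by metis
    then show "f \<in> (\<Union>q\<in>\<rat> \<inter> {0<..1}. nondeg_at c s q)"
      using nondeg_at_mono[OF \<delta>(3) assms, of q] \<delta> by auto
  qed
qed (auto simp: nondeg_def)

lemma openin_fcoeff_less:
  fixes k :: "'n::{finite,linorder} freq"
  assumes "0 < s"
  shows "openin (analytic_top s) {f \<in> analytic_space s. norm (fcoeff f k) < r}"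
  unfolding openin_analytic_top
proof (intro conjI ballI)
  fix f assume f: "f \<in> {f \<in> analytic_space s. norm (fcoeff f k) < r}"
  show "\<exists>e>0. \<forall>g\<in>analytic_space s. analytic_dist s f g < e \<longrightarrow> g \<in> {f \<in> analytic_space s. norm (fcoeff f k) < r}"
  proof (intro exI[of _ "r - norm (fcoeff f k)"] conjI ballI impI)
    fix g assume g: "g \<in> analytic_space s" "analytic_dist s f g < r - norm (fcoeff f k)"
    have "norm (fcoeff f k - fcoeff g k) * 1 \<le> norm (fcoeff f k - fcoeff g k) * exp (l1 k * s)"
      using assms by (intro mult_left_mono) auto
    also have "\<dots> < r - norm (fcoeff f k)"
      using analytic_dist_ge[of f s g k] f g by simp
    finally have "norm (fcoeff g k) < r"
      using norm_triangle_ineq2[of "fcoeff g k" "fcoeff f k"] by (simp add: norm_minus_commute)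
    then show "g \<in> {f \<in> analytic_space s. norm (fcoeff f k) < r}" using g by simp
  qed (use f in simp)
qed auto

lemma borel_fcoeff_ge:
  fixes k :: "'n::{finite,linorder} freq"
  assumes "0 < s"
  shows "{f \<in> analytic_space s. r \<le> norm (fcoeff f k)} \<in> sets (analytic_borel s)"
proof -
  have "analytic_space s - {f \<in> analytic_space s. norm (fcoeff f k) < r} \<in> sets (analytic_borel s)"
    using sets.compl_sets[OF open_in_analytic_borel[OF openin_fcoeff_less[OF assms]], of k r] by simp
  moreover have "analytic_space s - {f \<in> analytic_space s. norm (fcoeff f k) < r}
      = {f \<in> analytic_space s. r \<le> norm (fcoeff f k)}"
    by auto
  ultimately show ?thesis by simp
qed

lemma sets_Collect_Ball_countable:
  fixes X :: "'b::countable set"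
  assumes "\<And>k. k \<in> X \<Longrightarrow> {x \<in> space M. P k x} \<in> sets M"
  shows "{x \<in> space M. \<forall>k\<in>X. P k x} \<in> sets M"
proof -
  have "{x \<in> space M. \<forall>k\<in>X. P k x} = space M - (\<Union>k\<in>X. space M - {x \<in> space M. P k x})"
    by auto
  moreover have "\<dots> \<in> sets M"
    using assms by (intro sets.compl_sets sets.countable_UN' sets.Diff) auto
  ultimately show ?thesis by simp
qed

text \<open>
  Stated for an arbitrary family \<open>\<Phi>\<close> because synthesis with the weights of the unit ball is not
  measurable for the full Borel algebra of the sup-norm, although each condition pulls back to
  a measurable set.
\<close>
lemma nondeg_preimage_sets:
  fixes \<Phi> :: "'a \<Rightarrow> 'n::{finite,linorder} torus_fun"
  assumes "0 < s" "0 \<le> c"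
    and space: "\<And>z. z \<in> space M \<Longrightarrow> \<Phi> z \<in> analytic_space s"
    and coeff: "\<And>k r. k \<in> Zstar \<Longrightarrow> {z \<in> space M. r \<le> norm (fcoeff (\<Phi> z) k)} \<in> sets M"
    and ray: "\<And>k. k \<in> Zstar \<Longrightarrow> {z \<in> space M. nondeg_ray k (\<Phi> z)} \<in> sets M"
  shows "{z \<in> space M. \<Phi> z \<in> nondeg c s} \<in> sets M"
proof -
  have "{z \<in> space M. \<Phi> z \<in> nondeg_at c s q} \<in> sets M" for q
  proof -
    have "{z \<in> space M. \<forall>k\<in>Zstar.
      (l1 k > cutoff c s q \<longrightarrow>
        norm (fcoeff (\<Phi> z) k) \<ge> q * l1 k powr (- ((real CARD('n) + 3) / 2)) * exp (- (l1 k * s))) \<and>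
      (l1 k \<le> cutoff c s q \<longrightarrow> nondeg_ray k (\<Phi> z))} \<in> sets M"
    proof (rule sets_Collect_Ball_countable)
      fix k :: "'n freq" assume k: "k \<in> Zstar"
      show "{z \<in> space M.
        (l1 k > cutoff c s q \<longrightarrow>
          norm (fcoeff (\<Phi> z) k) \<ge> q * l1 k powr (- ((real CARD('n) + 3) / 2)) * exp (- (l1 k * s))) \<and>
        (l1 k \<le> cutoff c s q \<longrightarrow> nondeg_ray k (\<Phi> z))} \<in> sets M"
        using coeff[OF k] ray[OF k] by (cases "l1 k \<le> cutoff c s q") auto
    qed
    also have "{z \<in> space M. \<forall>k\<in>Zstar.
      (l1 k > cutoff c s q \<longrightarrow>
        norm (fcoeff (\<Phi> z) k) \<ge> q * l1 k powr (- ((real CARD('n) + 3) / 2)) * exp (- (l1 k * s))) \<and>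
      (l1 k \<le> cutoff c s q \<longrightarrow> nondeg_ray k (\<Phi> z))} = {z \<in> space M. \<Phi> z \<in> nondeg_at c s q}"
      using space unfolding nondeg_at_iff by blast
    finally show ?thesis .
  qed
  then have "(\<Union>q\<in>\<rat> \<inter> {0<..1}. {z \<in> space M. \<Phi> z \<in> nondeg_at c s q}) \<in> sets M"
    by (intro sets.countable_UN' countable_Int1 countable_rat) auto
  also have "(\<Union>q\<in>\<rat> \<inter> {0<..1}. {z \<in> space M. \<Phi> z \<in> nondeg_at c s q}) = {z \<in> space M. \<Phi> z \<in> nondeg c s}"
    unfolding nondeg_rational[OF assms(1,2)] by auto
  finally show ?thesis .
qed

lemma nondeg_subset: "nondeg c s \<subseteq> analytic_space s"
  by (auto simp: nondeg_def nondeg_at_iff)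

lemma nondeg_borel:
  assumes "0 < s" "0 \<le> c"
  shows "(nondeg c s :: 'n::{finite,linorder} torus_fun set) \<in> sets (analytic_borel s)"
proof -
  have "{f \<in> space (analytic_borel s). (f :: 'n torus_fun) \<in> nondeg c s} \<in> sets (analytic_borel s)"
  proof (rule nondeg_preimage_sets[OF assms])
    fix k :: "'n freq" and r assume k: "k \<in> Zstar"
    show "{z \<in> space (analytic_borel s). r \<le> norm (fcoeff z k)} \<in> sets (analytic_borel s)"
      using borel_fcoeff_ge[OF assms(1)] by simp
    show "{z \<in> space (analytic_borel s). nondeg_ray k z} \<in> sets (analytic_borel s)"
      using open_in_analytic_borel[OF openin_nondeg_ray[OF assms(1) Zstar_nonzero[OF k]]] by simp
  qed simp
  also have "{f \<in> space (analytic_borel s). (f :: 'n torus_fun) \<in> nondeg c s} = nondeg c s"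
    using nondeg_subset[of c s] by auto
  finally show ?thesis .
qed

section \<open>Which coefficients a ray depends on\<close>

lemma nondeg_ray_cong:
  assumes "\<And>j. fcoeff f (j *s k) = fcoeff g (j *s k)"
  shows "nondeg_ray k f = nondeg_ray k g"
proof -
  have 1: "ray f k = ray g k" using assms by (simp add: ray_def fun_eq_iff)
  then have 2: "ray' f k = ray' g k" unfolding ray'_def[abs_def] by simp
  then have 3: "ray'' f k = ray'' g k" unfolding ray''_def[abs_def] by simp
  show ?thesis unfolding nondeg_ray_def 1 2 3 ..
qed

lemma herm_ray_cong:
  assumes k: "k \<in> Zsharp" and "\<And>j. 0 < j \<Longrightarrow> a (j *s k) = b (j *s k)"
  shows "herm a (j *s k) = herm b (j *s k)"
proof -
  have pos: "herm a (j *s k) = herm b (j *s k)" if "j > 0" for j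
    using Zsharp_scale[OF k that] assms(2)[OF that] by (simp add: herm_Zsharp)
  have "j *s k = - ((- j) *s k)" "(0::int) *s k = 0" for j by (simp_all add: vec_eq_iff)
  then show ?thesis
    using pos[of j] pos[of "- j"] by (cases "j = 0"; cases "j > 0") (metis herm_minus herm_zero linorder_neqE_linordered_idom neg_0_less_iff_less)+
qed

text \<open>Guarantees that changing coefficients at primitive frequencies touches each primitive
  ray in its first coefficient and the conjugate one only, so that perturbations of several rays do
  not interfere.\<close>

lemma Zstar_multiple:
  assumes k: "k \<in> Zstar" and j: "1 < j" shows "j *s k \<notin> Zstar"
proof
  assume "j *s k \<in> Zstar"
  then have "Gcd (range (\<lambda>i. (j *s k) $ i)) = 1" by (simp add: Zstar_def)
  moreover have "j dvd Gcd (range (\<lambda>i. (j *s k) $ i))"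
    by (rule Gcd_greatest) auto
  ultimately have "j dvd 1" by simp
  then show False using j by (simp add: zdvd_not_zless)
qed

lemma openin_nondeg_rays:
  fixes F :: "'n::{finite,linorder} freq set"
  assumes "0 < s" "finite F" "\<And>k. k \<in> F \<Longrightarrow> k \<noteq> 0"
  shows "openin (analytic_top s) {f \<in> analytic_space s. \<forall>k\<in>F. nondeg_ray k f}"
  using assms(2,3)
proof (induction F)
  case empty
  then show ?case using openin_topspace[of "analytic_top s"] by simp
next
  case (insert k F)
  have "{f \<in> analytic_space s. \<forall>k\<in>insert k F. nondeg_ray k f}
    = {f \<in> analytic_space s. nondeg_ray k f} \<inter> {f \<in> analytic_space s. \<forall>k\<in>F. nondeg_ray k f}"
    by auto
  then show ?case
    using insert by (simp add: openin_Int openin_nondeg_ray[OF assms(1)])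
qed

lemma nondeg_interior_dense:
  fixes f :: "'n::{finite,linorder} torus_fun"
  assumes s: "0 < s" and f: "f \<in> analytic_space s" and \<epsilon>: "0 < \<epsilon>"
  obtains h V where "openin (analytic_top s) V" "V \<subseteq> nondeg c s" "h \<in> V" "analytic_dist s f h < \<epsilon>"
proof -
  interpret Metric_space "analytic_space s" "analytic_dist s :: 'n torus_fun \<Rightarrow> _"
    by (rule Metric_space_analytic)
  \<comment> \<open>One \<delta> is both the parameter of \<open>nondeg_at\<close> and the unit of
    size: normalised coefficients move by at most \<open>4 * \<delta>\<close>, which is at most half
    of \<open>\<epsilon>\<close>.\<close>
  define \<delta> where "\<delta> = min 1 (\<epsilon> / 8)"
  have \<delta>: "0 < \<delta>" "\<delta> \<le> 1" "8 * \<delta> \<le> \<epsilon>" using \<epsilon> by (auto simp: \<delta>_def)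
  define a where "a = fcoeff f"
  define F where "F = {k::'n freq. k \<in> Zstar \<and> l1 k \<le> cutoff c s \<delta>}"
  have F: "finite F"
    by (rule finite_subset[OF _ finite_l1_le[of "cutoff c s \<delta>"]]) (auto simp: F_def)
  have a: "norm (a k) * exp (l1 k * s) \<le> analytic_norm s f" for k
    unfolding a_def by (rule analytic_spaceD(3)[OF f])
  have "\<exists>w. norm (w - a k) * exp (l1 k * s) < 4 * \<delta> \<and> nondeg_ray k (synth (a(k := w)))" if "k \<in> F" for k
  proof -
    have k: "k \<in> Zsharp" using that by (auto simp: F_def Zstar_subset)
    have "negligible {w. \<not> nondeg_ray k (synth (a(k := w)))}"
      by (rule negligible_degenerate_coeff[OF s a k])
    moreover have "\<not> negligible (ball (a k) (4 * \<delta> / exp (l1 k * s)))"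
      using \<delta> by (intro open_not_negligible) (simp_all add: not_le)
    ultimately have "\<not> ball (a k) (4 * \<delta> / exp (l1 k * s)) \<subseteq> {w. \<not> nondeg_ray k (synth (a(k := w)))}"
      using negligible_subset by blast
    then obtain w where "dist (a k) w < 4 * \<delta> / exp (l1 k * s)" "nondeg_ray k (synth (a(k := w)))"
      by auto
    then show ?thesis
      by (intro exI[of _ w]) (simp add: dist_norm norm_minus_commute field_simps)
  qed
  then obtain w where w: "\<And>k. k \<in> F \<Longrightarrow> norm (w k - a k) * exp (l1 k * s) < 4 * \<delta>"
    "\<And>k. k \<in> F \<Longrightarrow> nondeg_ray k (synth (a(k := w k)))"
    by metis
  \<comment> \<open>Rays below the cutoff receive a non-degenerate first coefficient; small
    primitive coefficients above it are raised to normalised modulus exactly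
    \<open>2 * \<delta>\<close>, of which \<delta> survives in a ball of radius \<delta>.
    Non-primitive frequencies stay as they are.\<close>
  define b where "b k = (if k \<in> F then w k else if k \<in> Zstar \<and> norm (a k) * exp (l1 k * s) < 2 * \<delta>
    then of_real (2 * \<delta> / exp (l1 k * s)) else a k)" for k
  have ba: "norm (b k - a k) * exp (l1 k * s) \<le> 4 * \<delta>" for k
  proof -
    consider "k \<in> F" | "k \<notin> F" "k \<in> Zstar" "norm (a k) * exp (l1 k * s) < 2 * \<delta>" | "b k = a k"
      by (cases "k \<in> F"; cases "k \<in> Zstar \<and> norm (a k) * exp (l1 k * s) < 2 * \<delta>") (auto simp: b_def)
    then show ?thesis
    proof cases
      case 1
      then show ?thesis using w(1)[of k] by (simp add: b_def)
    next
      case 2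
      have "norm (b k - a k) * exp (l1 k * s) \<le> (norm (b k) + norm (a k)) * exp (l1 k * s)"
        by (intro mult_right_mono norm_triangle_ineq4) auto
      also have "\<dots> = 2 * \<delta> + norm (a k) * exp (l1 k * s)"
        using 2 \<delta> by (simp add: b_def distrib_right norm_divide)
      finally show ?thesis using 2 by simp
    next
      case 3
      then show ?thesis using \<delta> by simp
    qed
  qed
  have b: "norm (b k) * exp (l1 k * s) \<le> 4 * \<delta> + analytic_norm s f" for k
  proof -
    have "norm (b k) * exp (l1 k * s) \<le> (norm (b k - a k) + norm (a k)) * exp (l1 k * s)"
      using norm_triangle_ineq[of "b k - a k" "a k"] by (intro mult_right_mono) auto
    then show ?thesis using ba[of k] a[of k] by (simp add: distrib_right)
  qed
  define h where "h = synth b"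
  have h: "h \<in> analytic_space s" "fcoeff h = herm b"
    unfolding h_def by (rule synth_in_space[OF s b])+
  have dist: "analytic_dist s f h \<le> 4 * \<delta>"
    using \<delta> ba by (intro analytic_dist_le f h) (auto simp: h herm_Zsharp norm_minus_commute a_def[symmetric])
  have ray: "nondeg_ray k h" if k: "k \<in> F" for k
  proof -
    have kZ: "k \<in> Zstar" "k \<in> Zsharp" using k by (auto simp: F_def Zstar_subset)
    have "herm b (j *s k) = herm (a(k := w k)) (j *s k)" for j
    proof (rule herm_ray_cong[OF kZ(2)])
      fix j :: int assume j: "0 < j"
      show "b (j *s k) = (a(k := w k)) (j *s k)"
      proof (cases "j = 1")
        case True
        then show ?thesis using k by (simp add: b_def)
      next
        case False
        \<comment> \<open>The higher coefficients of the ray sit at non-primitive frequencies, where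
          \<open>b\<close> agrees with \<open>a\<close>; hence \<open>w(2)\<close>, proved for a
          single change, still applies.\<close>
        then have "j *s k \<notin> Zstar" "j *s k \<noteq> k"
          using Zstar_multiple[OF kZ(1), of j] j kZ(1) by auto
        then show ?thesis by (simp add: b_def F_def)
      qed
    qed
    then have "nondeg_ray k h = nondeg_ray k (synth (a(k := w k)))"
      by (intro nondeg_ray_cong) (simp add: h synth_upd_in_space(2)[OF s a])
    then show ?thesis using w(2)[OF k] by simp
  qed
  define V where "V = mball h \<delta> \<inter> {g \<in> analytic_space s. \<forall>k\<in>F. nondeg_ray k g}"
  show ?thesis
  proof (rule that)
    show "openin (analytic_top s) V"
      unfolding V_def using openin_mball[of h \<delta>]
      by (intro openin_Int openin_nondeg_rays s F) (auto simp: analytic_top_def F_def Zstar_nonzero)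
    show "h \<in> V" using h \<delta> ray by (auto simp: V_def)
    show "analytic_dist s f h < \<epsilon>" using dist \<delta> by linarith
    show "V \<subseteq> nondeg c s"
    proof
      fix g assume g: "g \<in> V"
      then have gs: "g \<in> analytic_space s" and d: "analytic_dist s h g < \<delta>" and gF: "\<forall>k\<in>F. nondeg_ray k g"
        by (auto simp: V_def)
      have "g \<in> nondeg_at c s \<delta>"
        unfolding nondeg_at_iff
      proof (intro conjI ballI impI gs)
        fix k :: "'n freq" assume k: "k \<in> Zstar"
        show "nondeg_ray k g" if "l1 k \<le> cutoff c s \<delta>"
          using gF k that by (simp add: F_def)
        assume "cutoff c s \<delta> < l1 k"
        then have "k \<notin> F" by (simp add: F_def)
        then have "2 * \<delta> \<le> norm (b k) * exp (l1 k * s)"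
          using k \<delta> by (simp add: b_def norm_divide)
        also have "\<dots> = norm (fcoeff h k) * exp (l1 k * s)"
          using k by (simp add: h herm_Zsharp Zstar_subset)
        also have "\<dots> \<le> (norm (fcoeff h k - fcoeff g k) + norm (fcoeff g k)) * exp (l1 k * s)"
          using norm_triangle_ineq[of "fcoeff h k - fcoeff g k" "fcoeff g k"] by (intro mult_right_mono) auto
        also have "\<dots> \<le> \<delta> + norm (fcoeff g k) * exp (l1 k * s)"
          using analytic_dist_ge[OF h(1) gs, of k] d by (simp add: distrib_right)
        finally have "\<delta> \<le> norm (fcoeff g k) * exp (l1 k * s)" by simp
        then have "\<delta> * exp (- (l1 k * s)) \<le> norm (fcoeff g k)"
          by (simp add: exp_minus field_simps)
        \<comment> \<open>\<open>l1 k\<close> is at least 1 and the exponent negative, so the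
          uniform bound just found exceeds the required one.\<close>
        moreover have "\<delta> * l1 k powr (- ((real CARD('n) + 3) / 2)) \<le> \<delta> * 1"
          using l1_ge_1[OF Zstar_nonzero[OF k]] \<delta> powr_mono[of "- ((real CARD('n) + 3) / 2)" 0 "l1 k"]
          by (intro mult_left_mono) auto
        then have "\<delta> * l1 k powr (- ((real CARD('n) + 3) / 2)) * exp (- (l1 k * s)) \<le> \<delta> * 1 * exp (- (l1 k * s))"
          by (rule mult_right_mono) simp
        ultimately show "\<delta> * l1 k powr (- ((real CARD('n) + 3) / 2)) * exp (- (l1 k * s)) \<le> norm (fcoeff g k)"
          by simp
      qed
      then show "g \<in> nondeg c s" using \<delta> by (auto simp: nondeg_def)
    qed
  qed
qed

lemma nondeg_contains_open_dense:
  assumes s: "0 < s"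
  shows "\<exists>U. openin (analytic_top s) U \<and> analytic_top s closure_of U = analytic_space s \<and>
    U \<subseteq> (nondeg c s :: 'n::{finite,linorder} torus_fun set)"
proof (intro exI conjI)
  \<comment> \<open>The interior of \<open>nondeg c s\<close>.\<close>
  let ?U = "\<Union>{V. openin (analytic_top s) V \<and> V \<subseteq> (nondeg c s :: 'n torus_fun set)}"
  show "openin (analytic_top s) ?U" by (rule openin_Union) auto
  show "?U \<subseteq> nondeg c s" by auto
  show "analytic_top s closure_of ?U = analytic_space s"
  proof
    show "analytic_top s closure_of ?U \<subseteq> analytic_space s"
      using closure_of_subset_topspace[of "analytic_top s" ?U] by simp
    show "analytic_space s \<subseteq> analytic_top s closure_of ?U"
    proof
      fix f :: "'n torus_fun" assume f: "f \<in> analytic_space s"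
      show "f \<in> analytic_top s closure_of ?U"
        unfolding in_closure_of
      proof (intro conjI allI impI)
        show "f \<in> topspace (analytic_top s)" using f by simp
        fix T assume "f \<in> T \<and> openin (analytic_top s) T"
        then obtain e where e: "0 < e" "\<And>g. g \<in> analytic_space s \<Longrightarrow> analytic_dist s f g < e \<Longrightarrow> g \<in> T"
          unfolding openin_analytic_top by blast
        obtain h V where V: "openin (analytic_top s) V" "V \<subseteq> nondeg c s" "h \<in> V" "analytic_dist s f h < e"
          using nondeg_interior_dense[OF s f e(1)] by metis
        then have "h \<in> T" using e(2) nondeg_subset[of c s] by blast
        then show "\<exists>y. y \<in> ?U \<and> y \<in> T" using V by blast
      qed
    qed
  qed
qed

section \<open>Random Fourier coefficients\<close>

text \<open>The common model of the random functions: centre \<open>a\<close>, radii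
  \<open>w\<close>, and points \<open>z\<close> of the unit disc. The unit ball is the case of
  centre 0, kept as a literal \<open>0 +\<close>, with radii \<open>exp (- (l1 k * s))\<close>;
  prevalence shrinks the radii and moves the centre to \<open>- fcoeff g\<close>.\<close>

lemma affine_synth_in_space:
  assumes s: "0 < s" and a: "\<And>k. k \<in> Zsharp \<Longrightarrow> norm (a k) * exp (l1 k * s) \<le> C"
    and w: "\<And>k. k \<in> Zsharp \<Longrightarrow> \<bar>w k\<bar> * exp (l1 k * s) \<le> 1"
    and z: "\<And>k. k \<in> Zsharp \<Longrightarrow> norm (z k) \<le> 1"
  shows "synth (\<lambda>k. a k + of_real (w k) * z k) \<in> analytic_space s"
    "fcoeff (synth (\<lambda>k. a k + of_real (w k) * z k)) = herm (\<lambda>k. a k + of_real (w k) * z k)"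
    "\<And>k. k \<in> Zsharp \<Longrightarrow> norm (a k + of_real (w k) * z k) * exp (l1 k * s) \<le> C + 1"
proof -
  show le: "norm (a k + of_real (w k) * z k) * exp (l1 k * s) \<le> C + 1" if k: "k \<in> Zsharp" for k
  proof -
    have "norm (a k + of_real (w k) * z k) \<le> norm (a k) + \<bar>w k\<bar> * norm (z k)"
      using norm_triangle_ineq[of "a k" "of_real (w k) * z k"] by (simp add: norm_mult)
    also have "\<bar>w k\<bar> * norm (z k) \<le> \<bar>w k\<bar> * 1"
      using z[OF k] by (intro mult_left_mono) auto
    finally have "norm (a k + of_real (w k) * z k) \<le> norm (a k) + \<bar>w k\<bar>" by simp
    then have "norm (a k + of_real (w k) * z k) * exp (l1 k * s) \<le> (norm (a k) + \<bar>w k\<bar>) * exp (l1 k * s)"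
      by (rule mult_right_mono) simp
    then show ?thesis using a[OF k] w[OF k] by (simp add: distrib_right)
  qed
  show "synth (\<lambda>k. a k + of_real (w k) * z k) \<in> analytic_space s"
    "fcoeff (synth (\<lambda>k. a k + of_real (w k) * z k)) = herm (\<lambda>k. a k + of_real (w k) * z k)"
    by (rule synth_in_space[OF s le], assumption)+
qed

text \<open>Makes \<open>synth\<close> of the rescaled coefficients total, hence continuous on the full product space.\<close>
definition clip :: "complex \<Rightarrow> complex" where
  "clip = closest_point (cball 0 1)"

lemma clip: "norm (clip z) \<le> 1" "norm z \<le> 1 \<Longrightarrow> clip z = z" "continuous_on UNIV clip"
  using closest_point_in_set[of "cball 0 1" z] closest_point_self[of z "cball 0 1"]
    continuous_on_closest_point[of "cball (0::complex) 1" UNIV]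
  by (auto simp: clip_def)

text \<open>\<open>fin\<close> says that the normalised radii tend to 0. Up to a given error only
  finitely many coordinates matter, and controlling finitely many coordinates is what an open set of
  the product topology can do.\<close>

lemma continuous_map_synth:
  fixes a :: "'n::{finite,linorder} freq \<Rightarrow> complex"
  assumes s: "0 < s" and a: "\<And>k. k \<in> Zsharp \<Longrightarrow> norm (a k) * exp (l1 k * s) \<le> C"
    and w: "\<And>k. k \<in> Zsharp \<Longrightarrow> \<bar>w k\<bar> * exp (l1 k * s) \<le> 1"
    and fin: "\<And>e. 0 < e \<Longrightarrow> finite {k \<in> Zsharp. e \<le> \<bar>w k\<bar> * exp (l1 k * s)}"
  shows "continuous_map euclidean (analytic_top s) (\<lambda>z. synth (\<lambda>k. a k + of_real (w k) * clip (z k)))"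
proof -
  define \<Phi> where "\<Phi> z = synth (\<lambda>k. a k + of_real (w k) * clip (z k))" for z
  have \<Phi>: "\<Phi> z \<in> analytic_space s" "fcoeff (\<Phi> z) = herm (\<lambda>k. a k + of_real (w k) * clip (z k))" for z
    unfolding \<Phi>_def by (rule affine_synth_in_space[OF s a w], assumption+, rule clip(1))+
  have "open {z. \<Phi> z \<in> U}" if U: "openin (analytic_top s) U" for U
  proof (subst open_subopen, intro ballI)
    fix z assume "z \<in> {z. \<Phi> z \<in> U}"
    then obtain e where e: "0 < e" "\<And>g. g \<in> analytic_space s \<Longrightarrow> analytic_dist s (\<Phi> z) g < e \<Longrightarrow> g \<in> U"
      using U unfolding openin_analytic_top by blast
    \<comment> \<open>Clipped values differ by at most 2, so a coordinate outside \<open>J\<close>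
      contributes at most \<open>e / 2\<close>; inside \<open>J\<close> the neighbourhood
      \<open>T\<close> ensures the same.\<close>
    define J where "J = {k::'n freq. k \<in> Zsharp \<and> e / 4 \<le> \<bar>w k\<bar> * exp (l1 k * s)}"
    have J: "finite J" unfolding J_def by (rule fin) (use e in simp)
    define T where "T = (\<Inter>k\<in>J. {y. norm (clip (y k) - clip (z k)) < e / 2})"
    have "open T"
      unfolding T_def
    proof (intro open_INT J ballI)
      fix k
      have "continuous_on UNIV (\<lambda>y. norm (clip (y k) - clip (z k)))"
        by (intro continuous_intros continuous_on_compose2[OF clip(3)]) auto
      then show "open {y. norm (clip (y k) - clip (z k)) < e / 2}"
        by (intro open_Collect_less) auto
    qed
    moreover have "z \<in> T" using e by (simp add: T_def)
    moreover have "T \<subseteq> {z. \<Phi> z \<in> U}"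
    proof
      fix y assume y: "y \<in> T"
      have "analytic_dist s (\<Phi> z) (\<Phi> y) \<le> e / 2"
      proof (rule analytic_dist_le[OF \<Phi>(1) \<Phi>(1)])
        show "0 \<le> e / 2" using e by simp
        fix k :: "'n freq" assume k: "k \<in> Zsharp"
        have "norm (fcoeff (\<Phi> z) k - fcoeff (\<Phi> y) k) = norm (of_real (w k) * (clip (z k) - clip (y k)))"
          by (simp add: \<Phi>(2) herm_Zsharp[OF k] algebra_simps)
        also have "\<dots> = \<bar>w k\<bar> * norm (clip (y k) - clip (z k))"
          by (simp add: norm_mult norm_minus_commute)
        finally have eq: "norm (fcoeff (\<Phi> z) k - fcoeff (\<Phi> y) k) * exp (l1 k * s)
            = (\<bar>w k\<bar> * exp (l1 k * s)) * norm (clip (y k) - clip (z k))"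
          by simp
        show "norm (fcoeff (\<Phi> z) k - fcoeff (\<Phi> y) k) * exp (l1 k * s) \<le> e / 2"
        proof (cases "k \<in> J")
          case True
          then have "norm (clip (y k) - clip (z k)) < e / 2" using y by (simp add: T_def)
          then show ?thesis
            unfolding eq using w[OF k] mult_mono[of "\<bar>w k\<bar> * exp (l1 k * s)" 1 "norm (clip (y k) - clip (z k))" "e / 2"]
            by simp
        next
          case False
          then have "\<bar>w k\<bar> * exp (l1 k * s) \<le> e / 4" using k by (simp add: J_def)
          moreover have "norm (clip (y k) - clip (z k)) \<le> 2"
            using norm_triangle_ineq4[of "clip (y k)" "clip (z k)"] clip(1)[of "y k"] clip(1)[of "z k"] by linarith
          ultimately show ?thesis
            unfolding eq using mult_mono[of "\<bar>w k\<bar> * exp (l1 k * s)" "e / 4" "norm (clip (y k) - clip (z k))" 2] e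
            by simp
        qed
      qed
      then show "y \<in> {z. \<Phi> z \<in> U}" using e \<Phi>(1) by simp
    qed
    ultimately show "\<exists>T. open T \<and> z \<in> T \<and> T \<subseteq> {z. \<Phi> z \<in> U}" by blast
  qed
  then show ?thesis
    using \<Phi>(1) unfolding \<Phi>_def[symmetric] by (auto simp: continuous_map)
qed

section \<open>Measurability of the random function\<close>

lemma measurable_coordinate:
  assumes "k \<in> Zsharp"
  shows "(\<lambda>z. z k) \<in> borel_measurable lebesgue_product"
proof -
  have "(\<lambda>x. x) \<in> borel_measurable disc_measure"
    unfolding disc_measure_def by (rule measurable_restrict_space1) (simp add: uniform_measure_def)
  then show ?thesis
    unfolding lebesgue_product_def
    by (rule measurable_compose[OF measurable_component_singleton[OF assms]])
qed

lemma space_lebesgue_product: "space lebesgue_product = Pi\<^sub>E Zsharp (\<lambda>_. cball 0 1)"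
  by (simp add: lebesgue_product_def space_PiM space_disc_measure)

lemma prob_space_lebesgue_product: "prob_space lebesgue_product"
  unfolding lebesgue_product_def by (intro prob_space_PiM prob_space_disc_measure)

lemma norm_lebesgue_product: "z \<in> space lebesgue_product \<Longrightarrow> k \<in> Zsharp \<Longrightarrow> norm (z k) \<le> 1"
  by (auto simp: space_lebesgue_product PiE_iff)

text \<open>There are countably many frequencies, so the Borel sets of the product topology are the
  product algebra; this turns continuity into measurability even though the target is not
  separable.\<close>

lemma measurable_synth:
  fixes a :: "'n::{finite,linorder} freq \<Rightarrow> complex"
  assumes s: "0 < s" and a: "\<And>k. k \<in> Zsharp \<Longrightarrow> norm (a k) * exp (l1 k * s) \<le> C"
    and w: "\<And>k. k \<in> Zsharp \<Longrightarrow> \<bar>w k\<bar> * exp (l1 k * s) \<le> 1"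
    and fin: "\<And>e. 0 < e \<Longrightarrow> finite {k \<in> Zsharp. e \<le> \<bar>w k\<bar> * exp (l1 k * s)}"
  shows "(\<lambda>z. synth (\<lambda>k. a k + of_real (w k) * z k)) \<in> measurable lebesgue_product (analytic_borel s)"
proof -
  let ?\<Phi> = "\<lambda>z. synth (\<lambda>k. a k + of_real (w k) * clip (z k))"
  \<comment> \<open>Points of \<open>lebesgue_product\<close> are \<open>undefined\<close> outside
    \<open>Zsharp\<close>; they are completed by 0, which \<open>synth\<close> does not
    notice.\<close>
  let ?e = "\<lambda>(z :: 'n freq \<Rightarrow> complex) k. if k \<in> Zsharp then z k else (0::complex)"
  have c: "continuous_map euclidean (analytic_top s) ?\<Phi>"
    by (rule continuous_map_synth[OF s a w fin])
  have vim: "?\<Phi> -` U \<inter> space borel \<in> sets borel" if "U \<in> {U. openin (analytic_top s) U}" for U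
  proof -
    have "openin euclidean {z \<in> topspace euclidean. ?\<Phi> z \<in> U}"
      using c that by (auto simp: continuous_map)
    then have "open (?\<Phi> -` U)" by (simp add: vimage_def)
    then show ?thesis by simp
  qed
  have "?\<Phi> \<in> measurable borel (analytic_borel s)"
    by (rule measurable_sigma_sets[OF sets_analytic_borel _ _ vim])
       (use openin_subset[of "analytic_top s"] c in \<open>auto simp: continuous_map\<close>)
  then have m: "?\<Phi> \<in> measurable (Pi\<^sub>M UNIV (\<lambda>_. borel)) (analytic_borel s)"
    by (simp cong: measurable_cong_sets add: measurable_cong_sets[OF sets_PiM_equal_borel refl])
  have "?e \<in> measurable lebesgue_product (Pi\<^sub>M UNIV (\<lambda>_. borel))"
  proof (rule measurable_PiM_single')
    fix k :: "'n freq"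
    show "(\<lambda>z. ?e z k) \<in> borel_measurable lebesgue_product"
      using measurable_coordinate[of k] by (cases "k \<in> Zsharp") auto
  qed auto
  from measurable_compose[OF this m]
  have "(\<lambda>z. ?\<Phi> (?e z)) \<in> measurable lebesgue_product (analytic_borel s)" .
  moreover have "?\<Phi> (?e z) = synth (\<lambda>k. a k + of_real (w k) * z k)" if "z \<in> space lebesgue_product" for z
    by (rule synth_cong) (use norm_lebesgue_product[OF that] in \<open>simp add: clip(2)\<close>)
  ultimately show ?thesis
    by (simp cong: measurable_cong)
qed

section \<open>Almost sure statements\<close>

lemma AE_disc_measure:
  assumes "negligible N" shows "AE x in disc_measure. x \<notin> N"
proof -
  have "AE x in lebesgue. x \<notin> N"
    unfolding eventually_ae_filter_negligible using assms by auto
  then have "AE x in lborel. x \<notin> N"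
    by (simp add: AE_completion_iff)
  then have "AE x in uniform_measure lborel (cball 0 1). x \<notin> N"
    by (intro AE_uniform_measureI) auto
  then show ?thesis
    unfolding disc_measure_def by (subst AE_restrict_space_iff) auto
qed

text \<open>The set lies in a disc of radius \<open>r / w\<close>, whose centre alone depends on
  \<open>a\<close>. The absence of \<open>a\<close> from the bound is what makes the estimate
  invariant under translation.\<close>

lemma disc_measure_small_ball:
  assumes w: "0 < w" and r: "0 \<le> r"
  shows "emeasure disc_measure {x \<in> cball 0 1. norm (a + of_real w * x) < r} \<le> ennreal ((r / w)\<^sup>2)"
proof -
  let ?A = "{x \<in> cball 0 1. norm (a + of_real w * x) < r}"
  have "open {x. norm (a + of_real w * x) < r}"
    by (intro open_Collect_less continuous_intros)
  then have A: "?A \<in> sets borel"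
    using sets.Int[of "cball 0 1" borel "{x. norm (a + of_real w * x) < r}"] by (simp add: Int_def)
  have sub: "?A \<subseteq> ball (- a / of_real w) (r / w)"
  proof
    fix x assume "x \<in> ?A"
    moreover have "- a / of_real w - x = - ((a + of_real w * x) / of_real w)"
      using w by (simp add: field_simps)
    then have "dist (- a / of_real w) x = norm (a + of_real w * x) / w"
      using w by (simp only: dist_norm norm_minus_cancel norm_divide) simp
    ultimately show "x \<in> ball (- a / of_real w) (r / w)"
      using w by (simp add: divide_strict_right_mono)
  qed
  have "emeasure disc_measure ?A = emeasure (uniform_measure lborel (cball 0 1)) ?A"
    unfolding disc_measure_def by (intro emeasure_restrict_space) auto
  also have "\<dots> = emeasure lborel (cball 0 1 \<inter> ?A) / emeasure lborel (cball (0::complex) 1)"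
    using A by (intro emeasure_uniform_measure) auto
  also have "\<dots> \<le> emeasure lborel (ball (- a / of_real w) (r / w)) / emeasure lborel (cball (0::complex) 1)"
    using sub by (intro divide_right_mono_ennreal emeasure_mono) auto
  also have "\<dots> = ennreal (pi * (r / w)\<^sup>2) / ennreal pi"
    using w r unit_ball_vol_numeral(1)[of Num.One] by (simp add: emeasure_ball emeasure_cball)
  also have "\<dots> = ennreal ((r / w)\<^sup>2)"
    by (simp add: divide_ennreal)
  finally show ?thesis .
qed

text \<open>At width \<open>s / 2\<close> the normalised weights are at most
  \<open>exp (- (l1 k * (s / 2)))\<close>, which is the decay that \<open>measurable_synth\<close>
  needs and that the bound at width \<open>s\<close> does not give. \<open>nondeg_ray\<close> is the
  same predicate in both spaces.\<close>

lemma sets_nondeg_ray: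
  fixes a :: "'n::{finite,linorder} freq \<Rightarrow> complex"
  assumes s: "0 < s" and a: "\<And>k. k \<in> Zsharp \<Longrightarrow> norm (a k) * exp (l1 k * s) \<le> C"
    and w: "\<And>k. k \<in> Zsharp \<Longrightarrow> \<bar>w k\<bar> * exp (l1 k * s) \<le> 1" and k: "k \<noteq> 0"
  shows "{z \<in> space lebesgue_product. nondeg_ray k (synth (\<lambda>k. a k + of_real (w k) * z k))}
    \<in> sets lebesgue_product"
proof -
  let ?\<Phi> = "\<lambda>z. synth (\<lambda>k. a k + of_real (w k) * z k)"
  have half: "exp (l1 k * (s / 2)) = exp (l1 k * s) * exp (- (l1 k * (s / 2)))" for k :: "'n freq"
    by (simp add: exp_add[symmetric] field_simps)
  have s2: "0 < s / 2" using s by simp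
  have w2: "\<bar>w k\<bar> * exp (l1 k * (s / 2)) \<le> exp (- (l1 k * (s / 2)))" if "k \<in> Zsharp" for k
    unfolding half using mult_right_mono[OF w[OF that], of "exp (- (l1 k * (s / 2)))"] by (simp add: mult.assoc)
  have a': "norm (a k) * exp (l1 k * (s / 2)) \<le> C" if "k \<in> Zsharp" for k
  proof -
    have "norm (a k) * exp (l1 k * (s / 2)) \<le> norm (a k) * exp (l1 k * s)"
      using s by (intro mult_left_mono) (auto intro!: mult_left_mono)
    then show ?thesis using a[OF that] by linarith
  qed
  have w': "\<bar>w k\<bar> * exp (l1 k * (s / 2)) \<le> 1" if "k \<in> Zsharp" for k
    using order_trans[OF w2[OF that]] s by simp
  have fin: "finite {k \<in> Zsharp. e \<le> \<bar>w k\<bar> * exp (l1 k * (s / 2))}" if e: "0 < e" for e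
  proof (rule finite_subset[OF _ finite_l1_le[of "- ln e / (s / 2)"]], clarify)
    fix k :: "'n freq" assume "k \<in> Zsharp" "e \<le> \<bar>w k\<bar> * exp (l1 k * (s / 2))"
    then have "e \<le> exp (- (l1 k * (s / 2)))" using w2[of k] by linarith
    then have "ln e \<le> ln (exp (- (l1 k * (s / 2))))" using e by (intro ln_mono) auto
    then have "ln e \<le> - (l1 k * (s / 2))" by (simp only: ln_exp)
    then have "l1 k * (s / 2) \<le> - ln e" by linarith
    then show "l1 k \<le> - ln e / (s / 2)" using s2 by (simp only: pos_le_divide_eq)
  qed
  have m: "?\<Phi> \<in> measurable lebesgue_product (analytic_borel (s / 2))"
    by (rule measurable_synth[OF s2 a' w' fin])
  have "?\<Phi> -` {f \<in> analytic_space (s / 2). nondeg_ray k f} \<inter> space lebesgue_product \<in> sets lebesgue_product"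
    by (rule measurable_sets[OF m open_in_analytic_borel[OF openin_nondeg_ray[OF s2 k]]])
  also have "?\<Phi> -` {f \<in> analytic_space (s / 2). nondeg_ray k f} \<inter> space lebesgue_product
      = {z \<in> space lebesgue_product. nondeg_ray k (?\<Phi> z)}"
    using measurable_space[OF m] by auto
  finally show ?thesis .
qed

text \<open>Fubini with the coordinate at \<open>k\<close> split off: for every choice of the others
  the exceptional values form a negligible set. \<open>sets_nondeg_ray\<close> provides the joint
  measurability for exchanging the two quantifiers.\<close>

lemma AE_nondeg_ray:
  fixes a :: "'n::{finite,linorder} freq \<Rightarrow> complex"
  assumes s: "0 < s" and a: "\<And>k. k \<in> Zsharp \<Longrightarrow> norm (a k) * exp (l1 k * s) \<le> C"
    and w: "\<And>k. k \<in> Zsharp \<Longrightarrow> \<bar>w k\<bar> * exp (l1 k * s) \<le> 1"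
    and wk: "w k \<noteq> 0" and k: "k \<in> Zsharp"
  shows "AE z in lebesgue_product. nondeg_ray k (synth (\<lambda>k. a k + of_real (w k) * z k))"
proof -
  define I where "I = (Zsharp :: 'n freq set) - {k}"
  have Z: "insert k I = Zsharp" using k by (auto simp: I_def)
  let ?M2 = "Pi\<^sub>M I (\<lambda>_. disc_measure)"
  let ?u = "\<lambda>(x, X). X(k := x)"
  define P where "P z = nondeg_ray k (synth (\<lambda>k. a k + of_real (w k) * z k))" for z
  interpret M1: prob_space disc_measure by (rule prob_space_disc_measure)
  interpret M2: prob_space ?M2 by (intro prob_space_PiM prob_space_disc_measure)
  interpret pair_sigma_finite disc_measure ?M2 ..
  have L: "lebesgue_product = distr (disc_measure \<Otimes>\<^sub>M ?M2) lebesgue_product ?u"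
    using distr_pair_PiM_eq_PiM[of I "\<lambda>_. disc_measure" k] prob_space_disc_measure
    unfolding Z lebesgue_product_def by simp
  have u: "?u \<in> measurable (disc_measure \<Otimes>\<^sub>M ?M2) lebesgue_product"
    unfolding lebesgue_product_def case_prod_unfold
    by (rule measurable_fun_upd[of _ I]) (use Z in auto)
  have S: "{z \<in> space lebesgue_product. P z} \<in> sets lebesgue_product"
    unfolding P_def by (rule sets_nondeg_ray[OF s a w]) (use k in auto)
  have S2: "{y \<in> space (disc_measure \<Otimes>\<^sub>M ?M2). P (?u y)} \<in> sets (disc_measure \<Otimes>\<^sub>M ?M2)"
  proof -
    have "?u -` {z \<in> space lebesgue_product. P z} \<inter> space (disc_measure \<Otimes>\<^sub>M ?M2)
        = {y \<in> space (disc_measure \<Otimes>\<^sub>M ?M2). P (?u y)}"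
      using measurable_space[OF u] by auto
    then show ?thesis using measurable_sets[OF u S] by simp
  qed
  have "AE X in ?M2. AE x in disc_measure. P (X(k := x))"
  proof (rule AE_I2)
    fix X assume X: "X \<in> space ?M2"
    \<comment> \<open>The value at \<open>k\<close> is overwritten before use; 0 merely respects the
      bound.\<close>
    define b where "b m = (if m = k then 0 else a m + of_real (w m) * X m)" for m
    have b: "norm (b m) * exp (l1 m * s) \<le> C + 1" if m: "m \<in> Zsharp" for m
    proof (cases "m = k")
      case True
      have "0 \<le> norm (a k) * exp (l1 k * s)" by simp
      then have "0 \<le> C" using a[OF k] by linarith
      then show ?thesis using True by (simp add: b_def)
    next
      case False
      have X0: "norm ((X(k := 0)) m) \<le> 1" if "m \<in> Zsharp" for m
        using X that by (auto simp: space_PiM space_disc_measure PiE_iff I_def)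
      have "norm (a m + of_real (w m) * (X(k := 0)) m) * exp (l1 m * s) \<le> C + 1"
        by (rule affine_synth_in_space(3)[where z = "X(k := 0)", OF s a w X0 m])
      with False show ?thesis by (simp add: b_def)
    qed
    define N where "N = {w. \<not> nondeg_ray k (synth (b(k := w)))}"
    have "negligible N"
      unfolding N_def by (rule negligible_degenerate_coeff[OF s b k])
    \<comment> \<open>The exceptional coefficients are pulled back to the unit disc by inverting
      \<open>x \<mapsto> a k + w k * x\<close>, where \<open>w k \<noteq> 0\<close> enters.\<close>
    then have neg: "negligible ((\<lambda>y. (y - a k) / of_real (w k)) ` N)"
      by (rule negligible_differentiable_image_negligible[rotated])
         (use wk in \<open>auto intro!: differentiable_at_imp_differentiable_on differentiable_divide differentiable_diff\<close>)
    have good: "P (X(k := x))" if "x \<notin> (\<lambda>y. (y - a k) / of_real (w k)) ` N" for x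
    proof -
      have "a k + of_real (w k) * x \<notin> N"
      proof
        assume "a k + of_real (w k) * x \<in> N"
        moreover have "x = ((a k + of_real (w k) * x) - a k) / of_real (w k)" using wk by simp
        ultimately show False using that by blast
      qed
      moreover have "synth (\<lambda>m. a m + of_real (w m) * (X(k := x)) m) = synth (b(k := a k + of_real (w k) * x))"
        by (rule synth_cong) (auto simp: b_def)
      ultimately show ?thesis by (simp add: P_def N_def)
    qed
    show "AE x in disc_measure. P (X(k := x))"
      by (rule eventually_mono[OF AE_disc_measure[OF neg]]) (rule good)
  qed
  \<comment> \<open>\<open>AE_pair_measure\<close> wants the disc coordinate outermost, while the
    argument above freezes the other coordinates first.\<close>
  then have "AE x in disc_measure. AE X in ?M2. P (X(k := x))"
    by (subst AE_commute) (use S2 in \<open>simp_all add: case_prod_unfold\<close>)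
  then have "AE y in disc_measure \<Otimes>\<^sub>M ?M2. P (?u y)"
    by (intro AE_pair_measure S2) simp
  then have "AE z in distr (disc_measure \<Otimes>\<^sub>M ?M2) lebesgue_product ?u. P z"
    by (subst AE_distr_iff[OF u S])
  then show ?thesis unfolding L[symmetric] P_def .
qed

lemma infinite_freq: "infinite (UNIV :: 'n::finite freq set)"
proof
  assume "finite (UNIV :: 'n freq set)"
  moreover have "inj (\<lambda>j::int. (\<chi> i. j) :: 'n freq)"
    by (auto simp: inj_on_def vec_eq_iff)
  ultimately have "finite (UNIV :: int set)"
    using finite_subset[of "range (\<lambda>j::int. (\<chi> i. j) :: 'n freq)" UNIV] by (auto dest: finite_imageD)
  then show False by simp
qed

text \<open>
  Borel-Cantelli. The exponent leaves room: even with radii shrinking like \<open>l1 k powr (- 1 / 2)\<close>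
  the failure probabilities are bounded by \<open>l1 k powr (- (n + 2))\<close>, which is summable.
\<close>
lemma AE_coeff_lower_bound:
  fixes a :: "'n::{finite,linorder} freq \<Rightarrow> complex"
  assumes w0: "\<And>k. k \<in> Zsharp \<Longrightarrow> 0 < w k"
    and w1: "\<And>k. k \<in> Zsharp \<Longrightarrow> l1 k powr (- 1 / 2) \<le> w k * exp (l1 k * s)"
  shows "AE z in lebesgue_product. \<exists>R. \<forall>k\<in>Zsharp. R < l1 k \<longrightarrow>
    l1 k powr (- ((real CARD('n) + 3) / 2)) \<le> norm (a k + of_real (w k) * z k) * exp (l1 k * s)"
proof -
  interpret L: prob_space "lebesgue_product :: ('n freq \<Rightarrow> complex) measure"
    by (rule prob_space_lebesgue_product)
  define p where "p = real CARD('n) + 2"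
  define r where "r k = l1 k powr (- ((real CARD('n) + 3) / 2)) / exp (l1 k * s)" for k :: "'n freq"
  \<comment> \<open>Membership of \<open>k\<close> in \<open>Zsharp\<close> is part of the event, so
    that all frequencies can be enumerated at once; elsewhere the event is empty.\<close>
  define E where "E k = {z \<in> space lebesgue_product. k \<in> Zsharp \<and> norm (a k + of_real (w k) * z k) < r k}" for k
  \<comment> \<open>Since \<open>l1 k\<close> is at least 1 on \<open>Zsharp\<close>, it dominates
    \<open>(1 + l1 k) / 2\<close>; this passes to the summable family with \<open>1 + l1 k\<close>
    and costs the factor \<open>2 powr p\<close>.\<close>
  define g where "g k = 2 powr p * (1 + l1 k) powr (- p)" for k :: "'n freq"
  have E_sets: "E k \<in> sets lebesgue_product" for k
  proof (cases "k \<in> Zsharp")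
    case True
    note [measurable] = measurable_coordinate[OF True]
    show ?thesis unfolding E_def by measurable
  qed (simp add: E_def)
  have E_le: "measure lebesgue_product (E k) \<le> g k" for k
  proof (cases "k \<in> Zsharp")
    case k: True
    have l: "1 \<le> l1 k" using k by (intro l1_ge_1) auto
    let ?A = "{x \<in> cball 0 1. norm (a k + of_real (w k) * x) < r k}"
    have "open {x. norm (a k + of_real (w k) * x) < r k}"
      by (intro open_Collect_less continuous_intros)
    then have "?A \<in> sets borel"
      using sets.Int[of "cball 0 1" borel "{x. norm (a k + of_real (w k) * x) < r k}"] by (simp add: Int_def)
    then have A: "?A \<in> sets disc_measure" by (auto simp: sets_disc_measure)
    have m: "(\<lambda>z. z k) \<in> measurable (lebesgue_product :: ('n freq \<Rightarrow> complex) measure) disc_measure"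
      unfolding lebesgue_product_def by (rule measurable_component_singleton[OF k])
    have "E k = (\<lambda>z. z k) -` ?A \<inter> space lebesgue_product"
      using k norm_lebesgue_product by (auto simp: E_def)
    then have "emeasure lebesgue_product (E k) = emeasure (distr lebesgue_product disc_measure (\<lambda>z. z k)) ?A"
      using emeasure_distr[OF m A] by simp
    also have "\<dots> = emeasure disc_measure ?A"
      unfolding lebesgue_product_def using distr_PiM_component[of Zsharp "\<lambda>_. disc_measure" k] k prob_space_disc_measure
      by simp
    also have "\<dots> \<le> ennreal ((r k / w k)\<^sup>2)"
      by (rule disc_measure_small_ball) (use w0[OF k] in \<open>auto simp: r_def\<close>)
    also have "\<dots> \<le> ennreal (g k)"
    proof (rule ennreal_leI)
      have "r k / w k = l1 k powr (- ((real CARD('n) + 3) / 2)) / (w k * exp (l1 k * s))"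
        by (simp add: r_def mult.commute)
      also have "\<dots> \<le> l1 k powr (- ((real CARD('n) + 3) / 2)) / l1 k powr (- 1 / 2)"
        using w1[OF k] w0[OF k] l by (intro divide_left_mono) auto
      also have "\<dots> = l1 k powr (- ((real CARD('n) + 3) / 2) - (- 1 / 2))"
        by (rule powr_diff[symmetric])
      also have "- ((real CARD('n) + 3) / 2) - (- 1 / 2) = - (p / 2)"
        by (simp add: p_def field_simps)
      finally have "(r k / w k)\<^sup>2 \<le> (l1 k powr (- (p / 2)))\<^sup>2"
        using w0[OF k] by (intro power_mono) (auto simp: r_def)
      also have "\<dots> = l1 k powr (- p)"
        using l by (simp add: powr_power)
      also have "\<dots> \<le> ((1 + l1 k) / 2) powr (- p)"
        using l by (intro powr_mono2') (auto simp: p_def)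
      also have "\<dots> = g k"
        using l by (simp add: g_def powr_divide powr_minus_divide)
      finally show "(r k / w k)\<^sup>2 \<le> g k" .
    qed
    finally show ?thesis
      by (simp add: L.emeasure_eq_measure g_def)
  qed (simp add: E_def g_def)
  define e where "e = from_nat_into (UNIV :: 'n freq set)"
  have e: "bij_betw e UNIV UNIV"
    unfolding e_def by (rule bij_betw_from_nat_into[OF _ infinite_freq]) auto
  have "g summable_on UNIV"
    unfolding g_def by (rule summable_on_cmult_right, rule summable_l1_powr) (simp add: p_def)
  then have "(\<lambda>n. g (e n)) summable_on UNIV"
    using summable_on_reindex_bij_betw[OF e, of g] by simp
  then have "summable (\<lambda>n. g (e n))"
    by (rule summable_on_imp_summable)
  then have "summable (\<lambda>n. measure lebesgue_product (E (e n)))"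
    by (rule summable_comparison_test') (use E_le in auto)
  then have "AE z in lebesgue_product. eventually (\<lambda>n. z \<in> space lebesgue_product - E (e n)) sequentially"
    by (intro borel_cantelli_AE1) (auto simp: E_sets L.emeasure_eq_measure)
  then show ?thesis
  proof (rule AE_mp, intro AE_I2 impI)
    fix z assume z: "z \<in> space lebesgue_product" and "eventually (\<lambda>n. z \<in> space lebesgue_product - E (e n)) sequentially"
    then obtain N where N: "\<And>n. N \<le> n \<Longrightarrow> z \<notin> E (e n)"
      by (auto simp: eventually_sequentially)
    show "\<exists>R. \<forall>k\<in>Zsharp. R < l1 k \<longrightarrow>
      l1 k powr (- ((real CARD('n) + 3) / 2)) \<le> norm (a k + of_real (w k) * z k) * exp (l1 k * s)"
    proof (intro exI ballI impI)
      \<comment> \<open>The sum bounds \<open>l1\<close> of each of the first \<open>N\<close>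
        frequencies, so a frequency beyond it has an index of at least \<open>N\<close>.\<close>
      fix k :: "'n freq" assume k: "k \<in> Zsharp" and R: "(\<Sum>n<N. l1 (e n)) < l1 k"
      obtain n where n: "k = e n" using e by (auto simp: bij_betw_def)
      have "\<not> n < N"
        using member_le_sum[of n "{..<N}" "\<lambda>n. l1 (e n)"] R n by auto
      then have "z \<notin> E k" using N n by simp
      then have "r k \<le> norm (a k + of_real (w k) * z k)" using k z by (simp add: E_def not_less)
      then show "l1 k powr (- ((real CARD('n) + 3) / 2)) \<le> norm (a k + of_real (w k) * z k) * exp (l1 k * s)"
        by (simp add: r_def pos_divide_le_eq)
    qed
  qed
qed

lemma sets_nondeg:
  fixes a :: "'n::{finite,linorder} freq \<Rightarrow> complex"
  assumes s: "0 < s" and c: "0 \<le> c" and a: "\<And>k. k \<in> Zsharp \<Longrightarrow> norm (a k) * exp (l1 k * s) \<le> C"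
    and w: "\<And>k. k \<in> Zsharp \<Longrightarrow> \<bar>w k\<bar> * exp (l1 k * s) \<le> 1"
  shows "{z \<in> space lebesgue_product. synth (\<lambda>k. a k + of_real (w k) * z k) \<in> nondeg c s} \<in> sets lebesgue_product"
proof (rule nondeg_preimage_sets[OF s c])
  fix z :: "'n freq \<Rightarrow> complex" assume "z \<in> space lebesgue_product"
  then show "synth (\<lambda>k. a k + of_real (w k) * z k) \<in> analytic_space s"
    by (intro affine_synth_in_space(1)[OF s a w] norm_lebesgue_product)
next
  fix k :: "'n freq" and r assume k: "k \<in> Zstar"
  have kS: "k \<in> Zsharp" by (rule Zstar_subset[OF k])
  note [measurable] = measurable_coordinate[OF kS]
  have "{z \<in> space lebesgue_product. r \<le> norm (a k + of_real (w k) * z k)} \<in> sets lebesgue_product"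
    by measurable
  moreover have "fcoeff (synth (\<lambda>k. a k + of_real (w k) * z k)) k = a k + of_real (w k) * z k"
    if z: "z \<in> space lebesgue_product" for z
  proof -
    have "fcoeff (synth (\<lambda>k. a k + of_real (w k) * z k)) = herm (\<lambda>k. a k + of_real (w k) * z k)"
      by (rule affine_synth_in_space(2)[OF s a w norm_lebesgue_product[OF z]])
    then show ?thesis by (simp add: herm_Zsharp[OF kS])
  qed
  ultimately show "{z \<in> space lebesgue_product. r \<le> norm (fcoeff (synth (\<lambda>k. a k + of_real (w k) * z k)) k)}
      \<in> sets lebesgue_product"
    by (simp cong: conj_cong)
  show "{z \<in> space lebesgue_product. nondeg_ray k (synth (\<lambda>k. a k + of_real (w k) * z k))} \<in> sets lebesgue_product"
    by (rule sets_nondeg_ray[OF s a w Zstar_nonzero[OF k]])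
qed

lemma AE_nondeg:
  fixes a :: "'n::{finite,linorder} freq \<Rightarrow> complex"
  assumes s: "0 < s" and c: "0 < c" and a: "\<And>k. k \<in> Zsharp \<Longrightarrow> norm (a k) * exp (l1 k * s) \<le> C"
    and w0: "\<And>k. k \<in> Zsharp \<Longrightarrow> 0 < w k"
    and w1: "\<And>k. k \<in> Zsharp \<Longrightarrow> l1 k powr (- 1 / 2) \<le> w k * exp (l1 k * s)"
    and w2: "\<And>k. k \<in> Zsharp \<Longrightarrow> w k * exp (l1 k * s) \<le> 1"
  shows "AE z in lebesgue_product. synth (\<lambda>k. a k + of_real (w k) * z k) \<in> nondeg c s"
proof -
  have w: "\<bar>w k\<bar> * exp (l1 k * s) \<le> 1" if "k \<in> Zsharp" for k
    using w0[OF that] w2[OF that] by simp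
  have "AE z in lebesgue_product. \<forall>k\<in>Zstar. nondeg_ray k (synth (\<lambda>k. a k + of_real (w k) * z k))"
    using AE_nondeg_ray[OF s a w] w0 Zstar_subset
    by (subst AE_ball_countable) (auto simp: less_imp_neq[symmetric])
  moreover have "AE z in lebesgue_product. \<exists>R. \<forall>k\<in>Zsharp. R < l1 k \<longrightarrow>
    l1 k powr (- ((real CARD('n) + 3) / 2)) \<le> norm (a k + of_real (w k) * z k) * exp (l1 k * s)"
    by (rule AE_coeff_lower_bound[OF w0 w1])
  ultimately show ?thesis
    using AE_space
  proof eventually_elim
    fix z :: "'n freq \<Rightarrow> complex"
    let ?f = "synth (\<lambda>k. a k + of_real (w k) * z k)"
    assume rays: "\<forall>k\<in>Zstar. nondeg_ray k ?f" and z: "z \<in> space lebesgue_product"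
      and "\<exists>R. \<forall>k\<in>Zsharp. R < l1 k \<longrightarrow>
        l1 k powr (- ((real CARD('n) + 3) / 2)) \<le> norm (a k + of_real (w k) * z k) * exp (l1 k * s)"
    then obtain R where R: "\<And>k. k \<in> Zsharp \<Longrightarrow> R < l1 k \<Longrightarrow>
        l1 k powr (- ((real CARD('n) + 3) / 2)) \<le> norm (a k + of_real (w k) * z k) * exp (l1 k * s)"
      by blast
    have f: "?f \<in> analytic_space s" "fcoeff ?f = herm (\<lambda>k. a k + of_real (w k) * z k)"
      by (rule affine_synth_in_space(1,2)[OF s a w norm_lebesgue_product[OF z]]; assumption)+
    \<comment> \<open>Solves \<open>c / s * ln (1 / (s * \<delta>)) = R\<close>, capped at 1 to be
      admissible: the cutoff then reaches \<open>R\<close>, and every frequency violating the lower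
      bound lies below it.\<close>
    define \<delta> where "\<delta> = min 1 (exp (- (R * s / c)) / s)"
    have \<delta>: "0 < \<delta>" "\<delta> \<le> 1" using s by (auto simp: \<delta>_def)
    have "R \<le> cutoff c s \<delta>"
    proof -
      have "s * \<delta> \<le> s * (exp (- (R * s / c)) / s)"
        using s by (intro mult_left_mono) (auto simp: \<delta>_def)
      then have "s * \<delta> \<le> exp (- (R * s / c))" using s by simp
      then have "ln (s * \<delta>) \<le> ln (exp (- (R * s / c)))"
        using s \<delta> by (intro ln_mono) auto
      then have "R * s / c \<le> ln (1 / (s * \<delta>))"
        using s \<delta> by (simp add: ln_div)
      then have "c * (1 / s) * (R * s / c) \<le> c * (1 / s) * ln (1 / (s * \<delta>))"
        using s c by (intro mult_left_mono) auto
      then have "R \<le> c * (1 / s * ln (1 / (s * \<delta>)))"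
        using s c by (simp add: mult.assoc)
      also have "\<dots> \<le> cutoff c s \<delta>"
        unfolding cutoff_eq using c by (intro mult_left_mono) auto
      finally show ?thesis .
    qed
    have "?f \<in> nondeg_at c s \<delta>"
      unfolding nondeg_at_iff
    proof (intro conjI ballI impI)
      show "?f \<in> analytic_space s" by (rule f(1))
      fix k :: "'n freq" assume k: "k \<in> Zstar"
      then show "nondeg_ray k ?f" using rays by blast
      assume "cutoff c s \<delta> < l1 k"
      then have "l1 k powr (- ((real CARD('n) + 3) / 2)) \<le> norm (fcoeff ?f k) * exp (l1 k * s)"
        using R[OF Zstar_subset[OF k]] \<open>R \<le> cutoff c s \<delta>\<close> by (simp add: f(2) herm_Zsharp[OF Zstar_subset[OF k]])
      then have "l1 k powr (- ((real CARD('n) + 3) / 2)) * exp (- (l1 k * s)) \<le> norm (fcoeff ?f k)"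
        by (simp add: exp_minus field_simps)
      moreover have "\<delta> * (l1 k powr (- ((real CARD('n) + 3) / 2)) * exp (- (l1 k * s)))
          \<le> 1 * (l1 k powr (- ((real CARD('n) + 3) / 2)) * exp (- (l1 k * s)))"
        using \<delta> by (intro mult_right_mono) auto
      ultimately show "\<delta> * l1 k powr (- ((real CARD('n) + 3) / 2)) * exp (- (l1 k * s)) \<le> norm (fcoeff ?f k)"
        by simp
    qed
    then show "?f \<in> nondeg c s" using \<delta> by (auto simp: nondeg_def)
  qed
qed

text \<open>Cylinders generate the product algebra, so the identity is measurable from any algebra
  containing them, and a probability measure is determined there by its values on cylinders. Events
  of the product algebra thus have the same probability under every \<open>M\<close>.\<close>

lemma is_lebesgue_product_agree:
  fixes M :: "('n::{finite,linorder} freq \<Rightarrow> complex) measure"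
  assumes M: "is_lebesgue_product M"
  shows "(\<lambda>z. z) \<in> measurable M lebesgue_product" "distr M lebesgue_product (\<lambda>z. z) = lebesgue_product"
proof -
  have spM: "space M = Pi\<^sub>E Zsharp (\<lambda>_. cball 0 1)" and pM: "prob_space M"
    using M by (simp_all add: is_lebesgue_product_def)
  have cyl: "Pi\<^sub>E Zsharp A \<in> sets M" "emeasure M (Pi\<^sub>E Zsharp A) = emeasure lebesgue_product (Pi\<^sub>E Zsharp A)"
    if "\<And>k. k \<in> Zsharp \<Longrightarrow> A k \<in> sets disc_measure" "finite {k \<in> Zsharp. A k \<noteq> cball 0 1}" for A
    using that M is_lebesgue_product_lebesgue_product[where 'n = 'n]
    by (auto simp: is_lebesgue_product_def sets_disc_measure)
  show id: "(\<lambda>z. z) \<in> measurable M lebesgue_product"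
    unfolding lebesgue_product_def
  proof (rule measurable_PiM_single'[of _ "\<lambda>k z. z k"])
    fix k :: "'n freq" assume k: "k \<in> Zsharp"
    show "(\<lambda>z. z k) \<in> measurable M disc_measure"
    proof (rule measurableI)
      fix z assume "z \<in> space M"
      then show "z k \<in> space disc_measure" using k by (auto simp: spM space_disc_measure)
    next
      fix A assume A: "A \<in> sets disc_measure"
      have "Pi\<^sub>E Zsharp (\<lambda>m. if m = k then A else cball 0 1) \<in> sets M"
        by (rule cyl(1)) (use A in \<open>auto simp: sets_disc_measure intro: finite_subset[of _ "{k}"]\<close>)
      also have "Pi\<^sub>E Zsharp (\<lambda>m. if m = k then A else cball 0 1) = (\<lambda>z. z k) -` A \<inter> space M"
        using A k by (auto simp: spM PiE_iff sets_disc_measure split: if_splits) (metis mem_cball_0 subsetD)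
      finally show "(\<lambda>z. z k) -` A \<inter> space M \<in> sets M" .
    qed
  qed (auto simp: spM space_disc_measure)
  show "distr M lebesgue_product (\<lambda>z. z) = lebesgue_product"
  proof (rule measure_eqI_PiM_infinite[of _ Zsharp "\<lambda>_. disc_measure"])
    fix A :: "'n freq \<Rightarrow> complex set" and J
    assume J: "finite J" "J \<subseteq> Zsharp" and A: "\<And>k. k \<in> J \<Longrightarrow> A k \<in> sets disc_measure"
    define B where "B k = (if k \<in> J then A k else cball 0 1)" for k
    have sub: "A k \<subseteq> cball 0 1" if "k \<in> J" for k
      using A[OF that] by (simp add: sets_disc_measure)
    have "prod_emb Zsharp (\<lambda>_. disc_measure) J (Pi\<^sub>E J A)
        = Pi\<^sub>E Zsharp (\<lambda>k. if k \<in> J then A k else space disc_measure)"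
      using J(2) sub by (intro prod_emb_PiE) (simp_all add: space_disc_measure)
    then have emb: "prod_emb Zsharp (\<lambda>_. disc_measure) J (Pi\<^sub>E J A) = Pi\<^sub>E Zsharp B"
      unfolding B_def[abs_def] space_disc_measure .
    have B: "B k \<in> sets disc_measure" for k
      using A[of k] by (auto simp: B_def sets_disc_measure)
    have fin: "finite {k \<in> Zsharp. B k \<noteq> cball 0 1}"
      by (rule finite_subset[OF _ J(1)]) (auto simp: B_def)
    have "Pi\<^sub>E Zsharp B \<in> sets lebesgue_product"
      unfolding emb[symmetric] lebesgue_product_def using J A by (intro sets_PiM_I) auto
    then have "emeasure (distr M lebesgue_product (\<lambda>z. z)) (Pi\<^sub>E Zsharp B) = emeasure M (Pi\<^sub>E Zsharp B \<inter> space M)"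
      by (subst emeasure_distr[OF id]) auto
    also have "Pi\<^sub>E Zsharp B \<inter> space M = Pi\<^sub>E Zsharp B"
      using sets.sets_into_space[OF cyl(1)[OF B fin]] by auto
    finally show "emeasure (distr M lebesgue_product (\<lambda>z. z)) (prod_emb Zsharp (\<lambda>_. disc_measure) J (Pi\<^sub>E J A))
        = emeasure lebesgue_product (prod_emb Zsharp (\<lambda>_. disc_measure) J (Pi\<^sub>E J A))"
      unfolding emb using cyl(2)[OF B fin] by simp
  next
    show "finite_measure (distr M lebesgue_product (\<lambda>z. z))"
      by (intro prob_space.finite_measure prob_space.prob_space_distr[OF pM id])
  qed (simp_all add: lebesgue_product_def)
qed

section \<open>Transfer to the unit ball\<close>

lemma coeff_map_unit_ball:
  fixes f :: "'n::{finite,linorder} torus_fun"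
  assumes f: "f \<in> unit_ball s"
  shows "coeff_map s f \<in> Pi\<^sub>E Zsharp (\<lambda>_. cball 0 1)"
    "synth (\<lambda>k. 0 + of_real (exp (- (l1 k * s))) * coeff_map s f k) = f"
proof -
  have fs: "f \<in> analytic_space s" and n: "analytic_norm s f \<le> 1"
    using f by (auto simp: unit_ball_def)
  show "coeff_map s f \<in> Pi\<^sub>E Zsharp (\<lambda>_. cball 0 1)"
    using order_trans[OF analytic_spaceD(3)[OF fs] n] by (auto simp: coeff_map_def norm_mult)
  have "synth (\<lambda>k. 0 + of_real (exp (- (l1 k * s))) * coeff_map s f k) = synth (fcoeff f)"
    by (rule synth_cong) (simp add: coeff_map_def exp_minus)
  then show "synth (\<lambda>k. 0 + of_real (exp (- (l1 k * s))) * coeff_map s f k) = f"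
    by (simp add: synth_fcoeff[OF fs])
qed

lemma synth_unit_ball:
  fixes z :: "'n::{finite,linorder} freq \<Rightarrow> complex"
  assumes s: "0 < s" and z: "z \<in> Pi\<^sub>E Zsharp (\<lambda>_. cball 0 1)"
  shows "synth (\<lambda>k. 0 + of_real (exp (- (l1 k * s))) * z k) \<in> unit_ball s"
    "coeff_map s (synth (\<lambda>k. 0 + of_real (exp (- (l1 k * s))) * z k)) = z"
proof -
  let ?f = "synth (\<lambda>k. 0 + of_real (exp (- (l1 k * s))) * z k)"
  have nz: "norm (z k) \<le> 1" if "k \<in> Zsharp" for k using z that by (auto simp: PiE_iff)
  have f: "?f \<in> analytic_space s" "fcoeff ?f = herm (\<lambda>k. 0 + of_real (exp (- (l1 k * s))) * z k)"
    by (rule affine_synth_in_space[OF s, where C = 0]; use nz in \<open>simp add: exp_minus\<close>)+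
  have co: "fcoeff ?f k = of_real (exp (- (l1 k * s))) * z k" if "k \<in> Zsharp" for k
    unfolding f(2) herm_Zsharp[OF that] by simp
  have "norm (fcoeff ?f k) * exp (l1 k * s) \<le> 1" if "k \<in> Zsharp" for k
    unfolding co[OF that] using nz[OF that]
    by (simp only: norm_mult norm_of_real abs_exp_cancel) (simp add: exp_minus field_simps)
  then show "?f \<in> unit_ball s"
    unfolding unit_ball_def using f(1) by (auto intro!: analytic_norm_le)
  show "coeff_map s ?f = z"
  proof
    fix k
    show "coeff_map s ?f k = z k"
    proof (cases "k \<in> Zsharp")
      case True
      have "coeff_map s ?f k = (of_real (exp (- (l1 k * s))) * z k) * of_real (exp (l1 k * s))"
        unfolding coeff_map_def restrict_apply'[OF True] co[OF True] ..
      then show ?thesis by (simp add: exp_minus)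
    next
      case False
      then show ?thesis by (simp only: coeff_map_def restrict_apply if_False PiE_arb[OF z False])
    qed
  qed
qed

text \<open>On the space of \<open>M\<close> the inverse of \<open>coeff_map s\<close> is synthesis
  with centre 0, so the event becomes the set \<open>A\<close>. As \<open>A\<close> lies in the
  product algebra, its measure is known for every \<open>M\<close>.\<close>

lemma emeasure_induced_nondeg:
  fixes M :: "('n::{finite,linorder} freq \<Rightarrow> complex) measure"
  assumes s: "0 < s" and c: "0 < c" and M: "is_lebesgue_product M"
  shows "emeasure (induced_measure s M) ((nondeg c s :: 'n torus_fun set) \<inter> unit_ball s) = 1"
proof -
  interpret L: prob_space "lebesgue_product :: ('n freq \<Rightarrow> complex) measure"
    by (rule prob_space_lebesgue_product)
  let ?\<Psi> = "\<lambda>z :: 'n freq \<Rightarrow> complex. synth (\<lambda>k. 0 + of_real (exp (- (l1 k * s))) * z k)"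
  let ?B = "unit_ball s :: 'n torus_fun set"
  let ?g = "the_inv_into ?B (coeff_map s)"
  define A where "A = {z \<in> space lebesgue_product. ?\<Psi> z \<in> nondeg c s}"
  have spM: "space M = Pi\<^sub>E Zsharp (\<lambda>_. cball 0 1)"
    using M by (simp add: is_lebesgue_product_def)
  have A: "A \<in> sets lebesgue_product"
    unfolding A_def by (rule sets_nondeg[OF s, where C = 0]) (use c in \<open>auto simp: exp_minus\<close>)
  have "AE z in lebesgue_product. ?\<Psi> z \<in> nondeg c s"
  proof (rule AE_nondeg[OF s c, where C = 0])
    fix k :: "'n freq" assume "k \<in> Zsharp"
    then have "1 \<le> l1 k" by (intro l1_ge_1) auto
    then show "l1 k powr (- 1 / 2) \<le> exp (- (l1 k * s)) * exp (l1 k * s)"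
      using powr_mono[of "- 1 / 2" 0 "l1 k"] by (simp add: exp_minus)
  qed (auto simp: exp_minus)
  then have "emeasure lebesgue_product A = 1"
    by (intro L.emeasure_eq_1_AE A) (auto simp: A_def elim: AE_mp)
  moreover note agree = is_lebesgue_product_agree[OF M]
  have "emeasure (distr M lebesgue_product (\<lambda>z. z)) A = emeasure M (A \<inter> space M)"
    by (subst emeasure_distr[OF agree(1) A]) auto
  moreover have "A \<inter> space M = A"
    by (auto simp: A_def spM space_lebesgue_product)
  ultimately have MA: "emeasure M A = 1" by (simp add: agree(2))
  have A_M: "A \<in> sets M"
    using measurable_sets[OF agree(1) A] \<open>A \<inter> space M = A\<close> by simp
  have inj: "inj_on (coeff_map s) ?B"
    by (rule inj_on_inverseI[of _ ?\<Psi>]) (rule coeff_map_unit_ball(2))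
  have g: "?g z = ?\<Psi> z" if "z \<in> space M" for z
    using synth_unit_ball[OF s, of z] that by (intro the_inv_into_f_eq[OF inj]) (auto simp: spM)
  have T: "nondeg c s \<inter> ?B = coeff_map s -` A \<inter> ?B"
    using coeff_map_unit_ball by (fastforce simp: A_def space_lebesgue_product)
  have g_meas: "?g \<in> measurable M (vimage_algebra ?B (coeff_map s) M)"
  proof (rule measurable_vimage_algebra2)
    show "?g \<in> space M \<rightarrow> ?B"
      using synth_unit_ball(1)[OF s] by (auto simp: g spM)
    have "coeff_map s (?g z) = z" if "z \<in> space M" for z
      using synth_unit_ball(2)[OF s, of z] that by (simp add: g spM)
    then show "(\<lambda>z. coeff_map s (?g z)) \<in> measurable M M"
      by (simp cong: measurable_cong)
  qed
  have "nondeg c s \<inter> ?B \<in> sets (vimage_algebra ?B (coeff_map s) M)"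
    unfolding T by (rule in_vimage_algebra[OF A_M])
  then have "emeasure (induced_measure s M) (nondeg c s \<inter> ?B) = emeasure M (?g -` (nondeg c s \<inter> ?B) \<inter> space M)"
    unfolding induced_measure_def by (rule emeasure_distr[OF g_meas])
  also have "?g -` (nondeg c s \<inter> ?B) \<inter> space M = A"
    using synth_unit_ball(1)[OF s] by (auto simp: g A_def spM space_lebesgue_product)
  finally show ?thesis using MA by simp
qed

section \<open>Prevalence\<close>

lemma analytic_translation_measurable:
  fixes g :: "'n::{finite,linorder} torus_fun"
  assumes g: "g \<in> analytic_space s"
  shows "(\<lambda>f x. f x - g x) \<in> measurable (analytic_borel s) (analytic_borel s)"
proof (rule measurable_sigma_sets[OF sets_analytic_borel])
  show "{U. openin (analytic_top s) U} \<subseteq> Pow (analytic_space s :: 'n torus_fun set)"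
    using openin_subset[of "analytic_top s"] by auto
  show "(\<lambda>f x. f x - g x) \<in> space (analytic_borel s) \<rightarrow> analytic_space s"
    using analytic_space_diff[OF _ g] by auto
  fix U :: "'n torus_fun set" assume U: "U \<in> {U. openin (analytic_top s) U}"
  have "openin (analytic_top s) ((\<lambda>f x. f x - g x) -` U \<inter> analytic_space s)"
    unfolding openin_analytic_top
  proof (intro conjI ballI)
    fix f assume "f \<in> (\<lambda>f x. f x - g x) -` U \<inter> analytic_space s"
    then have f: "f \<in> analytic_space s" and "(\<lambda>x. f x - g x) \<in> U" by auto
    then obtain e where e: "0 < e" "\<And>h. h \<in> analytic_space s \<Longrightarrow>
        analytic_dist s (\<lambda>x. f x - g x) h < e \<Longrightarrow> h \<in> U"
      using U unfolding openin_analytic_top by blast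
    have "(\<lambda>x. h x - g x) \<in> U" if h: "h \<in> analytic_space s" "analytic_dist s f h < e" for h
      using that f g by (intro e(2)) (simp_all add: analytic_space_diff analytic_dist_def)
    then show "\<exists>e>0. \<forall>h\<in>analytic_space s. analytic_dist s f h < e \<longrightarrow>
        h \<in> (\<lambda>f x. f x - g x) -` U \<inter> analytic_space s"
      using e(1) by blast
  qed auto
  then show "(\<lambda>f x. f x - g x) -` U \<inter> space (analytic_borel s) \<in> sets (analytic_borel s)"
    by (simp add: open_in_analytic_borel)
qed

text \<open>One measure serves all translates: a function lies in the translate by \<open>g\<close>
  iff its difference with \<open>g\<close> is non-degenerate, and subtracting \<open>g\<close> only
  moves the centre to \<open>- fcoeff g\<close>, which \<open>AE_nondeg\<close> allows.\<close>

lemma prevalent_nondeg: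
  assumes s: "0 < s" and c: "0 < c"
  shows "prevalent s (nondeg c s :: 'n::{finite,linorder} torus_fun set)"
proof -
  interpret L: prob_space "lebesgue_product :: ('n freq \<Rightarrow> complex) measure"
    by (rule prob_space_lebesgue_product)
  define w where "w k = l1 k powr (- 1 / 2) * exp (- (l1 k * s))" for k :: "'n freq"
  have we: "w k * exp (l1 k * s) = l1 k powr (- 1 / 2)" for k
    by (simp add: w_def exp_minus)
  have l: "1 \<le> l1 k" if "k \<in> Zsharp" for k :: "'n freq"
    using that by (intro l1_ge_1) auto
  have w0: "0 < w k" if "k \<in> Zsharp" for k
    using l[OF that] by (simp add: w_def)
  have w1: "w k * exp (l1 k * s) \<le> 1" if "k \<in> Zsharp" for k
    unfolding we using l[OF that] powr_mono[of "- 1 / 2" 0 "l1 k"] by simp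
  have w2: "\<bar>w k\<bar> * exp (l1 k * s) \<le> 1" if "k \<in> Zsharp" for k
    using w0[OF that] w1[OF that] by simp
  have fin: "finite {k \<in> Zsharp. e \<le> \<bar>w k\<bar> * exp (l1 k * s)}" if e: "0 < e" for e
  \<comment> \<open>The normalised radius \<open>l1 k powr (- 1 / 2)\<close> reaches
    \<open>e\<close> only if \<open>l1 k\<close> is at most \<open>e powr (- 2)\<close>.\<close>
  proof (rule finite_subset[OF _ finite_l1_le[of "e powr (- 2)"]], clarify)
    fix k :: "'n freq" assume k: "k \<in> Zsharp" "e \<le> \<bar>w k\<bar> * exp (l1 k * s)"
    then have "e \<le> l1 k powr (- 1 / 2)" using w0[OF k(1)] we[of k] by simp
    then have "(l1 k powr (- 1 / 2)) powr (- 2) \<le> e powr (- 2)"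
      using e by (intro powr_mono2') auto
    then show "l1 k \<le> e powr (- 2)" using l[OF k(1)] by (simp add: powr_powr)
  qed
  have a0: "norm ((\<lambda>_. 0::complex) k) * exp (l1 k * s) \<le> 0" for k :: "'n freq" by simp
  define \<Phi> where "\<Phi> z = synth (\<lambda>k. 0 + of_real (w k) * z k)" for z
  have m: "\<Phi> \<in> measurable lebesgue_product (analytic_borel s)"
    unfolding \<Phi>_def[abs_def] by (rule measurable_synth[OF s a0 w2 fin])
  define \<nu> where "\<nu> = distr lebesgue_product (analytic_borel s) \<Phi>"
  interpret \<nu>: prob_space \<nu>
    unfolding \<nu>_def by (rule L.prob_space_distr[OF m])
  \<comment> \<open>The product of closed discs is compact by Tychonoff, and clipped synthesis is
    continuous on it because the normalised radii tend to 0.\<close>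
  define C where "C = (\<lambda>z. synth (\<lambda>k. 0 + of_real (w k) * clip (z k))) ` (Pi\<^sub>E UNIV (\<lambda>_. cball 0 1))"
  have "compactin (product_topology (\<lambda>_::'n freq. euclidean) UNIV) (Pi\<^sub>E UNIV (\<lambda>_. cball (0::complex) 1))"
    by (subst compactin_PiE) auto
  then have "compactin euclidean (Pi\<^sub>E (UNIV :: 'n freq set) (\<lambda>_. cball (0::complex) 1))"
    by (simp add: euclidean_product_topology)
  then have C: "compactin (analytic_top s) C"
    unfolding C_def by (rule image_compactin[OF _ continuous_map_synth[OF s a0 w2 fin]])
  have C_sets: "C \<in> sets (analytic_borel s)"
  proof -
    interpret Metric_space "analytic_space s" "analytic_dist s :: 'n torus_fun \<Rightarrow> _"
      by (rule Metric_space_analytic)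
    have "closedin (analytic_top s) C"
      using C unfolding analytic_top_def by (rule compactin_imp_closedin[OF Hausdorff_space_mtopology])
    then have "openin (analytic_top s) (analytic_space s - C)" "C \<subseteq> analytic_space s"
      by (auto simp: closedin_def)
    then have "space (analytic_borel s) - (analytic_space s - C) \<in> sets (analytic_borel s)"
      by (intro sets.compl_sets open_in_analytic_borel)
    then show ?thesis using \<open>C \<subseteq> analytic_space s\<close> by (simp add: double_diff)
  qed
  have "\<Phi> z \<in> C" if "z \<in> space lebesgue_product" for z
  proof -
    let ?y = "\<lambda>k. if k \<in> Zsharp then z k else 0"
    have eq: "\<Phi> z = synth (\<lambda>k. 0 + of_real (w k) * clip (?y k))"
      unfolding \<Phi>_def by (rule synth_cong) (use norm_lebesgue_product[OF that] in \<open>simp add: clip(2)\<close>)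
    have mem: "?y \<in> Pi\<^sub>E UNIV (\<lambda>_. cball 0 1)"
      using norm_lebesgue_product[OF that] by auto
    show ?thesis
      unfolding C_def by (rule image_eqI[where x = ?y], rule eq, rule mem)
  qed
  then have "AE z in lebesgue_product. \<Phi> z \<in> C" by (intro AE_I2)
  then have "AE f in \<nu>. f \<in> C"
    unfolding \<nu>_def using C_sets sets.sets_into_space[OF C_sets]
    by (subst AE_distr_iff[OF m]) (auto simp: Collect_conj_eq Int_absorb1)
  then have \<nu>C: "emeasure \<nu> C = 1"
    by (intro \<nu>.emeasure_eq_1_AE) (simp_all add: \<nu>_def C_sets)
  have trans: "emeasure \<nu> ((\<lambda>f x. f x + g x) ` (nondeg c s)) = 1" if g: "g \<in> analytic_space s" for g :: "'n torus_fun"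
  proof -
    let ?t = "\<lambda>f x. f x - g x"
    have "(\<lambda>f x. f x + g x) ` (nondeg c s) = ?t -` nondeg c s \<inter> space (analytic_borel s)" (is "?P = _")
    proof (intro equalityI subsetI)
      fix h assume "h \<in> (\<lambda>f x. f x + g x) ` (nondeg c s)"
      then obtain f where "f \<in> nondeg c s" "h = (\<lambda>x. f x + g x)" by blast
      then show "h \<in> ?t -` nondeg c s \<inter> space (analytic_borel s)"
        using analytic_space_add(1)[OF s _ g, of f] nondeg_subset[of c s] by auto
    next
      fix h assume "h \<in> ?t -` nondeg c s \<inter> space (analytic_borel s)"
      then show "h \<in> (\<lambda>f x. f x + g x) ` (nondeg c s)"
        by (intro image_eqI[of _ _ "?t h"]) auto
    qed
    then have P: "?P \<in> sets (analytic_borel s)"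
      using measurable_sets[OF analytic_translation_measurable[OF g] nondeg_borel[OF s]] c by simp
    have mg: "norm (- fcoeff g k) * exp (l1 k * s) \<le> analytic_norm s g" for k
      using analytic_spaceD(3)[OF g, of k] by simp
    have ae: "AE z in lebesgue_product. synth (\<lambda>k. - fcoeff g k + of_real (w k) * z k) \<in> nondeg c s"
      by (rule AE_nondeg[OF s c mg w0 _ w1]) (simp_all add: we)
    have eq: "synth (\<lambda>k. - fcoeff g k + of_real (w k) * z k) = ?t (\<Phi> z)"
      if z: "z \<in> space lebesgue_product" for z
    proof (rule analytic_space_eqI)
      have f: "\<Phi> z \<in> analytic_space s" "fcoeff (\<Phi> z) = herm (\<lambda>k. 0 + of_real (w k) * z k)"
        unfolding \<Phi>_def by (rule affine_synth_in_space(1,2)[OF s a0 w2 norm_lebesgue_product[OF z]]; assumption)+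
      have h: "synth (\<lambda>k. - fcoeff g k + of_real (w k) * z k) \<in> analytic_space s"
        "fcoeff (synth (\<lambda>k. - fcoeff g k + of_real (w k) * z k)) = herm (\<lambda>k. - fcoeff g k + of_real (w k) * z k)"
        by (rule affine_synth_in_space(1,2)[OF s mg w2 norm_lebesgue_product[OF z]]; assumption)+
      show "synth (\<lambda>k. - fcoeff g k + of_real (w k) * z k) \<in> analytic_space s" by (rule h(1))
      show "?t (\<Phi> z) \<in> analytic_space s" by (rule analytic_space_diff[OF f(1) g])
      show "fcoeff (synth (\<lambda>k. - fcoeff g k + of_real (w k) * z k)) k = fcoeff (?t (\<Phi> z)) k"
        if "k \<in> Zsharp" for k
        unfolding fcoeff_diff[OF f(1) g] f(2) h(2) herm_Zsharp[OF that] by simp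
    qed
    from ae AE_space have "AE z in lebesgue_product. \<Phi> z \<in> ?P"
    proof eventually_elim
      case (elim z)
      then have "?t (\<Phi> z) \<in> nondeg c s" by (simp only: eq)
      then show ?case by (rule rev_image_eqI) simp
    qed
    then have "AE f in \<nu>. f \<in> ?P"
      unfolding \<nu>_def using P sets.sets_into_space[OF P]
      by (subst AE_distr_iff[OF m]) (auto simp: Collect_conj_eq Int_absorb1)
    then show ?thesis
      by (intro \<nu>.emeasure_eq_1_AE) (simp_all add: \<nu>_def P)
  qed
  show ?thesis
    unfolding prevalent_def
  proof (intro conjI exI[of _ \<nu>] ballI)
    show "nondeg c s \<subseteq> analytic_space s" by (rule nondeg_subset)
    show "prob_space \<nu>" by (rule \<nu>.prob_space_axioms)
    show "space \<nu> = analytic_space s" "sets \<nu> = sets (analytic_borel s)" by (simp_all add: \<nu>_def)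
    show "\<exists>C. compactin (analytic_top s) C \<and> emeasure \<nu> C = 1" using C \<nu>C by blast
  qed (rule trans)
qed

theorem proposition1p1:
  shows "\<exists>c0>1. \<forall>c\<ge>c0. \<forall>s>0.
    (\<exists>U. openin (analytic_top s) U \<and> analytic_top s closure_of U = analytic_space s \<and>
         U \<subseteq> (nondeg c s :: ('n::{finite,linorder}) torus_fun set)) \<and>
    prevalent s (nondeg c s :: 'n torus_fun set) \<and>
    (nondeg c s :: 'n torus_fun set) \<inter> unit_ball s
      \<in> sets (restrict_space (analytic_borel s) (unit_ball s)) \<and>
    emeasure (induced_measure s lebesgue_product)
      ((nondeg c s :: 'n torus_fun set) \<inter> unit_ball s) = 1 \<and>
    (\<forall>M. is_lebesgue_product M \<longrightarrow>
       emeasure (induced_measure s M) ((nondeg c s :: 'n torus_fun set) \<inter> unit_ball s) = 1)"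
\<comment> \<open>Any number above 1 can serve as the witness: the lemmas applied below hold for
  every positive \<open>c\<close>.\<close>
proof (intro exI[of _ "2::real"] conjI allI impI)
  fix c s :: real assume "2 \<le> c" and s: "0 < s"
  then have c: "0 < c" by simp
  show "\<exists>U. openin (analytic_top s) U \<and> analytic_top s closure_of U = analytic_space s \<and>
      U \<subseteq> (nondeg c s :: 'n torus_fun set)"
    by (rule nondeg_contains_open_dense[OF s])
  show "prevalent s (nondeg c s :: 'n torus_fun set)"
    by (rule prevalent_nondeg[OF s c])
  show "(nondeg c s :: 'n torus_fun set) \<inter> unit_ball s \<in> sets (restrict_space (analytic_borel s) (unit_ball s))"
    using nondeg_borel[OF s, of c] c by (auto simp: sets_restrict_space)
  show ind: "emeasure (induced_measure s M) ((nondeg c s :: 'n torus_fun set) \<inter> unit_ball s) = 1"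
    if "is_lebesgue_product M" for M
    by (rule emeasure_induced_nondeg[OF s c that])
  show "emeasure (induced_measure s lebesgue_product) ((nondeg c s :: 'n torus_fun set) \<inter> unit_ball s) = 1"
    by (rule ind[OF is_lebesgue_product_lebesgue_product])
qed simp

end
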